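(* Fix any $\delta \le 1/2$. Under the data model below, take any covariance splitting $\Sigma=\Sigma_1\oplus\Sigma_2$ with $\Sigma_2\ne0$. Let $\gamma = C_1\left(\sqrt{\frac{\log(1/\delta)}{r(\Sigma_2)}} + \sqrt{\frac{\log(1/\delta)}{n}} + \sqrt{\frac{\operatorname{rank}(\Sigma_1)}{n}}\right)$ with an absolute constant $C_1 \le 66$, and let $\epsilon$ be a quantity with $\epsilon \le C\left(\sqrt{\frac{\log(1/\delta)}{r(\Sigma_2)}} + \sqrt{\frac{\log(1/\delta)}{n}} + \frac{n\log(1/\delta)}{R(\Sigma_2)}\right)$ for an absolute constant $C$ (the same $\gamma,\epsilon$ as in the Euclidean uniform convergence and norm bounds). There is an absolute constant $c>0$ such that if $R(\Sigma_2) \ge c\log(1/\delta)^2$ and $\gamma,\epsilon\le 1$, then with probability at least $1-\delta$ the minimal Euclidean norm interpolator $\hat w$ satisfies $$L(\hat w) \le (1+\gamma)(1+\epsilon)\left(\sigma + \|w^*\|_2\sqrt{\frac{\operatorname{Tr}(\Sigma_2)}{n}}\right)^2.$$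
   Context: Data model: $d \ge n$; $\Sigma \in \mathbb{R}^{d\times d}$ is positive semidefinite; $w^* \in \mathbb{R}^d$ arbitrary; $\sigma\ge0$. $X \in \mathbb{R}^{n\times d}$ has i.i.d. rows $X_i \sim N(0,\Sigma)$, $\xi \sim N(0,\sigma^2 I_n)$ independent of $X$, $Y = Xw^*+\xi$. $L(w) = \sigma^2 + \|w-w^*\|_\Sigma^2$ with $\|x\|_A^2 := \langle x,Ax\rangle$. $\hat w \in \arg\min\{\|w\|_2 : Xw=Y\}$. Covariance splitting: $\Sigma = \Sigma_1\oplus\Sigma_2$ means $\Sigma=\Sigma_1+\Sigma_2$, both positive semidefinite, with orthogonal column spaces. Effective ranks: $r(A) = \operatorname{Tr}(A)/\|A\|_{op}$, $R(A) = \operatorname{Tr}(A)^2/\operatorname{Tr}(A^2)$. *)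

theory Defs
  imports "HOL-Analysis.Analysis" "HOL-Probability.Probability"
begin

text \<open>Vectors in R^k are functions nat => real, only indices < k matter.
  Matrices are functions nat => nat => real, entry (i,j) = M i j, i < rows, j < cols.\<close>

definition vnorm :: "nat \<Rightarrow> (nat \<Rightarrow> real) \<Rightarrow> real" where
  "vnorm k x = sqrt (\<Sum>j<k. (x j)\<^sup>2)"

definition mvmul :: "nat \<Rightarrow> (nat \<Rightarrow> nat \<Rightarrow> real) \<Rightarrow> (nat \<Rightarrow> real) \<Rightarrow> (nat \<Rightarrow> real)" where
  "mvmul k M x = (\<lambda>i. \<Sum>j<k. M i j * x j)"

definition qform :: "nat \<Rightarrow> (nat \<Rightarrow> nat \<Rightarrow> real) \<Rightarrow> (nat \<Rightarrow> real) \<Rightarrow> real" where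
  "qform k A x = (\<Sum>i<k. \<Sum>j<k. x i * A i j * x j)"

definition psd :: "nat \<Rightarrow> (nat \<Rightarrow> nat \<Rightarrow> real) \<Rightarrow> bool" where
  "psd k A \<longleftrightarrow> (\<forall>i<k. \<forall>j<k. A i j = A j i) \<and> (\<forall>x. 0 \<le> qform k A x)"

definition mtrace :: "nat \<Rightarrow> (nat \<Rightarrow> nat \<Rightarrow> real) \<Rightarrow> real" where
  "mtrace k A = (\<Sum>i<k. A i i)"

definition mtrace_sq :: "nat \<Rightarrow> (nat \<Rightarrow> nat \<Rightarrow> real) \<Rightarrow> real" where
  "mtrace_sq k A = (\<Sum>i<k. \<Sum>j<k. A i j * A j i)"

definition op_norm :: "nat \<Rightarrow> (nat \<Rightarrow> nat \<Rightarrow> real) \<Rightarrow> real" where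
  "op_norm k A = Sup {vnorm k (mvmul k A x) | x. vnorm k x \<le> 1}"

definition cols_indep :: "nat \<Rightarrow> (nat \<Rightarrow> nat \<Rightarrow> real) \<Rightarrow> nat set \<Rightarrow> bool" where
  "cols_indep k A S \<longleftrightarrow>
     (\<forall>c. (\<forall>i<k. (\<Sum>j\<in>S. c j * A i j) = 0) \<longrightarrow> (\<forall>j\<in>S. c j = 0))"

definition mrank :: "nat \<Rightarrow> (nat \<Rightarrow> nat \<Rightarrow> real) \<Rightarrow> nat" where
  "mrank k A = Max {card S | S. S \<subseteq> {..<k} \<and> cols_indep k A S}"

definition eff_rank_r :: "nat \<Rightarrow> (nat \<Rightarrow> nat \<Rightarrow> real) \<Rightarrow> real" where
  "eff_rank_r k A = mtrace k A / op_norm k A"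

definition eff_rank_R :: "nat \<Rightarrow> (nat \<Rightarrow> nat \<Rightarrow> real) \<Rightarrow> real" where
  "eff_rank_R k A = (mtrace k A)\<^sup>2 / mtrace_sq k A"

definition cov_split :: "nat \<Rightarrow> (nat \<Rightarrow> nat \<Rightarrow> real) \<Rightarrow> (nat \<Rightarrow> nat \<Rightarrow> real)
    \<Rightarrow> (nat \<Rightarrow> nat \<Rightarrow> real) \<Rightarrow> bool" where
  "cov_split k S S1 S2 \<longleftrightarrow>
     (\<forall>i<k. \<forall>j<k. S i j = S1 i j + S2 i j) \<and> psd k S1 \<and> psd k S2 \<and>
     (\<forall>a<k. \<forall>b<k. (\<Sum>i<k. S1 i a * S2 i b) = 0)"

definition min_norm_interp :: "nat \<Rightarrow> nat \<Rightarrow> (nat \<Rightarrow> nat \<Rightarrow> real) \<Rightarrow> (nat \<Rightarrow> real)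
    \<Rightarrow> (nat \<Rightarrow> real) \<Rightarrow> bool" where
  "min_norm_interp n d X Y w \<longleftrightarrow>
     (\<forall>i<n. mvmul d X w i = Y i) \<and>
     (\<forall>v. (\<forall>i<n. mvmul d X v i = Y i) \<longrightarrow> vnorm d w \<le> vnorm d v)"

definition pop_loss :: "nat \<Rightarrow> (nat \<Rightarrow> nat \<Rightarrow> real) \<Rightarrow> real \<Rightarrow> (nat \<Rightarrow> real)
    \<Rightarrow> (nat \<Rightarrow> real) \<Rightarrow> real" where
  "pop_loss d S \<sigma> wstar w = \<sigma>\<^sup>2 + qform d S (\<lambda>j. w j - wstar j)"

text \<open>Standard Gaussian on R and the sample space: i.i.d. standard Gaussians
  Z(i,k) (i<n, k<d) for the design and g i (i<n) for the noise.\<close>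
definition std_gauss :: "real measure" where
  "std_gauss = density lborel std_normal_density"

definition sample_space :: "nat \<Rightarrow> nat \<Rightarrow> (((nat \<times> nat) \<Rightarrow> real) \<times> (nat \<Rightarrow> real)) measure" where
  "sample_space n d =
     (PiM ({..<n} \<times> {..<d}) (\<lambda>_. std_gauss)) \<Otimes>\<^sub>M (PiM {..<n} (\<lambda>_. std_gauss))"

text \<open>Design matrix with i.i.d. rows X_i = A z_i ~ N(0, A A^T), and responses
  Y = X w* + xi with xi = sigma * g ~ N(0, sigma^2 I_n).\<close>
definition design :: "nat \<Rightarrow> (nat \<Rightarrow> nat \<Rightarrow> real) \<Rightarrow> ((nat \<times> nat) \<Rightarrow> real) \<Rightarrow> (nat \<Rightarrow> nat \<Rightarrow> real)" where
  "design d A Z = (\<lambda>i j. \<Sum>k<d. A j k * Z (i, k))"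

definition response :: "nat \<Rightarrow> (nat \<Rightarrow> nat \<Rightarrow> real) \<Rightarrow> real \<Rightarrow> (nat \<Rightarrow> real)
    \<Rightarrow> ((nat \<times> nat) \<Rightarrow> real) \<times> (nat \<Rightarrow> real) \<Rightarrow> (nat \<Rightarrow> real)" where
  "response d A \<sigma> wstar \<omega> = (\<lambda>i. mvmul d (design d A (fst \<omega>)) wstar i + \<sigma> * snd \<omega> i)"

end

(* Write T = Tr Sigma2, R = R(Sigma2), L = ln (1/delta) and b = |w*| sqrt (T/n).  Instead of going
   through uniform convergence and Gordon's comparison theorem, the interpolator is analysed directly.
   In a common orthonormal eigenbasis of Sigma1 and Sigma2 the design splits into a block S (the range
   of Sigma1 and the eigendirections of Sigma2 with eigenvalue above T/(1000 n)) and the remaining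
   block B.  Since R is much larger than n, |S| exceeds rank Sigma1 by at most a constant times n^2/R
   and stays below n/4000, so the design is a near isometry on S, while the Gram matrix K of the block
   B is between 0.9 T and 1.1 T: both are shown with a net and exponential moments of Gaussian
   quadratic forms.  The error w - w* is the sum of a bias term, linear in w*, and a noise term.
   For a fixed w* the squared bias is at most 0.62 b^2, and the noise contributes at most
   sigma^2 theta with theta of order rank(Sigma1)/n + L/n + n L/R.  Hence the risk is at most
   (1 + theta) (sigma + b)^2, the cross term of bias and noise being absorbed by the one of
   (sigma + b)^2, and theta <= gamma + epsilon. *)

theory Submission
  imports Defs
begin

section \<open>Orthonormal eigenbases\<close>

text \<open>The design is only a rough isometry on S, because passing from a net to all vectors
  doubles the deviation; yet the bias must stay below \<open>b\<^sup>2\<close> with constant 1. The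
  room comes from completing a square. For the part v of the parameter that the design annihilates,
  let M be the image of v_S and a2 = <M, K^-1 M>. Up to a cross term, |v_S|^2 + a2 = <v_S, w_S>, so
  a2 is at most about |w_S|^2 / 4, and this quarter pays for the isometry constant 2. Eigenvalues on
  S may be arbitrarily large; they cancel in the noise part because risk and noise carry the same
  weight \<open>sqrt (m j)\<close>. The threshold T/(1000 n) comes from the net of the sample space:
  beating its at most 22^n points at deviation T/25 needs a Chernoff parameter of order n/T,
  admissible only for eigenvalues of order T/n at most. The noise bounds are conditional on the
  design and are integrated by Tonelli, so the inverse of K has to be measurable in the design; it
  is therefore built as the limit of an explicit iteration.\<close>

definition dot :: "'i set \<Rightarrow> ('i \<Rightarrow> real) \<Rightarrow> ('i \<Rightarrow> real) \<Rightarrow> real" where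
  "dot I x y = (\<Sum>i\<in>I. x i * y i)"

lemma dot_commute: "dot I x y = dot I y x"
  by (simp add: dot_def mult.commute)

lemma dot_add_left: "dot I (\<lambda>i. x i + y i) z = dot I x z + dot I y z"
  and dot_add_right: "dot I z (\<lambda>i. x i + y i) = dot I z x + dot I z y"
  and dot_diff_left: "dot I (\<lambda>i. x i - y i) z = dot I x z - dot I y z"
  and dot_diff_right: "dot I z (\<lambda>i. x i - y i) = dot I z x - dot I z y"
  and dot_scale_left: "dot I (\<lambda>i. a * x i) z = a * dot I x z"
  and dot_scale_right: "dot I z (\<lambda>i. a * x i) = a * dot I z x"
  by (simp_all add: dot_def algebra_simps sum.distrib sum_subtractf sum_distrib_left)

lemma dot_sum_left: "dot I (\<lambda>i. \<Sum>j\<in>J. f j i) z = (\<Sum>j\<in>J. dot I (f j) z)"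
proof -
  have "dot I (\<lambda>i. \<Sum>j\<in>J. f j i) z = (\<Sum>i\<in>I. \<Sum>j\<in>J. f j i * z i)"
    by (simp add: dot_def sum_distrib_right)
  also have "\<dots> = (\<Sum>j\<in>J. \<Sum>i\<in>I. f j i * z i)" by (rule sum.swap)
  finally show ?thesis by (simp add: dot_def)
qed

lemma dot_sum_right: "dot I z (\<lambda>i. \<Sum>j\<in>J. f j i) = (\<Sum>j\<in>J. dot I z (f j))"
  by (simp add: dot_commute[of I z] dot_sum_left)

lemma dot_self_nonneg: "0 \<le> dot I x x"
  by (simp add: dot_def sum_nonneg)

lemma dot_self_eq_0: "finite I \<Longrightarrow> dot I x x = 0 \<longleftrightarrow> (\<forall>i\<in>I. x i = 0)"
  by (simp add: dot_def sum_nonneg_eq_0_iff)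

lemma dot_Cauchy_Schwarz: "(dot I x y)\<^sup>2 \<le> dot I x x * dot I y y"
  using Cauchy_Schwarz_ineq_sum[of x y I] by (simp add: dot_def power2_eq_square)

text \<open>Orthonormality of the rows and of the columns are both kept as data: the column
  relations give the expansion of a vector in the basis directly, and a plane rotation preserves
  both.\<close>

definition orthonormal_basis :: "nat \<Rightarrow> (nat \<Rightarrow> nat \<Rightarrow> real) \<Rightarrow> bool" where
  "orthonormal_basis d e \<longleftrightarrow>
     (\<forall>i<d. \<forall>j<d. dot {..<d} (e i) (e j) = (if i = j then 1 else 0)) \<and>
     (\<forall>k<d. \<forall>l<d. (\<Sum>i<d. e i k * e i l) = (if k = l then 1 else 0))"

section \<open>Bilinear forms and the diagonalisation of a symmetric matrix\<close>

definition bform :: "nat \<Rightarrow> (nat \<Rightarrow> nat \<Rightarrow> real) \<Rightarrow> (nat \<Rightarrow> real) \<Rightarrow> (nat \<Rightarrow> real) \<Rightarrow> real" where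
  "bform d A x y = dot {..<d} x (mvmul d A y)"

lemma qform_eq_bform: "qform d A x = bform d A x x"
  by (simp add: qform_def bform_def dot_def mvmul_def sum_distrib_left mult_ac)

lemma mvmul_dot: "mvmul d A y i = dot {..<d} (A i) y"
  by (simp add: mvmul_def dot_def)

lemma mvmul_lin: "mvmul d A (\<lambda>i. a * x i + b * y i) = (\<lambda>i. a * mvmul d A x i + b * mvmul d A y i)"
  by (rule ext) (simp add: mvmul_dot dot_add_right dot_scale_right)

lemma bform_lin_right: "bform d A x (\<lambda>i. a * y i + b * z i) = a * bform d A x y + b * bform d A x z"
  by (simp add: bform_def mvmul_lin dot_add_right dot_scale_right)

lemma bform_lin_left: "bform d A (\<lambda>i. a * y i + b * z i) x = a * bform d A y x + b * bform d A z x"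
  by (simp add: bform_def dot_add_left dot_scale_left)

lemma bform_sym:
  assumes "\<forall>i<d. \<forall>j<d. A i j = A j i"
  shows "bform d A x y = bform d A y x"
proof -
  have "bform d A x y = (\<Sum>i<d. \<Sum>j<d. x i * A i j * y j)"
    by (simp add: bform_def dot_def mvmul_def sum_distrib_left mult_ac)
  also have "\<dots> = (\<Sum>j<d. \<Sum>i<d. x i * A i j * y j)" by (rule sum.swap)
  also have "\<dots> = (\<Sum>j<d. \<Sum>i<d. y j * A j i * x i)"
    using assms by (intro sum.cong refl) auto
  also have "\<dots> = bform d A y x"
    by (simp add: bform_def dot_def mvmul_def sum_distrib_left mult_ac)
  finally show ?thesis .
qed

lemma sum_extract2:
  fixes f :: "nat \<Rightarrow> real"
  assumes "p < d" "q < d" "p \<noteq> q"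
  shows "(\<Sum>i<d. f i) = f p + f q + (\<Sum>i\<in>{..<d} - {p, q}. f i)"
proof -
  have "(\<Sum>i<d. f i) = (\<Sum>i\<in>{p,q}. f i) + (\<Sum>i\<in>{..<d} - {p, q}. f i)"
    using assms by (subst sum.subset_diff[of "{p,q}"]) auto
  with assms show ?thesis by simp
qed

text \<open>One Jacobi rotation annihilates the entry \<open>(p, q)\<close> and moves its mass to the diagonal.\<close>

lemma Jacobi_rotation:
  fixes \<alpha> \<beta> \<gamma> :: real
  assumes "\<beta> \<noteq> 0"
  obtains c s where "c\<^sup>2 + s\<^sup>2 = 1"
    "(c\<^sup>2 * \<alpha> + 2 * c * s * \<beta> + s\<^sup>2 * \<gamma>)\<^sup>2 + (s\<^sup>2 * \<alpha> - 2 * c * s * \<beta> + c\<^sup>2 * \<gamma>)\<^sup>2 > \<alpha>\<^sup>2 + \<gamma>\<^sup>2"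
proof -
  \<comment> \<open>\<open>t\<close> is the tangent of the rotation angle, a root of
    \<open>t\<^sup>2 + 2 * \<tau> * t - 1 = 0\<close>; this is the condition that the rotated
    off-diagonal entry vanishes.\<close>
  define \<tau> where "\<tau> = (\<alpha> - \<gamma>) / (2 * \<beta>)"
  define t where "t = - \<tau> + sqrt (\<tau>\<^sup>2 + 1)"
  have "(t + \<tau>)\<^sup>2 = \<tau>\<^sup>2 + 1" by (simp add: t_def)
  then have t: "t\<^sup>2 + 2 * \<tau> * t - 1 = 0" by (simp add: power2_eq_square algebra_simps)
  have tb: "(1 - t\<^sup>2) * \<beta> + t * (\<gamma> - \<alpha>) = 0"
  proof -
    have "(\<alpha> - \<gamma>) = 2 * \<tau> * \<beta>" using assms by (simp add: \<tau>_def)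
    then have "(1 - t\<^sup>2) * \<beta> + t * (\<gamma> - \<alpha>) = - \<beta> * (t\<^sup>2 + 2 * \<tau> * t - 1)"
      by (simp add: algebra_simps)
    then show ?thesis using t by simp
  qed
  define c where "c = 1 / sqrt (1 + t\<^sup>2)"
  define s where "s = t * c"
  have pos: "1 + t\<^sup>2 > 0" by (simp add: add_pos_nonneg)
  have c2: "c\<^sup>2 * (1 + t\<^sup>2) = 1" using pos by (simp add: c_def power_divide)
  then have cs: "c\<^sup>2 + s\<^sup>2 = 1" by (simp add: s_def algebra_simps power_mult_distrib)
  have b0: "(c\<^sup>2 - s\<^sup>2) * \<beta> + c * s * (\<gamma> - \<alpha>) = 0"
  proof -
    have "(c\<^sup>2 - s\<^sup>2) * \<beta> + c * s * (\<gamma> - \<alpha>) = c\<^sup>2 * ((1 - t\<^sup>2) * \<beta> + t * (\<gamma> - \<alpha>))"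
      by (simp add: s_def power2_eq_square algebra_simps)
    then show ?thesis using tb by simp
  qed
  \<comment> \<open>Invariance of the Frobenius norm of the symmetric 2 by 2 block under the
    rotation; \<open>b0\<close> then deletes the off-diagonal term.\<close>
  have "(c\<^sup>2 * \<alpha> + 2 * c * s * \<beta> + s\<^sup>2 * \<gamma>)\<^sup>2 + (s\<^sup>2 * \<alpha> - 2 * c * s * \<beta> + c\<^sup>2 * \<gamma>)\<^sup>2
     + 2 * ((c\<^sup>2 - s\<^sup>2) * \<beta> + c * s * (\<gamma> - \<alpha>))\<^sup>2 = (c\<^sup>2 + s\<^sup>2)\<^sup>2 * (\<alpha>\<^sup>2 + \<gamma>\<^sup>2 + 2 * \<beta>\<^sup>2)"
    by (simp add: power2_eq_square) algebra
  then have "(c\<^sup>2 * \<alpha> + 2 * c * s * \<beta> + s\<^sup>2 * \<gamma>)\<^sup>2 + (s\<^sup>2 * \<alpha> - 2 * c * s * \<beta> + c\<^sup>2 * \<gamma>)\<^sup>2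
      = \<alpha>\<^sup>2 + \<gamma>\<^sup>2 + 2 * \<beta>\<^sup>2"
    using b0 cs by simp
  moreover have "\<beta>\<^sup>2 > 0" using assms by simp
  ultimately show ?thesis using that[OF cs] by linarith
qed

lemma orthonormal_basis_rotate:
  assumes e: "orthonormal_basis d e" and pq: "p < d" "q < d" "p \<noteq> q" and cs: "c\<^sup>2 + s\<^sup>2 = 1"
  shows "orthonormal_basis d (e(p := (\<lambda>k. c * e p k + s * e q k), q := (\<lambda>k. (- s) * e p k + c * e q k)))"
    (is "orthonormal_basis d ?f")
proof -
  have D: "dot {..<d} (e i) (e j) = (if i = j then 1 else 0)" if "i < d" "j < d" for i j
    using e that by (auto simp: orthonormal_basis_def)
  have cs': "c * c + s * s = 1" using cs by (simp add: power2_eq_square)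
  have rows: "dot {..<d} (?f i) (?f j) = (if i = j then 1 else 0)" if "i < d" "j < d" for i j
  proof -
    have minus: "dot {..<d} (\<lambda>k. - x k) z = - dot {..<d} x z" "dot {..<d} z (\<lambda>k. - x k) = - dot {..<d} z x" for x z
      by (simp_all add: dot_def sum_negf)
    show ?thesis using that pq cs' D
      by (auto simp: dot_add_left dot_add_right dot_diff_left dot_diff_right dot_scale_left dot_scale_right D minus algebra_simps)
  qed
  have cols: "(\<Sum>i<d. ?f i k * ?f i l) = (if k = l then 1 else 0)" if "k < d" "l < d" for k l
  proof -
    have "(\<Sum>i<d. ?f i k * ?f i l) = ?f p k * ?f p l + ?f q k * ?f q l + (\<Sum>i\<in>{..<d} - {p, q}. ?f i k * ?f i l)"
      by (rule sum_extract2[OF pq])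
    also have "(\<Sum>i\<in>{..<d} - {p, q}. ?f i k * ?f i l) = (\<Sum>i\<in>{..<d} - {p, q}. e i k * e i l)"
      by (intro sum.cong) auto
    also have "?f p k * ?f p l + ?f q k * ?f q l = (c\<^sup>2 + s\<^sup>2) * (e p k * e p l + e q k * e q l)"
      using pq by (simp add: power2_eq_square algebra_simps)
    also have "\<dots> + (\<Sum>i\<in>{..<d} - {p, q}. e i k * e i l) = (\<Sum>i<d. e i k * e i l)"
      using cs by (simp add: sum_extract2[OF pq])
    also have "\<dots> = (if k = l then 1 else 0)" using e that by (simp add: orthonormal_basis_def)
    finally show ?thesis .
  qed
  show ?thesis using rows cols unfolding orthonormal_basis_def by blast
qed

text \<open>Orthonormal bases with entries in [-1, 1] form a closed subset of a cube, which is
  compact by Tychonoff in the product topology over all pairs of indices. Locality of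
  \<open>F\<close> allows the entries beyond \<open>d\<close> to be reset to 0, so every basis has a
  representative in the cube.\<close>

lemma orthonormal_basis_attains_max:
  fixes F :: "(nat \<Rightarrow> nat \<Rightarrow> real) \<Rightarrow> real"
  assumes cont: "continuous_on UNIV (\<lambda>x :: nat \<times> nat \<Rightarrow> real. F (\<lambda>i k. x (i, k)))"
    and local: "\<And>e e'. (\<And>i k. i < d \<Longrightarrow> k < d \<Longrightarrow> e i k = e' i k) \<Longrightarrow> F e = F e'"
  obtains e where "orthonormal_basis d e" "\<And>e'. orthonormal_basis d e' \<Longrightarrow> F e' \<le> F e"
proof -
  define box :: "(nat \<times> nat \<Rightarrow> real) set" where "box = PiE UNIV (\<lambda>_. {-1..1})"
  have "compactin (product_topology (\<lambda>_. euclidean) UNIV) box"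
    unfolding box_def by (subst compactin_PiE) (auto simp: compactin_euclidean_iff)
  then have cb: "compact box"
    by (simp add: euclidean_product_topology compactin_euclidean_iff)
  define O' where "O' = {x :: nat \<times> nat \<Rightarrow> real. orthonormal_basis d (\<lambda>i k. x (i, k))}"
  have cx: "continuous_on UNIV (\<lambda>x :: nat \<times> nat \<Rightarrow> real. x p)" for p
    by (rule continuous_on_product_coordinates)
  have "O' = (\<Inter>i\<in>{..<d}. \<Inter>j\<in>{..<d}. {x. (\<Sum>k<d. x (i,k) * x (j,k)) = (if i = j then 1 else 0)})
       \<inter> (\<Inter>k\<in>{..<d}. \<Inter>l\<in>{..<d}. {x. (\<Sum>i<d. x (i,k) * x (i,l)) = (if k = l then 1 else 0)})"
    by (auto simp: O'_def orthonormal_basis_def dot_def)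
  moreover have "closed \<dots>"
    by (intro closed_Int closed_INT ballI closed_Collect_eq continuous_intros cx)
  ultimately have cO: "closed O'" by simp
  have comp: "compact (box \<inter> O')" using cb cO by (rule compact_Int_closed)
  have trim: "\<exists>x\<in>box \<inter> O'. F (\<lambda>i k. x (i, k)) = F e" if e: "orthonormal_basis d e" for e
  proof -
    define x where "x = (\<lambda>(i, k). if i < d \<and> k < d then e i k else 0)"
    have "\<bar>e i k\<bar> \<le> 1" if "i < d" "k < d" for i k
    proof -
      have "(e i k)\<^sup>2 \<le> (\<Sum>k<d. (e i k)\<^sup>2)" using that by (intro member_le_sum) auto
      also have "\<dots> = 1" using e that by (simp add: orthonormal_basis_def dot_def power2_eq_square)
      finally show ?thesis by (simp add: abs_square_le_1)
    qed
    then have "x \<in> box" by (fastforce simp: box_def x_def abs_le_iff)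
    moreover have "x \<in> O'" using e by (simp add: O'_def orthonormal_basis_def dot_def x_def)
    moreover have "F (\<lambda>i k. x (i, k)) = F e" by (rule local) (simp add: x_def)
    ultimately show ?thesis by blast
  qed
  have "orthonormal_basis d (\<lambda>i k. if i = k then 1 else 0)"
    by (simp add: orthonormal_basis_def dot_def if_distrib[of "\<lambda>x. x * _"] cong: if_cong)
  from trim[OF this] have "box \<inter> O' \<noteq> {}" by blast
  from continuous_attains_sup[OF comp this continuous_on_subset[OF cont]]
  obtain x where x: "x \<in> box \<inter> O'" and max: "\<And>y. y \<in> box \<inter> O' \<Longrightarrow> F (\<lambda>i k. y (i, k)) \<le> F (\<lambda>i k. x (i, k))"
    by blast
  show ?thesis
  proof (rule that)
    show "orthonormal_basis d (\<lambda>i k. x (i, k))" using x by (simp add: O'_def)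
    show "F e' \<le> F (\<lambda>i k. x (i, k))" if "orthonormal_basis d e'" for e'
      using trim[OF that] max by metis
  qed
qed

text \<open>At a basis maximising the sum of squared diagonal entries no off-diagonal entry
  survives: a Jacobi rotation in its plane would increase the sum and leave the other diagonal
  entries alone.\<close>

theorem symmetric_orthonormal_diagonalization:
  assumes sym: "\<forall>i<d. \<forall>j<d. A i j = A j i"
  obtains e where "orthonormal_basis d e"
    "\<And>i j. i < d \<Longrightarrow> j < d \<Longrightarrow> i \<noteq> j \<Longrightarrow> bform d A (e i) (e j) = 0"
proof -
  define F where "F e = (\<Sum>i<d. (bform d A (e i) (e i))\<^sup>2)" for e :: "nat \<Rightarrow> nat \<Rightarrow> real"
  have cont: "continuous_on UNIV (\<lambda>x :: nat \<times> nat \<Rightarrow> real. F (\<lambda>i k. x (i, k)))"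
    unfolding F_def bform_def dot_def mvmul_def
    by (intro continuous_intros continuous_on_product_coordinates)
  have local: "F e = F e'" if "\<And>i k. i < d \<Longrightarrow> k < d \<Longrightarrow> e i k = e' i k" for e e'
    using that by (simp add: F_def bform_def dot_def mvmul_def)
  obtain e where e: "orthonormal_basis d e" and max: "\<And>e'. orthonormal_basis d e' \<Longrightarrow> F e' \<le> F e"
    using orthonormal_basis_attains_max[OF cont local] by blast
  have "bform d A (e p) (e q) = 0" if pq: "p < d" "q < d" "p \<noteq> q" for p q
  proof (rule ccontr)
    assume b: "bform d A (e p) (e q) \<noteq> 0"
    let ?\<alpha> = "bform d A (e p) (e p)" and ?\<beta> = "bform d A (e p) (e q)" and ?\<gamma> = "bform d A (e q) (e q)"
    obtain c s where cs: "c\<^sup>2 + s\<^sup>2 = 1"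
      and inc: "(c\<^sup>2 * ?\<alpha> + 2 * c * s * ?\<beta> + s\<^sup>2 * ?\<gamma>)\<^sup>2 + (s\<^sup>2 * ?\<alpha> - 2 * c * s * ?\<beta> + c\<^sup>2 * ?\<gamma>)\<^sup>2 > ?\<alpha>\<^sup>2 + ?\<gamma>\<^sup>2"
      using Jacobi_rotation[OF b] by metis
    define f where "f = e(p := (\<lambda>k. c * e p k + s * e q k), q := (\<lambda>k. (- s) * e p k + c * e q k))"
    have fo: "orthonormal_basis d f" unfolding f_def by (rule orthonormal_basis_rotate[OF e pq cs])
    have s': "bform d A (e q) (e p) = ?\<beta>" by (rule bform_sym[OF sym])
    have fp: "bform d A (f p) (f p) = c\<^sup>2 * ?\<alpha> + 2 * c * s * ?\<beta> + s\<^sup>2 * ?\<gamma>"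
    proof -
      have "f p = (\<lambda>k. c * e p k + s * e q k)" using pq by (simp add: f_def)
      then show ?thesis
        by (simp only: bform_lin_left bform_lin_right s') (simp add: power2_eq_square algebra_simps)
    qed
    have fq: "bform d A (f q) (f q) = s\<^sup>2 * ?\<alpha> - 2 * c * s * ?\<beta> + c\<^sup>2 * ?\<gamma>"
    proof -
      have "f q = (\<lambda>k. (- s) * e p k + c * e q k)" using pq by (simp add: f_def)
      then show ?thesis
        by (simp only: bform_lin_left bform_lin_right s') (simp add: power2_eq_square algebra_simps)
    qed
    have "F f = (bform d A (f p) (f p))\<^sup>2 + (bform d A (f q) (f q))\<^sup>2
        + (\<Sum>i\<in>{..<d} - {p, q}. (bform d A (f i) (f i))\<^sup>2)"
      unfolding F_def by (rule sum_extract2[OF pq])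
    also have "(\<Sum>i\<in>{..<d} - {p, q}. (bform d A (f i) (f i))\<^sup>2)
        = (\<Sum>i\<in>{..<d} - {p, q}. (bform d A (e i) (e i))\<^sup>2)"
      by (intro sum.cong) (auto simp: f_def)
    finally have "F f > F e" using inc by (simp add: F_def sum_extract2[OF pq] fp fq)
    with max[OF fo] show False by simp
  qed
  with e show ?thesis using that by blast
qed

section \<open>Rank as the maximal number of independent columns\<close>

lemma homogeneous_system_nontrivial:
  fixes a :: "'i \<Rightarrow> 'j \<Rightarrow> real"
  assumes "finite I" "finite J" "card I < card J"
  shows "\<exists>c. (\<exists>j\<in>J. c j \<noteq> 0) \<and> (\<forall>i\<in>I. (\<Sum>j\<in>J. c j * a i j) = 0)"
  using assms
proof (induction I arbitrary: J a rule: finite_induct)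
  case empty
  then have "J \<noteq> {}" by auto
  then show ?case by (intro exI[of _ "\<lambda>_. 1"]) auto
next
  case (insert m I)
  show ?case
  proof (cases "\<forall>j\<in>J. a m j = 0")
    case True
    have "card I < card J" using insert by simp
    from insert.IH[OF insert.prems(1) this, of a] True show ?thesis by auto
  next
    case False
    \<comment> \<open>Gaussian elimination: equation \<open>m\<close> is solved for the unknown
      \<open>p\<close>, and \<open>a'\<close> is the remaining system after substitution.\<close>
    then obtain p where p: "p \<in> J" "a m p \<noteq> 0" by blast
    define J' where "J' = J - {p}"
    have J': "finite J'" "card I < card J'" "p \<notin> J'" "J = insert p J'"
      using insert p by (auto simp: J'_def)
    define a' where "a' i j = a i j - a i p * a m j / a m p" for i j
    from insert.IH[OF J'(1,2), of a'] obtain c where c: "\<exists>j\<in>J'. c j \<noteq> 0"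
      "\<And>i. i \<in> I \<Longrightarrow> (\<Sum>j\<in>J'. c j * a' i j) = 0" by blast
    define cp where "cp = - (\<Sum>j\<in>J'. c j * a m j) / a m p"
    define c' where "c' = c(p := cp)"
    have S: "(\<Sum>j\<in>J. c' j * a i j) = cp * a i p + (\<Sum>j\<in>J'. c j * a i j)" for i
    proof -
      have "(\<Sum>j\<in>J'. c' j * a i j) = (\<Sum>j\<in>J'. c j * a i j)"
        using J'(3) by (intro sum.cong) (auto simp: c'_def)
      then show ?thesis using J' by (simp add: c'_def)
    qed
    have "(\<Sum>j\<in>J. c' j * a m j) = 0" unfolding S using p by (simp add: cp_def)
    moreover have "(\<Sum>j\<in>J. c' j * a i j) = 0" if "i \<in> I" for i
    proof -
      have "(\<Sum>j\<in>J'. c j * a' i j) = (\<Sum>j\<in>J'. c j * a i j) - (a i p / a m p) * (\<Sum>j\<in>J'. c j * a m j)"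
        by (simp add: a'_def algebra_simps sum_subtractf sum_distrib_left)
      then show ?thesis unfolding S using c(2)[OF that] by (simp add: cp_def)
    qed
    moreover have "\<exists>j\<in>J. c' j \<noteq> 0" using c(1) J'(3,4) by (auto simp: c'_def)
    ultimately show ?thesis by (intro exI[of _ c']) auto
  qed
qed

text \<open>A largest independent set \<open>S\<close> of columns spans every column, so each image
  vector is a combination of \<open>card S\<close> columns. More than \<open>card S\<close> such
  vectors have a nontrivial relation, because their coefficients form a homogeneous system with more
  unknowns than equations.\<close>

lemma card_le_mrank:
  fixes v x :: "'j \<Rightarrow> nat \<Rightarrow> real"
  assumes P: "finite P"
    and v: "\<And>j i. j \<in> P \<Longrightarrow> i < d \<Longrightarrow> v j i = mvmul d A (x j) i"
    and indep: "\<And>c. (\<And>i. i < d \<Longrightarrow> (\<Sum>j\<in>P. c j * v j i) = 0) \<Longrightarrow> \<forall>j\<in>P. c j = 0"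
  shows "card P \<le> mrank d A"
proof -
  let ?F = "{card S | S. S \<subseteq> {..<d} \<and> cols_indep d A S}"
  have fin: "finite ?F"
    by (rule finite_subset[of _ "{..d}"]) (auto dest: card_mono[rotated])
  have "0 \<in> ?F" by (auto simp: cols_indep_def intro!: exI[of _ "{}"])
  then have "mrank d A \<in> ?F" unfolding mrank_def using fin by (intro Max_in) auto
  then obtain S where S: "S \<subseteq> {..<d}" "cols_indep d A S" "card S = mrank d A" by auto
  have fS: "finite S" using S(1) finite_subset by blast
  have "\<exists>b. \<forall>i<d. A i l = (\<Sum>s\<in>S. b s * A i s)" if l: "l < d" for l
  proof (cases "l \<in> S")
    case True
    have "A i l = (\<Sum>s\<in>S. (if s = l then 1 else 0) * A i s)" for i
      using True fS by (simp add: if_distrib[of "\<lambda>x. x * _"] cong: if_cong)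
    then show ?thesis by (intro exI[of _ "\<lambda>s. if s = l then 1 else 0"]) blast
  next
    case False
    have "\<not> cols_indep d A (insert l S)"
    proof
      assume "cols_indep d A (insert l S)"
      then have "card (insert l S) \<in> ?F" using S(1) l by blast
      then have "card (insert l S) \<le> mrank d A" unfolding mrank_def by (rule Max_ge[OF fin])
      with False fS S(3) show False by simp
    qed
    then obtain c where c: "\<And>i. i < d \<Longrightarrow> (\<Sum>j\<in>insert l S. c j * A i j) = 0" "\<exists>j\<in>insert l S. c j \<noteq> 0"
      unfolding cols_indep_def by blast
    have c1: "c l * A i l + (\<Sum>j\<in>S. c j * A i j) = 0" if "i < d" for i
      using c(1)[OF that] False fS by simp
    have "c l \<noteq> 0"
    proof
      assume 0: "c l = 0"
      then have "\<forall>i<d. (\<Sum>j\<in>S. c j * A i j) = 0" using c1 by simp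
      then have "\<forall>j\<in>S. c j = 0" using S(2) unfolding cols_indep_def by blast
      with 0 c(2) show False by auto
    qed
    then have "A i l = (\<Sum>s\<in>S. (- c s / c l) * A i s)" if "i < d" for i
    proof -
      have "(\<Sum>s\<in>S. (- c s / c l) * A i s) = - (\<Sum>s\<in>S. c s * A i s) / c l"
        by (simp add: sum_divide_distrib sum_negf)
      also have "\<dots> = A i l" using c1[OF that] \<open>c l \<noteq> 0\<close> by (simp add: field_simps eq_neg_iff_add_eq_0)
      finally show ?thesis by simp
    qed
    then show ?thesis by (intro exI[of _ "\<lambda>s. - c s / c l"]) blast
  qed
  then obtain b where b: "\<And>l i. l < d \<Longrightarrow> i < d \<Longrightarrow> A i l = (\<Sum>s\<in>S. b l s * A i s)" by metis
  define y where "y s j = (\<Sum>l<d. x j l * b l s)" for s j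
  have vy: "v j i = (\<Sum>s\<in>S. y s j * A i s)" if "j \<in> P" "i < d" for i j
  proof -
    have "v j i = (\<Sum>l<d. A i l * x j l)" using v[OF that] by (simp add: mvmul_def)
    also have "\<dots> = (\<Sum>l<d. \<Sum>s\<in>S. x j l * b l s * A i s)"
      using b that by (intro sum.cong refl) (simp add: sum_distrib_left mult_ac)
    also have "\<dots> = (\<Sum>s\<in>S. \<Sum>l<d. x j l * b l s * A i s)" by (rule sum.swap)
    finally show ?thesis by (simp add: y_def sum_distrib_right)
  qed
  have "\<not> card S < card P"
  proof
    assume "card S < card P"
    from homogeneous_system_nontrivial[OF fS P this, of y] obtain c
      where c: "\<exists>j\<in>P. c j \<noteq> 0" "\<And>s. s \<in> S \<Longrightarrow> (\<Sum>j\<in>P. c j * y s j) = 0" by blast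
    have "(\<Sum>j\<in>P. c j * v j i) = 0" if "i < d" for i
    proof -
      have "(\<Sum>j\<in>P. c j * v j i) = (\<Sum>j\<in>P. \<Sum>s\<in>S. c j * y s j * A i s)"
        using vy that by (intro sum.cong refl) (simp add: sum_distrib_left mult_ac)
      also have "\<dots> = (\<Sum>s\<in>S. \<Sum>j\<in>P. c j * y s j * A i s)" by (rule sum.swap)
      also have "\<dots> = (\<Sum>s\<in>S. (\<Sum>j\<in>P. c j * y s j) * A i s)" by (simp add: sum_distrib_right)
      finally show ?thesis using c(2) by simp
    qed
    with indep[of c] c(1) show False by blast
  qed
  with S(3) show ?thesis by simp
qed

section \<open>A common eigenbasis of the two parts of the covariance\<close>

lemma orthonormal_expansion:
  assumes "orthonormal_basis d e" "i < d"
  shows "x i = (\<Sum>j<d. dot {..<d} (e j) x * e j i)"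
proof -
  have "(\<Sum>j<d. dot {..<d} (e j) x * e j i) = (\<Sum>j<d. \<Sum>k<d. e j k * x k * e j i)"
    by (simp add: dot_def sum_distrib_right)
  also have "\<dots> = (\<Sum>k<d. \<Sum>j<d. e j k * x k * e j i)" by (rule sum.swap)
  also have "\<dots> = (\<Sum>k<d. x k * (\<Sum>j<d. e j k * e j i))" by (simp add: sum_distrib_left mult_ac)
  also have "\<dots> = (\<Sum>k<d. x k * (if k = i then 1 else 0))"
    using assms by (intro sum.cong refl) (simp add: orthonormal_basis_def)
  also have "\<dots> = x i" using assms(2) by (simp add: if_distrib[of "\<lambda>x. _ * x"] cong: if_cong)
  finally show ?thesis by simp
qed

lemma dot_cong: "(\<And>i. i \<in> I \<Longrightarrow> x i = x' i) \<Longrightarrow> (\<And>i. i \<in> I \<Longrightarrow> y i = y' i) \<Longrightarrow> dot I x y = dot I x' y'"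
  by (simp add: dot_def)

lemma orthonormal_Parseval:
  assumes "orthonormal_basis d e"
  shows "dot {..<d} x y = (\<Sum>j<d. dot {..<d} (e j) x * dot {..<d} (e j) y)"
proof -
  have "dot {..<d} x y = dot {..<d} (\<lambda>i. \<Sum>j<d. dot {..<d} (e j) x * e j i) y"
    using orthonormal_expansion[OF assms] by (intro dot_cong) auto
  then show ?thesis by (simp add: dot_sum_left dot_scale_left)
qed

lemma mvmul_cong: "(\<And>k. k < d \<Longrightarrow> x k = y k) \<Longrightarrow> mvmul d A x = mvmul d A y"
  by (simp add: mvmul_def)

definition eigenvector :: "nat \<Rightarrow> (nat \<Rightarrow> nat \<Rightarrow> real) \<Rightarrow> real \<Rightarrow> (nat \<Rightarrow> real) \<Rightarrow> bool" where
  "eigenvector d A a x \<longleftrightarrow> (\<forall>i<d. mvmul d A x i = a * x i)"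

lemma eigenvector_of_diagonal:
  assumes e: "orthonormal_basis d e" and j: "j < d"
    and off: "\<And>i. i < d \<Longrightarrow> i \<noteq> j \<Longrightarrow> bform d A (e i) (e j) = 0"
  shows "eigenvector d A (bform d A (e j) (e j)) (e j)"
  unfolding eigenvector_def
proof (intro allI impI)
  fix i assume "i < d"
  from orthonormal_expansion[OF e this, of "mvmul d A (e j)"]
  have "mvmul d A (e j) i = (\<Sum>k<d. bform d A (e k) (e j) * e k i)" by (simp add: bform_def)
  also have "\<dots> = (\<Sum>k<d. if k = j then bform d A (e j) (e j) * e j i else 0)"
    using off by (intro sum.cong) auto
  finally show "mvmul d A (e j) i = bform d A (e j) (e j) * e j i" using j by simp
qed

lemma eigenvector_nonneg:
  assumes "psd d A" "eigenvector d A a x" "dot {..<d} x x = 1"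
  shows "0 \<le> a"
proof -
  have "0 \<le> bform d A x x" using assms(1) by (simp add: psd_def qform_eq_bform)
  also have "\<dots> = dot {..<d} x (\<lambda>i. a * x i)"
    unfolding bform_def using assms(2) by (intro dot_cong) (auto simp: eigenvector_def)
  finally show ?thesis using assms(3) by (simp add: dot_scale_right)
qed

text \<open>Orthogonality of the column spaces is the vanishing of the transpose of \<Sigma>1 times
  \<Sigma>2; symmetry turns it into both products being zero.\<close>

lemma cov_split_annihilate:
  assumes "cov_split d \<Sigma> \<Sigma>1 \<Sigma>2" "i < d"
  shows "mvmul d \<Sigma>1 (mvmul d \<Sigma>2 x) i = 0" "mvmul d \<Sigma>2 (mvmul d \<Sigma>1 x) i = 0"
proof -
  have s1: "\<Sigma>1 i k = \<Sigma>1 k i" and s2: "\<Sigma>2 i k = \<Sigma>2 k i" if "k < d" for k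
    using assms that by (auto simp: cov_split_def psd_def)
  have 0: "(\<Sum>i<d. \<Sigma>1 i a * \<Sigma>2 i b) = 0" if "a < d" "b < d" for a b
    using assms that by (auto simp: cov_split_def)
  have "mvmul d \<Sigma>1 (mvmul d \<Sigma>2 x) i = (\<Sum>k<d. \<Sum>l<d. \<Sigma>1 k i * \<Sigma>2 k l * x l)"
    using s1 by (simp add: mvmul_def sum_distrib_left mult.assoc)
  also have "\<dots> = (\<Sum>l<d. \<Sum>k<d. \<Sigma>1 k i * \<Sigma>2 k l * x l)" by (rule sum.swap)
  also have "\<dots> = 0" using 0 assms(2) by (simp flip: sum_distrib_right)
  finally show "mvmul d \<Sigma>1 (mvmul d \<Sigma>2 x) i = 0" .
  have "mvmul d \<Sigma>2 (mvmul d \<Sigma>1 x) i = (\<Sum>k<d. \<Sum>l<d. \<Sigma>1 k l * \<Sigma>2 k i * x l)"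
    using s2 by (simp add: mvmul_def sum_distrib_left mult_ac)
  also have "\<dots> = (\<Sum>l<d. \<Sum>k<d. \<Sigma>1 k l * \<Sigma>2 k i * x l)" by (rule sum.swap)
  also have "\<dots> = 0" using 0 assms(2) by (simp flip: sum_distrib_right)
  finally show "mvmul d \<Sigma>2 (mvmul d \<Sigma>1 x) i = 0" .
qed

text \<open>If \<open>P Q = 0\<close>, \<open>Q\<close> is positive semidefinite and \<open>P x - Q x = a x\<close> with \<open>a > 0\<close>, then applying
  \<open>Q\<close> gives \<open>Q (Q x) = - a Q x\<close>, hence \<open>Q x = 0\<close>.\<close>

lemma psd_kernel_of_difference:
  assumes "psd d Q" and a: "a > 0"
    and x: "\<And>i. i < d \<Longrightarrow> mvmul d P x i - mvmul d Q x i = a * x i"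
    and ann: "\<And>i. i < d \<Longrightarrow> mvmul d Q (mvmul d P x) i = 0"
    and i: "i < d"
  shows "mvmul d Q x i = 0"
proof -
  let ?y = "mvmul d Q x"
  have "a * ?y i = - mvmul d Q ?y i" if "i < d" for i
  proof -
    have "mvmul d Q (\<lambda>k. mvmul d P x k - ?y k) i = mvmul d Q (\<lambda>k. a * x k) i"
      using x by (intro fun_cong[OF mvmul_cong]) auto
    moreover have "mvmul d Q (\<lambda>k. mvmul d P x k - ?y k) i = mvmul d Q (mvmul d P x) i - mvmul d Q ?y i"
      unfolding mvmul_dot[of d Q _ i] by (rule dot_diff_right)
    moreover have "mvmul d Q (\<lambda>k. a * x k) i = a * ?y i" by (simp add: mvmul_dot dot_scale_right)
    ultimately show ?thesis using ann[OF that] by simp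
  qed
  then have "dot {..<d} ?y (\<lambda>i. a * ?y i) = dot {..<d} ?y (\<lambda>i. (-1) * mvmul d Q ?y i)"
    by (intro dot_cong) auto
  then have "a * dot {..<d} ?y ?y = - bform d Q ?y ?y" by (simp add: dot_scale_right bform_def dot_def sum_negf)
  moreover have "0 \<le> bform d Q ?y ?y" using assms(1) by (simp add: psd_def qform_eq_bform)
  ultimately have "a * dot {..<d} ?y ?y \<le> 0" by simp
  then have "dot {..<d} ?y ?y = 0" using a dot_self_nonneg[of "{..<d}" ?y]
    by (simp add: mult_le_0_iff order_antisym)
  then show ?thesis using i by (auto simp: dot_self_eq_0)
qed

text \<open>Diagonalising the single matrix \<Sigma>1 - \<Sigma>2 is enough: the sign of an
  eigenvalue tells which of the two parts kills the eigenvector, and the other part then has it as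
  an eigenvector.\<close>

theorem cov_split_eigenbasis:
  assumes split: "cov_split d \<Sigma> \<Sigma>1 \<Sigma>2"
  obtains e m1 m2 where "orthonormal_basis d e"
    "\<And>j. j < d \<Longrightarrow> eigenvector d \<Sigma>1 (m1 j) (e j)" "\<And>j. j < d \<Longrightarrow> eigenvector d \<Sigma>2 (m2 j) (e j)"
    "\<And>j. j < d \<Longrightarrow> 0 \<le> m1 j" "\<And>j. j < d \<Longrightarrow> 0 \<le> m2 j" "\<And>j. j < d \<Longrightarrow> m1 j = 0 \<or> m2 j = 0"
proof -
  let ?M = "\<lambda>i j. \<Sigma>1 i j - \<Sigma>2 i j"
  have psd: "psd d \<Sigma>1" "psd d \<Sigma>2" using split by (auto simp: cov_split_def)
  have "\<forall>i<d. \<forall>j<d. ?M i j = ?M j i" using psd by (simp add: psd_def)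
  from symmetric_orthonormal_diagonalization[OF this] obtain e where e: "orthonormal_basis d e"
    and off: "\<And>i j. i < d \<Longrightarrow> j < d \<Longrightarrow> i \<noteq> j \<Longrightarrow> bform d ?M (e i) (e j) = 0" by blast
  have one: "dot {..<d} (e j) (e j) = 1" if "j < d" for j using e that by (simp add: orthonormal_basis_def)
  have "\<exists>a b. eigenvector d \<Sigma>1 a (e j) \<and> eigenvector d \<Sigma>2 b (e j) \<and> (a = 0 \<or> b = 0)" if j: "j < d" for j
  proof -
    let ?\<mu> = "bform d ?M (e j) (e j)"
    have ev: "mvmul d \<Sigma>1 (e j) i - mvmul d \<Sigma>2 (e j) i = ?\<mu> * e j i" if "i < d" for i
      using eigenvector_of_diagonal[OF e j, of ?M] off j that
      by (simp add: eigenvector_def mvmul_def sum_subtractf left_diff_distrib)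
    have ann: "\<And>i. i < d \<Longrightarrow> mvmul d \<Sigma>1 (mvmul d \<Sigma>2 (e j)) i = 0"
      "\<And>i. i < d \<Longrightarrow> mvmul d \<Sigma>2 (mvmul d \<Sigma>1 (e j)) i = 0"
      using cov_split_annihilate[OF split] by auto
    consider "?\<mu> > 0" | "?\<mu> < 0" | "?\<mu> = 0" by linarith
    then show ?thesis
    proof cases
      case 1
      have z: "mvmul d \<Sigma>2 (e j) i = 0" if "i < d" for i
        using psd_kernel_of_difference[OF psd(2) 1 ev ann(2) that] .
      then have "eigenvector d \<Sigma>1 ?\<mu> (e j)" "eigenvector d \<Sigma>2 0 (e j)"
        using ev by (fastforce simp: eigenvector_def)+
      then show ?thesis by blast
    next
      case 2
      then have p: "- ?\<mu> > 0" by simp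
      have ev': "mvmul d \<Sigma>2 (e j) i - mvmul d \<Sigma>1 (e j) i = - ?\<mu> * e j i" if "i < d" for i
        using ev[OF that] by simp
      have z: "mvmul d \<Sigma>1 (e j) i = 0" if "i < d" for i
        using psd_kernel_of_difference[OF psd(1) p ev' ann(1) that] .
      then have "eigenvector d \<Sigma>2 (- ?\<mu>) (e j)" "eigenvector d \<Sigma>1 0 (e j)"
        using ev' by (fastforce simp: eigenvector_def)+
      then show ?thesis by blast
    next
      \<comment> \<open>Here \<Sigma>1 x = \<Sigma>2 x, so |\<Sigma>1 x|^2 = <x, \<Sigma>1
        (\<Sigma>1 x)> = <x, \<Sigma>1 (\<Sigma>2 x)> = 0 and both parts kill x.\<close>
      case 3
      let ?y = "mvmul d \<Sigma>1 (e j)"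
      have eq: "?y i = mvmul d \<Sigma>2 (e j) i" if "i < d" for i using ev[OF that] 3 by simp
      have "dot {..<d} ?y ?y = bform d \<Sigma>1 ?y (e j)" by (simp add: bform_def)
      also have "\<dots> = bform d \<Sigma>1 (e j) ?y" using psd(1) by (intro bform_sym) (simp add: psd_def)
      also have "mvmul d \<Sigma>1 ?y = mvmul d \<Sigma>1 (mvmul d \<Sigma>2 (e j))" using eq by (intro mvmul_cong) auto
      then have "bform d \<Sigma>1 (e j) ?y = dot {..<d} (e j) (\<lambda>_. 0)"
        unfolding bform_def using ann(1) by (intro dot_cong) auto
      finally have "dot {..<d} ?y ?y = 0" by (simp add: dot_def)
      then have "?y i = 0" if "i < d" for i using that by (auto simp: dot_self_eq_0)
      then have "eigenvector d \<Sigma>1 0 (e j)" "eigenvector d \<Sigma>2 0 (e j)" using eq by (auto simp: eigenvector_def)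
      then show ?thesis by blast
    qed
  qed
  then obtain m1 m2 where ev: "\<And>j. j < d \<Longrightarrow> eigenvector d \<Sigma>1 (m1 j) (e j)"
    "\<And>j. j < d \<Longrightarrow> eigenvector d \<Sigma>2 (m2 j) (e j)" "\<And>j. j < d \<Longrightarrow> m1 j = 0 \<or> m2 j = 0" by metis
  have "0 \<le> m1 j" "0 \<le> m2 j" if "j < d" for j
    using eigenvector_nonneg[OF psd(1) ev(1)[OF that] one[OF that]]
      eigenvector_nonneg[OF psd(2) ev(2)[OF that] one[OF that]] by auto
  with e ev show ?thesis using that by blast
qed

section \<open>Traces, quadratic form and rank in terms of the eigenvalues\<close>

lemma spectral_decomposition:
  assumes e: "orthonormal_basis d e" and ev: "\<And>j. j < d \<Longrightarrow> eigenvector d A (m j) (e j)"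
    and "i < d" "l < d"
  shows "A i l = (\<Sum>j<d. m j * e j i * e j l)"
proof -
  have "A i l = (\<Sum>j<d. dot {..<d} (e j) (A i) * e j l)"
    using orthonormal_expansion[OF e assms(4)] .
  also have "\<dots> = (\<Sum>j<d. m j * e j i * e j l)"
    using ev assms(3) by (intro sum.cong refl) (simp add: eigenvector_def mvmul_dot dot_commute)
  finally show ?thesis .
qed

lemma mtrace_eigen:
  assumes e: "orthonormal_basis d e" and ev: "\<And>j. j < d \<Longrightarrow> eigenvector d A (m j) (e j)"
  shows "mtrace d A = (\<Sum>j<d. m j)"
proof -
  have "mtrace d A = (\<Sum>i<d. \<Sum>j<d. m j * e j i * e j i)"
    unfolding mtrace_def by (intro sum.cong refl spectral_decomposition[OF e ev]) auto
  also have "\<dots> = (\<Sum>j<d. \<Sum>i<d. m j * e j i * e j i)" by (rule sum.swap)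
  also have "\<dots> = (\<Sum>j<d. m j * dot {..<d} (e j) (e j))" by (simp add: dot_def sum_distrib_left mult_ac)
  finally show ?thesis using e by (simp add: orthonormal_basis_def)
qed

text \<open>This is the trace of the matrix square, which has the same eigenvectors with squared
  eigenvalues.\<close>

lemma mtrace_sq_eigen:
  assumes e: "orthonormal_basis d e" and ev: "\<And>j. j < d \<Longrightarrow> eigenvector d A (m j) (e j)"
  shows "mtrace_sq d A = (\<Sum>j<d. (m j)\<^sup>2)"
proof -
  let ?B = "\<lambda>i l. \<Sum>k<d. A i k * A k l"
  have "eigenvector d ?B ((m j)\<^sup>2) (e j)" if "j < d" for j
    unfolding eigenvector_def
  proof (intro allI impI)
    fix i assume i: "i < d"
    have "mvmul d ?B (e j) i = (\<Sum>l<d. \<Sum>k<d. A i k * A k l * e j l)"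
      by (simp add: mvmul_def sum_distrib_right)
    also have "\<dots> = (\<Sum>k<d. \<Sum>l<d. A i k * A k l * e j l)" by (rule sum.swap)
    also have "\<dots> = mvmul d A (mvmul d A (e j)) i" by (simp add: mvmul_def sum_distrib_left mult_ac)
    also have "mvmul d A (mvmul d A (e j)) = mvmul d A (\<lambda>i. m j * e j i)"
      using ev[OF that] by (intro mvmul_cong) (auto simp: eigenvector_def)
    also have "mvmul d A (\<lambda>i. m j * e j i) i = m j * mvmul d A (e j) i" by (simp add: mvmul_dot dot_scale_right)
    also have "mvmul d A (e j) i = m j * e j i" using ev[OF that] i by (auto simp: eigenvector_def)
    finally show "mvmul d ?B (e j) i = (m j)\<^sup>2 * e j i" by (simp add: power2_eq_square)
  qed
  from mtrace_eigen[OF e this] show ?thesis by (simp add: mtrace_def mtrace_sq_def)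
qed

lemma qform_eigen:
  assumes e: "orthonormal_basis d e" and ev: "\<And>j. j < d \<Longrightarrow> eigenvector d A (m j) (e j)"
    and sym: "\<forall>i<d. \<forall>j<d. A i j = A j i"
  shows "qform d A x = (\<Sum>j<d. m j * (dot {..<d} (e j) x)\<^sup>2)"
proof -
  have "dot {..<d} (e j) (mvmul d A x) = m j * dot {..<d} (e j) x" if "j < d" for j
  proof -
    have "dot {..<d} (e j) (mvmul d A x) = bform d A x (e j)" using bform_sym[OF sym] by (simp add: bform_def)
    also have "\<dots> = dot {..<d} x (\<lambda>i. m j * e j i)"
      unfolding bform_def using ev[OF that] by (intro dot_cong) (auto simp: eigenvector_def)
    finally show ?thesis by (simp add: dot_scale_right dot_commute)
  qed
  then show ?thesis
    unfolding qform_eq_bform bform_def orthonormal_Parseval[OF e, of x]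
    by (intro sum.cong refl) (simp add: power2_eq_square)
qed

text \<open>An eigenvector with positive eigenvalue is the image of a multiple of itself, and
  orthonormal vectors are independent. This bounds the number of directions that \<Sigma>1 puts into
  S.\<close>

lemma card_pos_eigenvalues_le_mrank:
  assumes e: "orthonormal_basis d e" and ev: "\<And>j. j < d \<Longrightarrow> eigenvector d A (m j) (e j)"
  shows "card {j. j < d \<and> 0 < m j} \<le> mrank d A"
proof (rule card_le_mrank)
  let ?P = "{j. j < d \<and> 0 < m j}"
  show "finite ?P" by simp
  show "e j i = mvmul d A (\<lambda>k. (1 / m j) * e j k) i" if "j \<in> ?P" "i < d" for i j
  proof -
    have "mvmul d A (\<lambda>k. (1 / m j) * e j k) i = (1 / m j) * mvmul d A (e j) i"
      unfolding mvmul_dot by (rule dot_scale_right)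
    then show ?thesis using ev[of j] that by (simp add: eigenvector_def)
  qed
  fix c assume c: "\<And>i. i < d \<Longrightarrow> (\<Sum>j\<in>?P. c j * e j i) = 0"
  show "\<forall>j\<in>?P. c j = 0"
  proof
    fix l assume l: "l \<in> ?P"
    have "0 = dot {..<d} (\<lambda>i. \<Sum>j\<in>?P. c j * e j i) (e l)" using c by (simp add: dot_def)
    also have "\<dots> = (\<Sum>j\<in>?P. c j * (if j = l then 1 else 0))"
      unfolding dot_sum_left dot_scale_left using e l by (intro sum.cong refl) (auto simp: orthonormal_basis_def)
    also have "\<dots> = c l" using l by (simp add: if_distrib[of "\<lambda>x. _ * x"] cong: if_cong)
    finally show "c l = 0" by simp
  qed
qed

section \<open>Gaussian quadratic forms\<close>

lemma prob_space_std_gauss: "prob_space std_gauss"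
  unfolding std_gauss_def by (intro prob_space_normal_density) simp

lemma sets_std_gauss [measurable_cong, simp]: "sets std_gauss = sets borel"
  by (simp add: std_gauss_def)

interpretation std_gauss: prob_space std_gauss
  by (rule prob_space_std_gauss)

interpretation gauss_prod: product_sigma_finite "\<lambda>_. std_gauss"
  by standard

lemma borel_measurable_std_gauss: "f \<in> borel_measurable borel \<Longrightarrow> f \<in> borel_measurable std_gauss"
  by (simp add: measurable_cong_sets[OF sets_std_gauss refl])

lemma std_gauss_exp: "(\<integral>\<^sup>+x. ennreal (exp (a * x)) \<partial>std_gauss) = ennreal (exp (a\<^sup>2 / 2))"
proof -
  have "(\<integral>\<^sup>+x. ennreal (exp (a * x)) \<partial>std_gauss) =
      (\<integral>\<^sup>+x. ennreal (std_normal_density x) * ennreal (exp (a * x)) \<partial>lborel)"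
    unfolding std_gauss_def by (subst nn_integral_density) auto
  also have "\<dots> = (\<integral>\<^sup>+x. ennreal (exp (a\<^sup>2 / 2)) * ennreal (normal_density a 1 x) \<partial>lborel)"
  proof (rule nn_integral_cong)
    fix x :: real
    have "- x\<^sup>2 / 2 + a * x = a\<^sup>2 / 2 - (x - a)\<^sup>2 / 2" by (simp add: power2_eq_square field_simps)
    then have "exp (- x\<^sup>2 / 2) * exp (a * x) = exp (a\<^sup>2 / 2) * exp (- (x - a)\<^sup>2 / 2)"
      by (simp flip: exp_add)
    then have "std_normal_density x * exp (a * x) = exp (a\<^sup>2 / 2) * normal_density a 1 x"
      by (simp add: std_normal_density_def normal_density_def)
    then show "ennreal (std_normal_density x) * ennreal (exp (a * x)) = ennreal (exp (a\<^sup>2 / 2)) * ennreal (normal_density a 1 x)"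
      by (simp flip: ennreal_mult)
  qed
  also have "\<dots> = ennreal (exp (a\<^sup>2 / 2)) * (\<integral>\<^sup>+x. ennreal (normal_density a 1 x) \<partial>lborel)"
    by (rule nn_integral_cmult) simp
  also have "(\<integral>\<^sup>+x. ennreal (normal_density a 1 x) \<partial>lborel) = 1"
    by (subst nn_integral_eq_integral) auto
  finally show ?thesis by simp
qed

text \<open>Tilting by \<open>exp (t * x\<^sup>2)\<close> turns the standard density into a multiple
  of the centred one with variance 1 / (1 - 2 t). Negative \<open>t\<close> are included because the
  lower tails use them.\<close>

lemma std_gauss_exp_square:
  assumes "t < 1 / 2"
  shows "(\<integral>\<^sup>+x. ennreal (exp (t * x\<^sup>2)) \<partial>std_gauss) = ennreal (1 / sqrt (1 - 2 * t))"
proof -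
  define s where "s = 1 / sqrt (1 - 2 * t)"
  have pos: "1 - 2 * t > 0" using assms by simp
  have s: "s > 0" "s\<^sup>2 = 1 / (1 - 2 * t)" using pos by (simp_all add: s_def power_divide)
  have "(\<integral>\<^sup>+x. ennreal (exp (t * x\<^sup>2)) \<partial>std_gauss) =
      (\<integral>\<^sup>+x. ennreal (std_normal_density x) * ennreal (exp (t * x\<^sup>2)) \<partial>lborel)"
    unfolding std_gauss_def by (subst nn_integral_density) auto
  also have "\<dots> = (\<integral>\<^sup>+x. ennreal s * ennreal (normal_density 0 s x) \<partial>lborel)"
  proof (rule nn_integral_cong)
    fix x :: real
    have "- x\<^sup>2 / 2 + t * x\<^sup>2 = - x\<^sup>2 / (2 * s\<^sup>2)" using pos unfolding s(2) by (simp add: field_simps)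
    then have "exp (- x\<^sup>2 / 2) * exp (t * x\<^sup>2) = exp (- x\<^sup>2 / (2 * s\<^sup>2))"
      by (simp flip: exp_add)
    moreover have "sqrt (2 * pi * s\<^sup>2) = sqrt (2 * pi) * s" using s(1) by (simp add: real_sqrt_mult)
    ultimately have "std_normal_density x * exp (t * x\<^sup>2) = s * normal_density 0 s x"
      using s(1) by (simp add: std_normal_density_def normal_density_def)
    then show "ennreal (std_normal_density x) * ennreal (exp (t * x\<^sup>2)) = ennreal s * ennreal (normal_density 0 s x)"
      using s(1) by (simp flip: ennreal_mult)
  qed
  also have "\<dots> = ennreal s * (\<integral>\<^sup>+x. ennreal (normal_density 0 s x) \<partial>lborel)"
    by (rule nn_integral_cmult) simp
  also have "(\<integral>\<^sup>+x. ennreal (normal_density 0 s x) \<partial>lborel) = 1"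
    using s(1) by (subst nn_integral_eq_integral) auto
  finally show ?thesis by (simp add: s_def)
qed

lemma std_gauss_iexp: "(\<integral>x. iexp (a * x) \<partial>std_gauss) = complex_of_real (exp (- a\<^sup>2 / 2))"
  using fun_cong[OF char_std_normal_distribution, of a] by (simp add: char_def std_gauss_def)

abbreviation gaussians :: "'i set \<Rightarrow> ('i \<Rightarrow> real) measure" where
  "gaussians I \<equiv> PiM I (\<lambda>_. std_gauss)"

lemma prob_space_gaussians: "prob_space (gaussians I)"
  by (rule prob_space_PiM) (rule prob_space_std_gauss)

lemma measurable_gaussians_component [measurable (raw)]:
  "i \<in> I \<Longrightarrow> (\<lambda>Z. Z i) \<in> borel_measurable (gaussians I)"
  using measurable_component_singleton[of i I "\<lambda>_. std_gauss"]
  by (simp add: measurable_cong_sets[OF refl sets_std_gauss])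

lemma measurable_dot [measurable]:
  "dot I v \<in> borel_measurable (gaussians I)"
  unfolding dot_def by (intro borel_measurable_sum borel_measurable_times measurable_gaussians_component borel_measurable_const)

lemma gaussians_exp_dot:
  assumes "finite I"
  shows "(\<integral>\<^sup>+Z. ennreal (exp (dot I a Z)) \<partial>gaussians I) = ennreal (exp (dot I a a / 2))"
proof -
  have "(\<integral>\<^sup>+Z. ennreal (exp (dot I a Z)) \<partial>gaussians I) = (\<integral>\<^sup>+Z. (\<Prod>i\<in>I. ennreal (exp (a i * Z i))) \<partial>gaussians I)"
    using assms by (simp add: dot_def exp_sum prod_ennreal)
  also have "\<dots> = (\<Prod>i\<in>I. \<integral>\<^sup>+x. ennreal (exp (a i * x)) \<partial>std_gauss)"
    using assms by (intro gauss_prod.product_nn_integral_prod borel_measurable_std_gauss) auto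
  also have "\<dots> = ennreal (exp (dot I a a / 2))"
    using assms by (simp add: std_gauss_exp prod_ennreal dot_def exp_sum sum_divide_distrib power2_eq_square)
  finally show ?thesis .
qed

lemma gaussians_exp_squares:
  assumes "finite I" "\<And>i. i \<in> I \<Longrightarrow> t i < 1 / 2"
  shows "(\<integral>\<^sup>+Z. ennreal (exp (\<Sum>i\<in>I. t i * (Z i)\<^sup>2)) \<partial>gaussians I) = ennreal (\<Prod>i\<in>I. 1 / sqrt (1 - 2 * t i))"
proof -
  have "(\<integral>\<^sup>+Z. ennreal (exp (\<Sum>i\<in>I. t i * (Z i)\<^sup>2)) \<partial>gaussians I)
      = (\<integral>\<^sup>+Z. (\<Prod>i\<in>I. ennreal (exp (t i * (Z i)\<^sup>2))) \<partial>gaussians I)"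
    using assms by (simp add: exp_sum prod_ennreal)
  also have "\<dots> = (\<Prod>i\<in>I. \<integral>\<^sup>+x. ennreal (exp (t i * x\<^sup>2)) \<partial>std_gauss)"
    using assms by (intro gauss_prod.product_nn_integral_prod borel_measurable_std_gauss) auto
  also have "\<dots> = (\<Prod>i\<in>I. ennreal (1 / sqrt (1 - 2 * t i)))"
    using assms by (intro prod.cong refl std_gauss_exp_square) auto
  also have "\<dots> = ennreal (\<Prod>i\<in>I. 1 / sqrt (1 - 2 * t i))"
    using assms(2) by (intro prod_ennreal) (force simp: less_imp_le)
  finally show ?thesis .
qed

text \<open>The real part of the characteristic function. Its integrand is real and bounded, which
  is what Fubini needs in the decoupling of negative exponents.\<close>

lemma gaussians_cos_dot:
  assumes "finite I"
  shows "(\<integral>Z. cos (dot I a Z) \<partial>gaussians I) = exp (- dot I a a / 2)"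
proof -
  have int: "integrable std_gauss (\<lambda>x. iexp (a i * x))" for i
    by (rule std_gauss.integrable_const_bound[of _ 1])
      (simp_all add: borel_measurable_std_gauss)
  have eq: "iexp (dot I a Z) = (\<Prod>i\<in>I. iexp (a i * Z i))" for Z
    using assms by (simp add: dot_def exp_sum sum_distrib_left)
  have int': "integrable (gaussians I) (\<lambda>Z. iexp (dot I a Z))"
    unfolding eq by (rule gauss_prod.product_integrable_prod[OF assms int])
  have "(\<integral>Z. iexp (dot I a Z) \<partial>gaussians I) = (\<Prod>i\<in>I. \<integral>x. iexp (a i * x) \<partial>std_gauss)"
    unfolding eq by (rule gauss_prod.product_integral_prod[OF assms int])
  also have "\<dots> = complex_of_real (exp (- dot I a a / 2))"
    using assms unfolding std_gauss_iexp of_real_prod[symmetric] exp_sum[OF assms, symmetric]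
    by (simp add: dot_def sum_divide_distrib sum_negf power2_eq_square)
  finally have "Re (\<integral>Z. iexp (dot I a Z) \<partial>gaussians I) = exp (- dot I a a / 2)" by simp
  then show ?thesis using integral_Re[OF int'] by (simp add: Re_exp)
qed

section \<open>Decoupling of Gaussian quadratic forms\<close>

text \<open>Decoupling: \<open>exp (x\<^sup>2 / 2)\<close> is the expectation of \<open>exp (h x)\<close> and \<open>exp (- x\<^sup>2 / 2)\<close> that of
  \<open>cos (h x)\<close> over an independent Gaussian \<open>h\<close>.\<close>

lemma dot_swap: "dot J h (\<lambda>j. dot I (v j) Z) = dot I (\<lambda>i. \<Sum>j\<in>J. h j * v j i) Z"
  by (simp add: dot_sum_left dot_scale_left) (simp add: dot_def)

text \<open>The exchange replaces the covariance of the forms \<open>dot I (v j)\<close> by a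
  quadratic form in \<open>h\<close>, so nothing has to be diagonalised: for orthogonal
  \<open>v j\<close> the right-hand side is a product of one-dimensional integrals, and in general
  an operator norm bound on the form suffices.\<close>

lemma gaussians_decouple_exp:
  assumes "finite I" "finite J"
  shows "(\<integral>\<^sup>+Z. ennreal (exp ((\<Sum>j\<in>J. (dot I (v j) Z)\<^sup>2) / 2)) \<partial>gaussians I)
    = (\<integral>\<^sup>+h. ennreal (exp ((\<Sum>i\<in>I. (\<Sum>j\<in>J. h j * v j i)\<^sup>2) / 2)) \<partial>gaussians J)"
proof -
  interpret I: prob_space "gaussians I" by (rule prob_space_gaussians)
  interpret J: prob_space "gaussians J" by (rule prob_space_gaussians)
  interpret IJ: pair_sigma_finite "gaussians I" "gaussians J" ..
  have [measurable]: "(\<lambda>x. dot J (snd x) (\<lambda>j. dot I (v j) (fst x))) \<in> borel_measurable (gaussians I \<Otimes>\<^sub>M gaussians J)"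
    unfolding dot_def
    by (intro borel_measurable_sum borel_measurable_times measurable_compose[OF measurable_snd measurable_gaussians_component]
        measurable_compose[OF measurable_fst measurable_gaussians_component] borel_measurable_const)
  have "(\<integral>\<^sup>+Z. ennreal (exp ((\<Sum>j\<in>J. (dot I (v j) Z)\<^sup>2) / 2)) \<partial>gaussians I)
    = (\<integral>\<^sup>+Z. \<integral>\<^sup>+h. ennreal (exp (dot J h (\<lambda>j. dot I (v j) Z))) \<partial>gaussians J \<partial>gaussians I)"
  proof (intro nn_integral_cong)
    fix Z
    show "ennreal (exp ((\<Sum>j\<in>J. (dot I (v j) Z)\<^sup>2) / 2)) = (\<integral>\<^sup>+h. ennreal (exp (dot J h (\<lambda>j. dot I (v j) Z))) \<partial>gaussians J)"
      using gaussians_exp_dot[OF assms(2), of "\<lambda>j. dot I (v j) Z"]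
      by (simp add: dot_def[of J] power2_eq_square mult.commute)
  qed
  also have "\<dots> = (\<integral>\<^sup>+h. \<integral>\<^sup>+Z. ennreal (exp (dot J h (\<lambda>j. dot I (v j) Z))) \<partial>gaussians I \<partial>gaussians J)"
    by (rule IJ.Fubini'[symmetric]) (simp add: split_beta')
  also have "\<dots> = (\<integral>\<^sup>+h. ennreal (exp ((\<Sum>i\<in>I. (\<Sum>j\<in>J. h j * v j i)\<^sup>2) / 2)) \<partial>gaussians J)"
    unfolding dot_swap gaussians_exp_dot[OF assms(1)] by (simp add: dot_def power2_eq_square)
  finally show ?thesis .
qed

lemma gaussians_decouple_exp_neg:
  assumes "finite I" "finite J"
  shows "(\<integral>Z. exp (- (\<Sum>j\<in>J. (dot I (v j) Z)\<^sup>2) / 2) \<partial>gaussians I)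
    = (\<integral>h. exp (- (\<Sum>i\<in>I. (\<Sum>j\<in>J. h j * v j i)\<^sup>2) / 2) \<partial>gaussians J)"
proof -
  interpret I: prob_space "gaussians I" by (rule prob_space_gaussians)
  interpret J: prob_space "gaussians J" by (rule prob_space_gaussians)
  interpret IJ: pair_prob_space "gaussians I" "gaussians J" ..
  have [measurable]: "(\<lambda>x. dot J (snd x) (\<lambda>j. dot I (v j) (fst x))) \<in> borel_measurable (gaussians I \<Otimes>\<^sub>M gaussians J)"
    unfolding dot_def
    by (intro borel_measurable_sum borel_measurable_times measurable_compose[OF measurable_snd measurable_gaussians_component]
        measurable_compose[OF measurable_fst measurable_gaussians_component] borel_measurable_const)
  have int: "integrable (gaussians I \<Otimes>\<^sub>M gaussians J) (\<lambda>(Z, h). cos (dot J h (\<lambda>j. dot I (v j) Z)))"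
  proof (rule IJ.P.integrable_const_bound[of _ 1])
    show "(\<lambda>(Z, h). cos (dot J h (\<lambda>j. dot I (v j) Z))) \<in> borel_measurable (gaussians I \<Otimes>\<^sub>M gaussians J)"
      unfolding split_beta' by measurable
  qed (simp add: split_beta')
  have "(\<integral>Z. exp (- (\<Sum>j\<in>J. (dot I (v j) Z)\<^sup>2) / 2) \<partial>gaussians I)
    = (\<integral>Z. \<integral>h. cos (dot J h (\<lambda>j. dot I (v j) Z)) \<partial>gaussians J \<partial>gaussians I)"
  proof (intro Bochner_Integration.integral_cong refl)
    fix Z
    show "exp (- (\<Sum>j\<in>J. (dot I (v j) Z)\<^sup>2) / 2) = (\<integral>h. cos (dot J h (\<lambda>j. dot I (v j) Z)) \<partial>gaussians J)"
      using gaussians_cos_dot[OF assms(2), of "\<lambda>j. dot I (v j) Z"]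
      by (simp add: dot_def[of J] power2_eq_square mult.commute)
  qed
  also have "\<dots> = (\<integral>h. \<integral>Z. cos (dot J h (\<lambda>j. dot I (v j) Z)) \<partial>gaussians I \<partial>gaussians J)"
    by (rule IJ.Fubini_integral[symmetric, OF int])
  also have "\<dots> = (\<integral>h. exp (- (\<Sum>i\<in>I. (\<Sum>j\<in>J. h j * v j i)\<^sup>2) / 2) \<partial>gaussians J)"
    unfolding dot_swap gaussians_cos_dot[OF assms(1)] by (simp add: dot_def power2_eq_square)
  finally show ?thesis .
qed

lemma norm_square_orthogonal_combination:
  assumes "finite J" and orth: "\<And>j k. j \<in> J \<Longrightarrow> k \<in> J \<Longrightarrow> j \<noteq> k \<Longrightarrow> dot I (v j) (v k) = 0"
  shows "(\<Sum>i\<in>I. (\<Sum>j\<in>J. h j * v j i)\<^sup>2) = (\<Sum>j\<in>J. dot I (v j) (v j) * (h j)\<^sup>2)"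
proof -
  have "(\<Sum>i\<in>I. (\<Sum>j\<in>J. h j * v j i)\<^sup>2) = dot I (\<lambda>i. \<Sum>j\<in>J. h j * v j i) (\<lambda>i. \<Sum>j\<in>J. h j * v j i)"
    by (simp add: dot_def power2_eq_square)
  also have "\<dots> = (\<Sum>j\<in>J. \<Sum>k\<in>J. h j * (h k * dot I (v j) (v k)))"
    by (simp add: dot_sum_left dot_sum_right dot_scale_left dot_scale_right sum_distrib_left)
  also have "\<dots> = (\<Sum>j\<in>J. \<Sum>k\<in>J. if k = j then dot I (v j) (v j) * (h j)\<^sup>2 else 0)"
    using orth by (intro sum.cong refl) (auto simp: power2_eq_square)
  also have "\<dots> = (\<Sum>j\<in>J. dot I (v j) (v j) * (h j)\<^sup>2)" using assms(1) by simp
  finally show ?thesis .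
qed

text \<open>Exponentiated second-order lower bounds for \<open>ln (1 - x)\<close> and
  \<open>ln (1 + x)\<close>. The linear term is kept exact because it has to cancel against the mean
  of the quadratic form.\<close>

lemma inverse_sqrt_le_exp:
  fixes x :: real
  assumes "0 \<le> x" "x \<le> 1 / 2"
  shows "1 / sqrt (1 - x) \<le> exp (x / 2 + x\<^sup>2)" "1 / sqrt (1 + x) \<le> exp (- x / 2 + x\<^sup>2)"
proof -
  have half: "1 / sqrt y = exp (- ln y / 2)" if "y > 0" for y :: real
    using that by (simp add: ln_sqrt[symmetric] exp_minus inverse_eq_divide)
  have "- x - 2 * x\<^sup>2 \<le> ln (1 - x)"
    using ln_one_minus_pos_lower_bound[OF assms] .
  then show "1 / sqrt (1 - x) \<le> exp (x / 2 + x\<^sup>2)" using assms by (subst half) auto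
  have "x - 2 * x\<^sup>2 \<le> ln (1 + x)"
    using ln_one_plus_pos_lower_bound[of x] assms zero_le_power2[of x] by linarith
  then show "1 / sqrt (1 + x) \<le> exp (- x / 2 + x\<^sup>2)" using assms by (subst half) auto
qed

section \<open>Exponential tail bounds\<close>

lemma (in prob_space) Chernoff_nn:
  assumes [measurable]: "X \<in> borel_measurable M" and t: "t \<ge> 0"
    and E: "(\<integral>\<^sup>+x. ennreal (exp (t * X x)) \<partial>M) \<le> ennreal c" and c: "c \<ge> 0"
  shows "prob {x \<in> space M. X x \<ge> s} \<le> c * exp (- t * s)"
proof -
  have "emeasure M {x \<in> space M. X x \<ge> s} = (\<integral>\<^sup>+x. indicator {x \<in> space M. X x \<ge> s} x \<partial>M)"
    by simp
  also have "\<dots> \<le> (\<integral>\<^sup>+x. ennreal (exp (- t * s)) * ennreal (exp (t * X x)) \<partial>M)"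
  proof (rule nn_integral_mono)
    fix x
    have "1 \<le> exp (t * X x - t * s)" if "X x \<ge> s" using that t by (simp add: mult_left_mono)
    then show "indicator {x \<in> space M. X x \<ge> s} x \<le> ennreal (exp (- t * s)) * ennreal (exp (t * X x))"
      by (auto simp: indicator_def simp flip: ennreal_mult ennreal_1 exp_add)
  qed
  also have "\<dots> = ennreal (exp (- t * s)) * (\<integral>\<^sup>+x. ennreal (exp (t * X x)) \<partial>M)"
    by (rule nn_integral_cmult) simp
  also have "\<dots> \<le> ennreal (exp (- t * s)) * ennreal c" using E by (rule mult_left_mono) simp
  also have "\<dots> = ennreal (c * exp (- t * s))" using c by (simp add: mult.commute flip: ennreal_mult)
  finally show ?thesis using c by (simp add: emeasure_eq_measure)
qed

text \<open>Decoupling with orthogonal \<open>v j\<close> leaves the product of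
  \<open>1 / sqrt (1 - 2 t b)\<close> over the squared lengths b (with a plus sign for the lower
  tail). The condition 4 t b <= 1 keeps 2 t b below 1/2, where each factor is the exponential of t b
  up to a second-order term; these terms add up to \<open>4 * t\<^sup>2 * V\<close>.\<close>

lemma gaussian_quadratic_tail:
  assumes I: "finite I" and J: "finite J"
    and orth: "\<And>j k. j \<in> J \<Longrightarrow> k \<in> J \<Longrightarrow> j \<noteq> k \<Longrightarrow> dot I (v j) (v k) = 0"
    and t: "t > 0" "\<And>j. j \<in> J \<Longrightarrow> 4 * t * dot I (v j) (v j) \<le> 1"
  defines "\<mu> \<equiv> \<Sum>j\<in>J. dot I (v j) (v j)" and "V \<equiv> \<Sum>j\<in>J. (dot I (v j) (v j))\<^sup>2"
  shows "measure (gaussians I) {Z \<in> space (gaussians I). (\<Sum>j\<in>J. (dot I (v j) Z)\<^sup>2) \<ge> \<mu> + s} \<le> exp (- t * s + 4 * t\<^sup>2 * V)"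
    and "measure (gaussians I) {Z \<in> space (gaussians I). (\<Sum>j\<in>J. (dot I (v j) Z)\<^sup>2) \<le> \<mu> - s} \<le> exp (- t * s + 4 * t\<^sup>2 * V)"
proof -
  interpret prob_space "gaussians I" by (rule prob_space_gaussians)
  \<comment> \<open>Scaling the vectors by \<open>sqrt (2 * t)\<close> brings
    \<open>exp (t * Q)\<close> to the form \<open>exp (Q / 2)\<close> of the decoupling
    identity.\<close>
  define r where "r = sqrt (2 * t)"
  have r: "r * r = 2 * t" using t by (simp add: r_def)
  define u where "u = (\<lambda>j i. r * v j i)"
  define b where "b = (\<lambda>j. dot I (v j) (v j))"
  have b0: "0 \<le> b j" for j by (simp add: b_def dot_self_nonneg)
  have b1: "2 * t * b j \<le> 1 / 2" if "j \<in> J" for j using t(2)[OF that] by (simp add: b_def)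
  have Q: "(\<Sum>j\<in>J. (dot I (u j) Z)\<^sup>2) / 2 = t * (\<Sum>j\<in>J. (dot I (v j) Z)\<^sup>2)" for Z
    using r by (simp add: u_def dot_scale_left power_mult_distrib power2_eq_square[of r] sum_distrib_left)
      (simp add: mult.assoc flip: sum_distrib_left)
  have orthu: "dot I (u j) (u k) = 0" if "j \<in> J" "k \<in> J" "j \<noteq> k" for j k
    using orth[OF that] by (simp add: u_def dot_scale_left dot_scale_right)
  have bu: "dot I (u j) (u j) = 2 * t * b j" for j
    by (simp add: u_def b_def dot_scale_left dot_scale_right mult.assoc[symmetric] r)
  have NS: "(\<Sum>i\<in>I. (\<Sum>j\<in>J. h j * u j i)\<^sup>2) / 2 = (\<Sum>j\<in>J. (t * b j) * (h j)\<^sup>2)" for h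
    using norm_square_orthogonal_combination[where v = u and J = J and I = I and h = h, OF J orthu]
    unfolding bu by (simp add: sum_distrib_left mult.assoc flip: sum_distrib_left)
  define Qf where "Qf = (\<lambda>Z. \<Sum>j\<in>J. (dot I (v j) Z)\<^sup>2)"
  have [measurable]: "Qf \<in> borel_measurable (gaussians I)" unfolding Qf_def by measurable
  have prod_le: "(\<Prod>j\<in>J. 1 / sqrt (1 - 2 * t * b j)) \<le> exp (t * \<mu> + 4 * t\<^sup>2 * V)"
  proof -
    have "(\<Prod>j\<in>J. 1 / sqrt (1 - 2 * t * b j)) \<le> (\<Prod>j\<in>J. exp (2 * t * b j / 2 + (2 * t * b j)\<^sup>2))"
    proof (intro prod_mono conjI)
      fix j assume j: "j \<in> J"
      have x: "0 \<le> 2 * t * b j" "2 * t * b j \<le> 1/2" using b0 b1[OF j] t by auto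
      show "1 / sqrt (1 - 2 * t * b j) \<le> exp (2 * t * b j / 2 + (2 * t * b j)\<^sup>2)" by (rule inverse_sqrt_le_exp(1)[OF x])
      show "0 \<le> 1 / sqrt (1 - 2 * t * b j)" using x by simp
    qed
    also have "\<dots> = exp (t * \<mu> + 4 * t\<^sup>2 * V)"
      unfolding exp_sum[OF J, symmetric] \<mu>_def V_def b_def
      by (simp add: sum.distrib sum_distrib_left power_mult_distrib field_simps)
    finally show ?thesis .
  qed
  have E1: "(\<integral>\<^sup>+Z. ennreal (exp (t * Qf Z)) \<partial>gaussians I) \<le> ennreal (exp (t * \<mu> + 4 * t\<^sup>2 * V))"
  proof -
    have "(\<integral>\<^sup>+Z. ennreal (exp (t * Qf Z)) \<partial>gaussians I)
        = (\<integral>\<^sup>+h. ennreal (exp (\<Sum>j\<in>J. (t * b j) * (h j)\<^sup>2)) \<partial>gaussians J)"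
      using gaussians_decouple_exp[OF I J, of u] unfolding Q NS Qf_def .
    also have "\<dots> = ennreal (\<Prod>j\<in>J. 1 / sqrt (1 - 2 * (t * b j)))"
      using b1 by (intro gaussians_exp_squares[OF J]) fastforce
    finally show ?thesis using prod_le by (simp add: mult.assoc ennreal_leI)
  qed
  have "prob {Z \<in> space (gaussians I). Qf Z \<ge> \<mu> + s} \<le> exp (t * \<mu> + 4 * t\<^sup>2 * V) * exp (- t * (\<mu> + s))"
    using E1 t by (intro Chernoff_nn) auto
  also have "\<dots> = exp (- t * s + 4 * t\<^sup>2 * V)" by (simp add: algebra_simps flip: exp_add)
  finally show "prob {Z \<in> space (gaussians I). (\<Sum>j\<in>J. (dot I (v j) Z)\<^sup>2) \<ge> \<mu> + s} \<le> exp (- t * s + 4 * t\<^sup>2 * V)"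
    by (simp add: Qf_def)
  have prod_le': "(\<Prod>j\<in>J. 1 / sqrt (1 + 2 * t * b j)) \<le> exp (- t * \<mu> + 4 * t\<^sup>2 * V)"
  proof -
    have "(\<Prod>j\<in>J. 1 / sqrt (1 + 2 * t * b j)) \<le> (\<Prod>j\<in>J. exp (- (2 * t * b j) / 2 + (2 * t * b j)\<^sup>2))"
    proof (intro prod_mono conjI)
      fix j assume j: "j \<in> J"
      have x: "0 \<le> 2 * t * b j" "2 * t * b j \<le> 1/2" using b0 b1[OF j] t by auto
      show "1 / sqrt (1 + 2 * t * b j) \<le> exp (- (2 * t * b j) / 2 + (2 * t * b j)\<^sup>2)" by (rule inverse_sqrt_le_exp(2)[OF x])
      show "0 \<le> 1 / sqrt (1 + 2 * t * b j)" using x by simp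
    qed
    also have "\<dots> = exp (- t * \<mu> + 4 * t\<^sup>2 * V)"
      unfolding exp_sum[OF J, symmetric] \<mu>_def V_def b_def
      by (simp add: sum.distrib sum_distrib_left power_mult_distrib sum_negf field_simps sum_subtractf)
    finally show ?thesis .
  qed
  \<comment> \<open>Decoupling of the negative exponential is an identity of Bochner integrals; both
    integrands lie between 0 and 1, which allows the passage from and to the nonnegative
    integral.\<close>
  have E2: "(\<integral>\<^sup>+Z. ennreal (exp (t * (- Qf Z))) \<partial>gaussians I) \<le> ennreal (exp (- t * \<mu> + 4 * t\<^sup>2 * V))"
  proof -
    interpret J: prob_space "gaussians J" by (rule prob_space_gaussians)
    have Q0: "0 \<le> Qf Z" for Z by (simp add: Qf_def sum_nonneg)
    have "(\<integral>\<^sup>+Z. ennreal (exp (t * (- Qf Z))) \<partial>gaussians I) = ennreal (\<integral>Z. exp (t * (- Qf Z)) \<partial>gaussians I)"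
      using Q0 t by (intro nn_integral_eq_integral integrable_const_bound[of _ 1]) auto
    also have "(\<integral>Z. exp (t * (- Qf Z)) \<partial>gaussians I) = (\<integral>h. exp (\<Sum>j\<in>J. (- t * b j) * (h j)\<^sup>2) \<partial>gaussians J)"
    proof -
      have "- (\<Sum>j\<in>J. (dot I (u j) Z)\<^sup>2) / 2 = t * (- Qf Z)" for Z using Q[of Z] by (simp add: Qf_def)
      moreover have "- (\<Sum>i\<in>I. (\<Sum>j\<in>J. h j * u j i)\<^sup>2) / 2 = (\<Sum>j\<in>J. (- t * b j) * (h j)\<^sup>2)" for h
        using NS[of h] by (simp add: sum_negf)
      ultimately show ?thesis using gaussians_decouple_exp_neg[OF I J, of u] by simp
    qed
    also have "ennreal \<dots> = (\<integral>\<^sup>+h. ennreal (exp (\<Sum>j\<in>J. (- t * b j) * (h j)\<^sup>2)) \<partial>gaussians J)"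
      using b0 t by (intro nn_integral_eq_integral[symmetric] J.integrable_const_bound[of _ 1])
        (auto intro!: sum_nonpos mult_nonneg_nonneg simp: mult_nonneg_nonneg)
    also have "\<dots> = ennreal (\<Prod>j\<in>J. 1 / sqrt (1 - 2 * (- t * b j)))"
      using b0 t by (intro gaussians_exp_squares[OF J]) (smt (verit) mult_nonneg_nonneg mult_minus_left divide_pos_pos)
    finally show ?thesis using prod_le' by (simp add: mult.assoc ennreal_leI)
  qed
  have "prob {Z \<in> space (gaussians I). - Qf Z \<ge> - (\<mu> - s)} \<le> exp (- t * \<mu> + 4 * t\<^sup>2 * V) * exp (- t * (- (\<mu> - s)))"
    using E2 t by (intro Chernoff_nn) auto
  also have "\<dots> = exp (- t * s + 4 * t\<^sup>2 * V)" by (simp add: algebra_simps flip: exp_add)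
  finally show "prob {Z \<in> space (gaussians I). (\<Sum>j\<in>J. (dot I (v j) Z)\<^sup>2) \<le> \<mu> - s} \<le> exp (- t * s + 4 * t\<^sup>2 * V)"
    by (simp add: Qf_def algebra_simps)
qed

text \<open>With t = 1/(4 b2) the decoupled exponent is at most |h|^2 / 4, so the exponential moment
  is at most \<open>sqrt 2\<close> to the power \<open>card J\<close>, hence at most
  \<open>exp (card J)\<close>. No orthogonality enters, only the operator norm, at the price of the
  constant 4 and no exact centring.\<close>

lemma gaussian_low_rank_tail:
  assumes I: "finite I" and J: "finite J" and b2: "b2 > 0"
    and op: "\<And>h. (\<Sum>i\<in>I. (\<Sum>j\<in>J. h j * v j i)\<^sup>2) \<le> b2 * (\<Sum>j\<in>J. (h j)\<^sup>2)"
  shows "measure (gaussians I) {Z \<in> space (gaussians I). (\<Sum>j\<in>J. (dot I (v j) Z)\<^sup>2) \<ge> 4 * b2 * (real (card J) + x)} \<le> exp (- x)"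
proof -
  interpret prob_space "gaussians I" by (rule prob_space_gaussians)
  define t where "t = 1 / (4 * b2)"
  define r where "r = sqrt (2 * t)"
  have t: "t > 0" using b2 by (simp add: t_def)
  have r: "r\<^sup>2 = 2 * t" using t by (simp add: r_def)
  define Qf where "Qf = (\<lambda>Z. \<Sum>j\<in>J. (dot I (v j) Z)\<^sup>2)"
  have [measurable]: "Qf \<in> borel_measurable (gaussians I)" unfolding Qf_def by measurable
  have Q: "(\<Sum>j\<in>J. (dot I (\<lambda>i. r * v j i) Z)\<^sup>2) / 2 = t * Qf Z" for Z
    by (simp add: dot_scale_left power_mult_distrib r Qf_def flip: sum_distrib_left)
  have NS: "(\<Sum>i\<in>I. (\<Sum>j\<in>J. h j * (r * v j i))\<^sup>2) / 2 \<le> (\<Sum>j\<in>J. (1 / 4) * (h j)\<^sup>2)" for h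
  proof -
    have "(\<Sum>i\<in>I. (\<Sum>j\<in>J. h j * (r * v j i))\<^sup>2) = (\<Sum>i\<in>I. (r * (\<Sum>j\<in>J. h j * v j i))\<^sup>2)"
      unfolding sum_distrib_left by (simp add: mult.left_commute)
    also have "\<dots> = 2 * t * (\<Sum>i\<in>I. (\<Sum>j\<in>J. h j * v j i)\<^sup>2)"
      unfolding power_mult_distrib r sum_distrib_left[symmetric] ..
    also have "\<dots> \<le> 2 * t * (b2 * (\<Sum>j\<in>J. (h j)\<^sup>2))" using t op by (intro mult_left_mono) auto
    also have "\<dots> = (\<Sum>j\<in>J. (h j)\<^sup>2) / 2" using b2 by (simp add: t_def)
    finally have "(\<Sum>i\<in>I. (\<Sum>j\<in>J. h j * (r * v j i))\<^sup>2) \<le> (\<Sum>j\<in>J. (h j)\<^sup>2) / 2" .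
    then have "(\<Sum>i\<in>I. (\<Sum>j\<in>J. h j * (r * v j i))\<^sup>2) / 2 \<le> (1 / 4) * (\<Sum>j\<in>J. (h j)\<^sup>2)" by linarith
    then show ?thesis by (simp only: sum_distrib_left)
  qed
  have "(\<integral>\<^sup>+Z. ennreal (exp (t * Qf Z)) \<partial>gaussians I)
      = (\<integral>\<^sup>+h. ennreal (exp ((\<Sum>i\<in>I. (\<Sum>j\<in>J. h j * (r * v j i))\<^sup>2) / 2)) \<partial>gaussians J)"
    using gaussians_decouple_exp[OF I J, of "\<lambda>j i. r * v j i"] unfolding Q .
  also have "\<dots> \<le> (\<integral>\<^sup>+h. ennreal (exp (\<Sum>j\<in>J. (1 / 4) * (h j)\<^sup>2)) \<partial>gaussians J)"
    using NS by (intro nn_integral_mono) (simp add: ennreal_leI)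
  also have "\<dots> = ennreal (\<Prod>j\<in>J. 1 / sqrt (1 - 2 * (1 / 4)))" by (intro gaussians_exp_squares[OF J]) auto
  also have "\<dots> \<le> ennreal (exp (real (card J)))"
  proof -
    have "1 / sqrt (1 - 2 * (1 / 4 :: real)) \<le> exp 1"
    proof -
      have "1 / sqrt (1 - 2 * (1 / 4 :: real)) = sqrt 2" by (simp add: real_sqrt_divide)
      also have "\<dots> \<le> 2" by (simp add: sqrt_le_D real_le_lsqrt)
      also have "\<dots> \<le> exp 1" using exp_ge_add_one_self[of 1] by simp
      finally show ?thesis .
    qed
    then have "(1 / sqrt (1 - 2 * (1 / 4 :: real))) ^ card J \<le> exp 1 ^ card J" by (intro power_mono) auto
    then show ?thesis by (simp add: ennreal_leI exp_of_nat_mult[symmetric])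
  qed
  finally have "prob {Z \<in> space (gaussians I). Qf Z \<ge> 4 * b2 * (real (card J) + x)}
      \<le> exp (real (card J)) * exp (- t * (4 * b2 * (real (card J) + x)))"
    using t by (intro Chernoff_nn) auto
  also have "\<dots> = exp (- x)" using b2 by (simp add: t_def flip: exp_add)
  finally show ?thesis by (simp add: Qf_def)
qed

text \<open>Without any orthogonality, convexity of \<open>exp\<close> still controls a sum of squares by its mean.\<close>

lemma gaussian_trace_tail:
  assumes I: "finite I" and J: "finite J" and x: "x \<ge> 0"
    and tr: "(\<Sum>j\<in>J. dot I (v j) (v j)) \<le> tr" "tr > 0"
  shows "measure (gaussians I) {Z \<in> space (gaussians I). (\<Sum>j\<in>J. (dot I (v j) Z)\<^sup>2) \<ge> 4 * tr * x} \<le> 2 * exp (- x)"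
proof -
  interpret prob_space "gaussians I" by (rule prob_space_gaussians)
  define b where "b = (\<lambda>j. dot I (v j) (v j))"
  have b0: "0 \<le> b j" for j by (simp add: b_def dot_self_nonneg)
  define Qf where "Qf = (\<lambda>Z. \<Sum>j\<in>J. (dot I (v j) Z)\<^sup>2)"
  have [measurable]: "Qf \<in> borel_measurable (gaussians I)" unfolding Qf_def by measurable
  define p where "p = (\<lambda>j. b j / tr)"
  have sp: "sum p J \<le> 1" using tr by (simp add: p_def b_def flip: sum_divide_distrib)
  have p0: "0 \<le> p j" for j using b0 tr by (simp add: p_def)
  define y where "y = (\<lambda>j Z. (dot I (v j) Z)\<^sup>2 / (4 * b j))"
  have [measurable]: "y j \<in> borel_measurable (gaussians I)" for j unfolding y_def by measurable
  \<comment> \<open>If \<open>b j = 0\<close> the form vanishes by Cauchy-Schwarz, so the default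
    value of the division by 0 in \<open>y j\<close> does no harm.\<close>
  have py: "(dot I (v j) Z)\<^sup>2 / (4 * tr) = p j * y j Z" for j Z
  proof (cases "b j = 0")
    case True
    have "(dot I (v j) Z)\<^sup>2 \<le> b j * dot I Z Z" unfolding b_def by (rule dot_Cauchy_Schwarz)
    with True show ?thesis by (simp add: p_def)
  next
    case False
    then show ?thesis by (simp add: p_def y_def)
  qed
  have conv: "exp ((1 / (4 * tr)) * Qf Z) \<le> (1 - sum p J) + (\<Sum>j\<in>J. p j * exp (y j Z))" for Z
  proof -
    \<comment> \<open>The weights \<open>p\<close> may sum to less than 1; the missing mass is put
      on the value 0 through the extra index \<open>None\<close>, so that Jensen applies to a
      genuine convex combination.\<close>
    let ?J = "insert None (Some ` J)"
    let ?a = "\<lambda>k. case k of None \<Rightarrow> 1 - sum p J | Some j \<Rightarrow> p j"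
    let ?y = "\<lambda>k. case k of None \<Rightarrow> 0 | Some j \<Rightarrow> y j Z"
    have conv: "convex_on UNIV (exp :: real \<Rightarrow> real)" by (rule convex_on_exp[of 1, simplified])
    have "exp (\<Sum>k\<in>?J. ?a k *\<^sub>R ?y k) \<le> (\<Sum>k\<in>?J. ?a k * exp (?y k))"
      using J sp p0 by (intro convex_on_sum[OF _ _ conv]) (auto simp: sum.reindex)
    moreover have "(1 / (4 * tr)) * Qf Z = (\<Sum>k\<in>?J. ?a k *\<^sub>R ?y k)"
      using J by (simp add: sum.reindex Qf_def sum_divide_distrib py)
    moreover have "(\<Sum>k\<in>?J. ?a k * exp (?y k)) = (1 - sum p J) + (\<Sum>j\<in>J. p j * exp (y j Z))"
      using J by (simp add: sum.reindex)
    ultimately show ?thesis by simp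
  qed
  \<comment> \<open>For \<open>b j > 0\<close>, \<open>y j\<close> is a quarter of the square of a
    standard Gaussian, whose exponential has mean \<open>sqrt 2\<close>.\<close>
  have Ey: "(\<integral>\<^sup>+Z. ennreal (exp (y j Z)) \<partial>gaussians I) \<le> 2" for j
  proof (cases "b j = 0")
    case True
    then show ?thesis by (simp add: y_def emeasure_space_1)
  next
    case False
    with b0[of j] have bj: "b j > 0" by simp
    define r where "r = sqrt (1 / (2 * b j))"
    have r: "r\<^sup>2 = 1 / (2 * b j)" using bj by (simp add: r_def)
    have "(\<integral>\<^sup>+Z. ennreal (exp (y j Z)) \<partial>gaussians I)
       = (\<integral>\<^sup>+Z. ennreal (exp ((\<Sum>k\<in>{()}. (dot I (\<lambda>i. r * v j i) Z)\<^sup>2) / 2)) \<partial>gaussians I)"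
      by (simp add: dot_scale_left power_mult_distrib r y_def)
    also have "\<dots> = (\<integral>\<^sup>+h. ennreal (exp ((\<Sum>i\<in>I. (\<Sum>k\<in>{()}. h k * (r * v j i))\<^sup>2) / 2)) \<partial>gaussians {()})"
      by (rule gaussians_decouple_exp[OF I]) simp
    also have "\<dots> = (\<integral>\<^sup>+h. ennreal (exp (\<Sum>k\<in>{()}. (1 / 4) * (h k)\<^sup>2)) \<partial>gaussians {()})"
    proof (intro nn_integral_cong arg_cong[where f = ennreal] arg_cong[where f = exp])
      fix h :: "unit \<Rightarrow> real"
      have "(\<Sum>i\<in>I. (h () * (r * v j i))\<^sup>2) = (h ())\<^sup>2 * r\<^sup>2 * b j"
        by (simp add: b_def dot_def power_mult_distrib sum_distrib_left power2_eq_square mult_ac)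
      then show "(\<Sum>i\<in>I. (\<Sum>k\<in>{()}. h k * (r * v j i))\<^sup>2) / 2 = (\<Sum>k\<in>{()}. (1 / 4) * (h k)\<^sup>2)"
        using bj by (simp add: r)
    qed
    also have "\<dots> = ennreal (\<Prod>k\<in>{()}. 1 / sqrt (1 - 2 * (1 / 4)))" by (intro gaussians_exp_squares) auto
    also have "\<dots> = ennreal (sqrt 2)" by (simp add: real_sqrt_divide)
    also have "\<dots> \<le> ennreal 2" by (intro ennreal_leI) (simp add: real_le_lsqrt)
    finally show ?thesis by simp
  qed
  have "(\<integral>\<^sup>+Z. ennreal (exp ((1 / (4 * tr)) * Qf Z)) \<partial>gaussians I)
     \<le> (\<integral>\<^sup>+Z. ennreal (1 - sum p J) + (\<Sum>j\<in>J. ennreal (p j) * ennreal (exp (y j Z))) \<partial>gaussians I)"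
  proof (rule nn_integral_mono)
    fix Z
    have "ennreal (exp ((1 / (4 * tr)) * Qf Z)) \<le> ennreal ((1 - sum p J) + (\<Sum>j\<in>J. p j * exp (y j Z)))"
      using conv by (rule ennreal_leI)
    also have "\<dots> = ennreal (1 - sum p J) + (\<Sum>j\<in>J. ennreal (p j) * ennreal (exp (y j Z)))"
      using sp p0 by (subst ennreal_plus) (auto intro!: sum_nonneg simp: ennreal_mult simp flip: sum_ennreal)
    finally show "ennreal (exp ((1 / (4 * tr)) * Qf Z)) \<le> \<dots>" .
  qed
  also have "\<dots> = ennreal (1 - sum p J) + (\<Sum>j\<in>J. ennreal (p j) * (\<integral>\<^sup>+Z. ennreal (exp (y j Z)) \<partial>gaussians I))"
    by (subst nn_integral_add) (auto simp: nn_integral_sum nn_integral_cmult emeasure_space_1)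
  also have "\<dots> \<le> ennreal (1 - sum p J) + (\<Sum>j\<in>J. ennreal (p j) * 2)"
    using Ey by (intro add_mono sum_mono mult_left_mono) auto
  also have "(\<Sum>j\<in>J. ennreal (p j) * 2) = ennreal (2 * sum p J)"
  proof -
    have "(\<Sum>j\<in>J. ennreal (p j) * 2) = (\<Sum>j\<in>J. ennreal (p j)) * 2" by (rule sum_distrib_right[symmetric])
    also have "\<dots> = ennreal (sum p J) * ennreal 2" using p0 by simp
    also have "\<dots> = ennreal (2 * sum p J)" using p0
      by (subst ennreal_mult[symmetric]) (simp_all add: sum_nonneg mult.commute)
    finally show ?thesis .
  qed
  also have "ennreal (1 - sum p J) + ennreal (2 * sum p J) = ennreal (1 + sum p J)"
    using sp p0 by (simp add: sum_nonneg flip: ennreal_plus)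
  also have "\<dots> \<le> ennreal 2" using sp by (intro ennreal_leI) simp
  finally have "prob {Z \<in> space (gaussians I). Qf Z \<ge> 4 * tr * x} \<le> 2 * exp (- (1 / (4 * tr)) * (4 * tr * x))"
    using tr by (intro Chernoff_nn) auto
  also have "\<dots> = 2 * exp (- x)" using tr by simp
  finally show ?thesis by (simp add: Qf_def)
qed

section \<open>Gram operators\<close>

text \<open>The operator on sample space summing the rank-one projections x -> <h j, x> h j. With
  \<open>h j\<close> the column of the design along the j-th eigendirection, it is the Gram matrix
  of the samples restricted to the block \<open>J\<close>.\<close>

definition gram :: "'i set \<Rightarrow> 'j set \<Rightarrow> ('j \<Rightarrow> 'i \<Rightarrow> real) \<Rightarrow> ('i \<Rightarrow> real) \<Rightarrow> 'i \<Rightarrow> real" where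
  "gram I J h x = (\<lambda>i. \<Sum>j\<in>J. dot I (h j) x * h j i)"

lemma dot_gram: "dot I y (gram I J h x) = (\<Sum>j\<in>J. dot I (h j) y * dot I (h j) x)"
proof -
  have "dot I y (gram I J h x) = (\<Sum>j\<in>J. dot I (h j) x * dot I y (h j))"
    unfolding gram_def dot_sum_right dot_scale_right ..
  then show ?thesis by (simp add: dot_commute[of I y] mult.commute)
qed

lemma dot_gram_self: "dot I x (gram I J h x) = (\<Sum>j\<in>J. (dot I (h j) x)\<^sup>2)"
  by (simp add: dot_gram power2_eq_square)

lemma dot_gram_sym: "dot I y (gram I J h x) = dot I (gram I J h y) x"
  by (simp add: dot_commute[of I "gram I J h y"] dot_gram mult.commute)

lemma gram_add: "gram I J h (\<lambda>i. x i + y i) i = gram I J h x i + gram I J h y i"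
  and gram_diff: "gram I J h (\<lambda>i. x i - y i) i = gram I J h x i - gram I J h y i"
  and gram_scale: "gram I J h (\<lambda>i. a * x i) i = a * gram I J h x i"
  by (simp_all add: gram_def dot_add_right dot_diff_right dot_scale_right algebra_simps sum.distrib
      sum_subtractf sum_distrib_left)

lemma gram_sum: "gram I J h (\<lambda>i. \<Sum>k\<in>A. f k i) i = (\<Sum>k\<in>A. gram I J h (f k) i)"
proof -
  have "gram I J h (\<lambda>i. \<Sum>k\<in>A. f k i) i = (\<Sum>j\<in>J. \<Sum>k\<in>A. dot I (h j) (f k) * h j i)"
    by (simp add: gram_def dot_sum_right sum_distrib_right)
  also have "\<dots> = (\<Sum>k\<in>A. gram I J h (f k) i)" unfolding gram_def by (rule sum.swap)
  finally show ?thesis .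
qed

lemma gram_norm_le:
  assumes L: "\<And>x. (\<Sum>j\<in>J. (dot I (h j) x)\<^sup>2) \<le> L * dot I x x"
  shows "dot I (gram I J h x) (gram I J h x) \<le> L * (\<Sum>j\<in>J. (dot I (h j) x)\<^sup>2)"
proof -
  let ?y = "gram I J h x"
  have "(dot I ?y ?y)\<^sup>2 = (\<Sum>j\<in>J. dot I (h j) ?y * dot I (h j) x)\<^sup>2"
    by (simp add: dot_gram)
  also have "\<dots> \<le> (\<Sum>j\<in>J. (dot I (h j) ?y)\<^sup>2) * (\<Sum>j\<in>J. (dot I (h j) x)\<^sup>2)"
    by (rule Cauchy_Schwarz_ineq_sum)
  also have "\<dots> \<le> (L * dot I ?y ?y) * (\<Sum>j\<in>J. (dot I (h j) x)\<^sup>2)"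
    using L by (intro mult_right_mono) (auto intro: sum_nonneg)
  finally have *: "dot I ?y ?y * dot I ?y ?y \<le> dot I ?y ?y * (L * (\<Sum>j\<in>J. (dot I (h j) x)\<^sup>2))"
    by (simp add: power2_eq_square mult_ac)
  show ?thesis
  proof (cases "dot I ?y ?y = 0")
    case True
    have "0 \<le> (\<Sum>j\<in>J. (dot I (h j) x)\<^sup>2)" by (simp add: sum_nonneg)
    \<comment> \<open>No sign of \<open>L\<close> is given: for negative \<open>L\<close> the upper
      bound forces the quadratic form to vanish.\<close>
    moreover have "0 \<le> L \<or> (\<Sum>j\<in>J. (dot I (h j) x)\<^sup>2) = 0"
    proof (rule ccontr)
      assume "\<not> ?thesis"
      then have "L * dot I x x \<le> 0" "(\<Sum>j\<in>J. (dot I (h j) x)\<^sup>2) > 0"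
        using dot_self_nonneg[of I x] \<open>0 \<le> (\<Sum>j\<in>J. (dot I (h j) x)\<^sup>2)\<close> by (auto simp: mult_le_0_iff less_le)
      with L[of x] show False by simp
    qed
    ultimately show ?thesis using True by auto
  next
    case False
    then show ?thesis using * dot_self_nonneg[of I ?y] by (simp add: less_le)
  qed
qed

text \<open>The inverse of the Gram operator as the limit of the Richardson iteration, which keeps it
  measurable in the vectors \<open>h j\<close>.\<close>

primrec Richardson :: "'i set \<Rightarrow> 'j set \<Rightarrow> ('j \<Rightarrow> 'i \<Rightarrow> real) \<Rightarrow> real \<Rightarrow> 'i \<Rightarrow> nat \<Rightarrow> 'i \<Rightarrow> real" where
  "Richardson I J h L k 0 = (\<lambda>i. 0)"
| "Richardson I J h L k (Suc N) = (\<lambda>i. Richardson I J h L k N i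
     + ((if i = k then 1 else 0) - gram I J h (Richardson I J h L k N) i) / L)"

text \<open>Column \<open>k\<close> of the inverse. Where the iteration does not converge,
  \<open>lim\<close> is a default value, so that measurability holds everywhere and correctness only
  on well-conditioned blocks.\<close>

definition gram_inv :: "'i set \<Rightarrow> 'j set \<Rightarrow> ('j \<Rightarrow> 'i \<Rightarrow> real) \<Rightarrow> real \<Rightarrow> 'i \<Rightarrow> 'i \<Rightarrow> real" where
  "gram_inv I J h L k i = lim (\<lambda>N. Richardson I J h L k N i)"

text \<open>Writing K for the Gram operator, |K x|^2 <= L <x, K x> means that the quadratic term of
  the step costs only half of the gain 2 <x, K x> / L; the other half is at least c |x|^2 /
  L.\<close>

lemma gram_Richardson_step_le:
  assumes L: "L > 0" "\<And>x. (\<Sum>j\<in>J. (dot I (h j) x)\<^sup>2) \<le> L * dot I x x"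
    and c: "\<And>x. c * dot I x x \<le> (\<Sum>j\<in>J. (dot I (h j) x)\<^sup>2)"
  defines "E \<equiv> \<lambda>x i. x i - gram I J h x i / L"
  shows "dot I (E x) (E x) \<le> (1 - c / L) * dot I x x"
proof -
  let ?q = "\<Sum>j\<in>J. (dot I (h j) x)\<^sup>2" and ?y = "gram I J h x"
  have E: "E x = (\<lambda>i. x i - (1 / L) * ?y i)" by (simp add: E_def)
  have "dot I (E x) (E x) = dot I x x - 2 * (1 / L) * dot I x ?y + (1 / L)\<^sup>2 * dot I ?y ?y"
    unfolding E by (simp only: dot_diff_left dot_diff_right dot_scale_left dot_scale_right)
      (simp add: dot_commute[of I ?y x] power2_eq_square)
  also have "dot I x ?y = ?q" by (rule dot_gram_self)
  also have "(1 / L)\<^sup>2 * dot I ?y ?y \<le> (1 / L)\<^sup>2 * (L * ?q)"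
    using gram_norm_le[OF L(2)] by (intro mult_left_mono) auto
  also have "(1 / L)\<^sup>2 * (L * ?q) = ?q / L" using L(1) by (simp add: power2_eq_square)
  also have "dot I x x - 2 * (1 / L) * ?q + ?q / L = dot I x x - ?q / L" by (simp add: field_simps)
  also have "\<dots> \<le> dot I x x - c * dot I x x / L" using c[of x] L(1) by (simp add: divide_right_mono)
  finally show ?thesis by (simp add: algebra_simps)
qed

text \<open>The residuals \<open>D N\<close> are iterated by the contraction of
  \<open>gram_Richardson_step_le\<close>. They decay geometrically, so the iterates, being partial
  sums of residuals over \<open>L\<close>, converge, and the limit has residual 0.\<close>

theorem gram_inv_correct:
  assumes I: "finite I" and L: "L > 0" "\<And>x. (\<Sum>j\<in>J. (dot I (h j) x)\<^sup>2) \<le> L * dot I x x"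
    and c: "c > 0" "\<And>x. c * dot I x x \<le> (\<Sum>j\<in>J. (dot I (h j) x)\<^sup>2)"
    and k: "k \<in> I" and i: "i \<in> I"
  shows "gram I J h (gram_inv I J h L k) i = (if i = k then 1 else 0)"
proof -
  let ?R = "Richardson I J h L k"
  define D where "D N = (\<lambda>i. (if i = k then 1 else 0) - gram I J h (?R N) i)" for N
  have stepR: "?R (Suc N) i = ?R N i + (1 / L) * D N i" for N i by (simp add: D_def)
  have stepD: "D (Suc N) = (\<lambda>i. D N i - gram I J h (D N) i / L)" for N
  proof
    fix i
    have "gram I J h (?R (Suc N)) i = gram I J h (\<lambda>i. ?R N i + (1 / L) * D N i) i"
      unfolding stepR[abs_def] ..
    also have "\<dots> = gram I J h (?R N) i + (1 / L) * gram I J h (D N) i"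
      by (simp only: gram_add gram_scale)
    finally have "gram I J h (?R (Suc N)) i = gram I J h (?R N) i + (1 / L) * gram I J h (D N) i" .
    then show "D (Suc N) i = D N i - gram I J h (D N) i / L" by (simp add: D_def)
  qed
  \<comment> \<open>The maximum makes \<open>\<rho>\<close> nonnegative without comparing
    \<open>c\<close> with \<open>L\<close>.\<close>
  define \<rho> where "\<rho> = max 0 (1 - c / L)"
  have \<rho>: "0 \<le> \<rho>" "\<rho> < 1" using L c by (auto simp: \<rho>_def)
  have Dle: "dot I (D N) (D N) \<le> \<rho> ^ N" for N
  proof (induction N)
    case 0
    have "D 0 i = (if i = k then 1 else 0)" for i by (simp add: D_def gram_def dot_def)
    then have "dot I (D 0) (D 0) = (\<Sum>i\<in>I. if i = k then 1 else 0)"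
      unfolding dot_def by (intro sum.cong) auto
    then show ?case using I k by simp
  next
    case (Suc N)
    have "dot I (D (Suc N)) (D (Suc N)) \<le> (1 - c / L) * dot I (D N) (D N)"
      unfolding stepD by (rule gram_Richardson_step_le[OF L c(2)])
    also have "\<dots> \<le> \<rho> * dot I (D N) (D N)"
      using dot_self_nonneg by (intro mult_right_mono) (auto simp: \<rho>_def)
    also have "\<dots> \<le> \<rho> * \<rho> ^ N" using Suc \<rho> by (intro mult_left_mono)
    finally show ?case by simp
  qed
  have Dabs: "\<bar>D N i\<bar> \<le> sqrt \<rho> ^ N" if "i \<in> I" for N i
  proof -
    have "(D N i)\<^sup>2 \<le> dot I (D N) (D N)"
      using member_le_sum[OF that, of "\<lambda>i. (D N i)\<^sup>2"] I by (simp add: dot_def power2_eq_square)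
    also have "\<dots> \<le> \<rho> ^ N" by (rule Dle)
    finally have "sqrt ((D N i)\<^sup>2) \<le> sqrt (\<rho> ^ N)" by (rule real_sqrt_le_mono)
    then have "\<bar>D N i\<bar> \<le> sqrt (\<rho> ^ N)" unfolding real_sqrt_abs .
    then show ?thesis by (simp only: real_sqrt_power)
  qed
  have s\<rho>: "norm (sqrt \<rho>) < 1" using \<rho> by simp
  have conv: "(\<lambda>N. ?R N i) \<longlonglongrightarrow> gram_inv I J h L k i" if i: "i \<in> I" for i
  proof -
    have "summable (\<lambda>N. D N i)"
      by (rule summable_comparison_test'[OF summable_geometric[OF s\<rho>], of 0]) (use Dabs[OF i] in auto)
    then have "(\<lambda>N. (1 / L) * (\<Sum>m<N. D m i)) \<longlonglongrightarrow> (1 / L) * suminf (\<lambda>N. D N i)"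
      by (intro tendsto_intros summable_LIMSEQ)
    moreover have "?R N i = (1 / L) * (\<Sum>m<N. D m i)" for N
    proof (induction N)
      case (Suc N)
      then show ?case unfolding stepR by (simp add: algebra_simps)
    qed simp
    ultimately have "convergent (\<lambda>N. ?R N i)" by (auto simp: convergent_def)
    then show ?thesis unfolding gram_inv_def by (simp add: convergent_LIMSEQ_iff)
  qed
  have "(\<lambda>N. gram I J h (?R N) i) \<longlonglongrightarrow> gram I J h (gram_inv I J h L k) i"
    unfolding gram_def dot_def by (intro tendsto_intros conv)
  then have "(\<lambda>N. D N i) \<longlonglongrightarrow> (if i = k then 1 else 0) - gram I J h (gram_inv I J h L k) i"
    unfolding D_def by (auto intro!: tendsto_intros)
  moreover have "(\<lambda>N. D N i) \<longlonglongrightarrow> 0"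
    by (rule Lim_null_comparison[OF _ LIMSEQ_power_zero[OF s\<rho>]]) (use Dabs[OF i] in auto)
  ultimately show ?thesis using LIMSEQ_unique by fastforce
qed

definition gram_solve :: "'i set \<Rightarrow> 'j set \<Rightarrow> ('j \<Rightarrow> 'i \<Rightarrow> real) \<Rightarrow> real \<Rightarrow> ('i \<Rightarrow> real) \<Rightarrow> 'i \<Rightarrow> real" where
  "gram_solve I J h L y = (\<lambda>i. \<Sum>k\<in>I. y k * gram_inv I J h L k i)"

corollary gram_gram_solve:
  assumes I: "finite I" and L: "L > 0" "\<And>x. (\<Sum>j\<in>J. (dot I (h j) x)\<^sup>2) \<le> L * dot I x x"
    and c: "c > 0" "\<And>x. c * dot I x x \<le> (\<Sum>j\<in>J. (dot I (h j) x)\<^sup>2)" and i: "i \<in> I"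
  shows "gram I J h (gram_solve I J h L y) i = y i"
proof -
  have "gram I J h (gram_solve I J h L y) i = (\<Sum>k\<in>I. y k * gram I J h (gram_inv I J h L k) i)"
    unfolding gram_solve_def gram_sum gram_scale ..
  also have "\<dots> = (\<Sum>k\<in>I. if k = i then y i else 0)"
    using gram_inv_correct[OF I L c _ i] by (intro sum.cong) auto
  finally show ?thesis using I i by simp
qed

corollary gram_surj:
  assumes I: "finite I" and c: "c > 0" "\<And>x. c * dot I x x \<le> (\<Sum>j\<in>J. (dot I (h j) x)\<^sup>2)"
  shows "\<exists>x. \<forall>i\<in>I. gram I J h x i = y i"
proof -
  \<comment> \<open>The trace bounds the operator; adding 1 keeps the bound positive, so the
    iteration can be run without an upper bound being supplied.\<close>
  define L where "L = 1 + (\<Sum>j\<in>J. dot I (h j) (h j))"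
  have L0: "L > 0" unfolding L_def using sum_nonneg[of J "\<lambda>j. dot I (h j) (h j)"] dot_self_nonneg by (smt (verit))
  have L: "(\<Sum>j\<in>J. (dot I (h j) x)\<^sup>2) \<le> L * dot I x x" for x
  proof -
    have "(\<Sum>j\<in>J. (dot I (h j) x)\<^sup>2) \<le> (\<Sum>j\<in>J. dot I (h j) (h j) * dot I x x)"
      by (intro sum_mono dot_Cauchy_Schwarz)
    also have "\<dots> \<le> L * dot I x x"
      using dot_self_nonneg[of I x] by (simp add: L_def distrib_right flip: sum_distrib_right)
    finally show ?thesis .
  qed
  show ?thesis using gram_gram_solve[OF I L0 L c] by blast
qed

lemma gram_inj:
  assumes "finite I" "c > 0" "\<And>x. c * dot I x x \<le> (\<Sum>j\<in>J. (dot I (h j) x)\<^sup>2)"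
    and eq: "\<And>i. i \<in> I \<Longrightarrow> gram I J h x i = gram I J h y i" and "i \<in> I"
  shows "x i = y i"
proof -
  let ?z = "\<lambda>i. x i - y i"
  have "dot I ?z (gram I J h ?z) = dot I ?z (\<lambda>_. 0)" using eq by (intro dot_cong) (auto simp: gram_diff)
  then have "(\<Sum>j\<in>J. (dot I (h j) ?z)\<^sup>2) = 0" unfolding dot_gram_self by (simp add: dot_def)
  with assms(3)[of ?z] have "c * dot I ?z ?z \<le> 0" by simp
  then have "dot I ?z ?z = 0" using assms(2) dot_self_nonneg[of I ?z] by (simp add: mult_le_0_iff order_antisym)
  then show ?thesis using dot_self_eq_0[OF assms(1), of ?z] assms(5) by simp
qed

lemma measurable_gram_inv:
  assumes "\<And>j i. j \<in> J \<Longrightarrow> i \<in> I \<Longrightarrow> (\<lambda>\<omega>. h \<omega> j i) \<in> borel_measurable M" and "i \<in> I"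
  shows "(\<lambda>\<omega>. gram_inv I J (h \<omega>) L k i) \<in> borel_measurable M"
proof -
  have R: "(\<lambda>\<omega>. Richardson I J (h \<omega>) L k N i) \<in> borel_measurable M" if "i \<in> I" for N i
    using that
  proof (induction N arbitrary: i)
    case (Suc N)
    have "(\<lambda>\<omega>. gram I J (h \<omega>) (Richardson I J (h \<omega>) L k N) i) \<in> borel_measurable M"
      unfolding gram_def dot_def using assms(1) Suc
      by (intro borel_measurable_sum borel_measurable_times) auto
    then show ?case using Suc by simp
  qed simp
  show ?thesis unfolding gram_inv_def
    by (rule borel_measurable_lim_metric) (rule R[OF assms(2)])
qed

section \<open>A net of the unit ball\<close>

text \<open>Integer points of the ball of radius 4 sqrt N with N = \<open>card I\<close>; division
  by that radius gives a lattice of mesh 1/(4 sqrt N) in the unit ball. The box makes finiteness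
  immediate and turns sums over lattice points into products.\<close>

definition int_grid :: "'i set \<Rightarrow> ('i \<Rightarrow> int) set" where
  "int_grid I = {z \<in> PiE I (\<lambda>_. {- int (4 * card I)..int (4 * card I)}). (\<Sum>i\<in>I. (z i)\<^sup>2) \<le> 16 * int (card I)}"

definition ball_net :: "'i set \<Rightarrow> ('i \<Rightarrow> real) set" where
  "ball_net I = (\<lambda>z i. real_of_int (z i) / (4 * sqrt (real (card I)))) ` int_grid I"

lemma finite_ball_net: "finite I \<Longrightarrow> finite (ball_net I)"
  by (simp add: ball_net_def int_grid_def finite_PiE)

lemma sum_geometric_int: "(\<Sum>k\<in>{- int m..int m}. (4 / 5 :: real) ^ nat \<bar>k\<bar>) \<le> 9"
proof -
  \<comment> \<open>The closed form with its exact remainder is what the induction can carry; the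
    limit is 1 + 2 * 4 = 9.\<close>
  have "(\<Sum>k\<in>{- int m..int m}. (4 / 5 :: real) ^ nat \<bar>k\<bar>) = 9 - 8 * (4 / 5) ^ m"
  proof (induction m)
    case (Suc m)
    have "{- int (Suc m)..int (Suc m)} = insert (- int (Suc m)) (insert (int (Suc m)) {- int m..int m})"
      by auto
    moreover have "- int (Suc m) \<notin> insert (int (Suc m)) {- int m..int m}" "int (Suc m) \<notin> {- int m..int m}"
      by auto
    moreover have "nat \<bar>- int (Suc m)\<bar> = Suc m" "nat \<bar>int (Suc m)\<bar> = Suc m" by auto
    ultimately have "(\<Sum>k\<in>{- int (Suc m)..int (Suc m)}. (4 / 5 :: real) ^ nat \<bar>k\<bar>)
        = 2 * (4 / 5) ^ Suc m + (\<Sum>k\<in>{- int m..int m}. (4 / 5 :: real) ^ nat \<bar>k\<bar>)"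
      by (simp only: sum.insert finite_insert finite_atLeastAtMost_int not_False_eq_True)
    then show ?case unfolding Suc by simp
  qed simp
  then show ?thesis by simp
qed

text \<open>Lattice points in a ball are counted with the generating function \<open>x ^ (\<Sum>\<bar>z i\<bar>)\<close> at \<open>x = 4/5\<close>.\<close>

lemma card_ball_net_le:
  assumes I: "finite I"
  shows "real (card (ball_net I)) \<le> 22 ^ card I"
proof -
  let ?N = "card I"
  let ?P = "PiE I (\<lambda>_. {- int (4 * ?N)..int (4 * ?N)})"
  have fin: "finite ?P" using I by (simp add: finite_PiE)
  have "real (card (int_grid I)) * (4 / 5) ^ (4 * ?N) = (\<Sum>z\<in>int_grid I. (4 / 5 :: real) ^ (4 * ?N))" by simp
  also have "\<dots> \<le> (\<Sum>z\<in>int_grid I. \<Prod>i\<in>I. (4 / 5 :: real) ^ nat \<bar>z i\<bar>)"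
  proof (rule sum_mono)
    fix z assume z: "z \<in> int_grid I"
    have "(\<Sum>i\<in>I. \<bar>real_of_int (z i)\<bar>)\<^sup>2 \<le> real ?N * (\<Sum>i\<in>I. \<bar>real_of_int (z i)\<bar>\<^sup>2)"
      using Cauchy_Schwarz_ineq_sum[of "\<lambda>_. 1" "\<lambda>i. \<bar>real_of_int (z i)\<bar>" I] by simp
    also have "(\<Sum>i\<in>I. \<bar>real_of_int (z i)\<bar>\<^sup>2) = real_of_int (\<Sum>i\<in>I. (z i)\<^sup>2)" by simp
    also have "real ?N * \<dots> \<le> real ?N * real_of_int (16 * int ?N)"
      using z unfolding int_grid_def by (intro mult_left_mono of_int_le_iff[THEN iffD2]) auto
    also have "\<dots> = (4 * real ?N)\<^sup>2" by (simp add: power2_eq_square)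
    finally have "(\<Sum>i\<in>I. \<bar>real_of_int (z i)\<bar>) \<le> 4 * real ?N" by (rule power2_le_imp_le) simp
    then have "real (\<Sum>i\<in>I. nat \<bar>z i\<bar>) \<le> real (4 * ?N)" by simp
    then have "(\<Sum>i\<in>I. nat \<bar>z i\<bar>) \<le> 4 * ?N" by linarith
    then have "(4 / 5 :: real) ^ (4 * ?N) \<le> (4 / 5) ^ (\<Sum>i\<in>I. nat \<bar>z i\<bar>)" by (intro power_decreasing) auto
    then show "(4 / 5 :: real) ^ (4 * ?N) \<le> (\<Prod>i\<in>I. (4 / 5) ^ nat \<bar>z i\<bar>)" by (simp add: power_sum)
  qed
  also have "\<dots> \<le> (\<Sum>z\<in>?P. \<Prod>i\<in>I. (4 / 5 :: real) ^ nat \<bar>z i\<bar>)"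
    using fin by (intro sum_mono2) (auto simp: int_grid_def intro!: prod_nonneg)
  also have "\<dots> = (\<Prod>i\<in>I. \<Sum>k\<in>{- int (4 * ?N)..int (4 * ?N)}. (4 / 5 :: real) ^ nat \<bar>k\<bar>)"
    using I by (intro prod_sum_PiE[symmetric]) auto
  also have "\<dots> \<le> (\<Prod>i\<in>I. 9)" by (intro prod_mono conjI sum_nonneg sum_geometric_int) auto
  also have "\<dots> = 9 ^ ?N" by simp
  finally have "real (card (int_grid I)) * (4 / 5) ^ (4 * ?N) \<le> 9 ^ ?N" .
  then have "real (card (int_grid I)) \<le> 9 ^ ?N / ((4 / 5) ^ 4) ^ ?N"
    unfolding power_mult by (subst pos_le_divide_eq) simp_all
  also have "\<dots> = (9 / (4 / 5) ^ 4) ^ ?N" by (simp only: power_divide)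
  \<comment> \<open>9 * 625 / 256 is just below 22.\<close>
  also have "\<dots> \<le> 22 ^ ?N" by (intro power_mono) (auto simp: eval_nat_numeral)
  finally have "real (card (int_grid I)) \<le> 22 ^ ?N" .
  moreover have "card (ball_net I) \<le> card (int_grid I)"
    unfolding ball_net_def using fin by (intro card_image_le) (auto simp: int_grid_def)
  ultimately show ?thesis by linarith
qed

lemma ball_net_norm_le:
  assumes "finite I" "y \<in> ball_net I"
  shows "dot I y y \<le> 1"
proof (cases "I = {}")
  case False
  then have N: "real (card I) > 0" using assms by (simp add: card_gt_0_iff)
  obtain z where z: "z \<in> int_grid I" "y = (\<lambda>i. real_of_int (z i) / (4 * sqrt (real (card I))))"
    using assms(2) by (auto simp: ball_net_def)
  have "dot I y y = real_of_int (\<Sum>i\<in>I. (z i)\<^sup>2) / (16 * real (card I))"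
    using N by (simp add: z(2) dot_def sum_divide_distrib power2_eq_square)
  also have "\<dots> \<le> real_of_int (16 * int (card I)) / (16 * real (card I))"
    using z(1) unfolding int_grid_def by (intro divide_right_mono of_int_le_iff[THEN iffD2]) auto
  also have "\<dots> = 1" using N by simp
  finally show ?thesis .
qed (simp add: dot_def)

text \<open>Rounding every scaled coordinate towards 0 never increases its absolute value, so the
  rounded point stays in the ball. Each of the N coordinates errs by at most 1/(4 sqrt N), which
  gives 1/16 in squared norm.\<close>

lemma ball_net_approx:
  assumes I: "finite I" and u: "dot I u u \<le> 1"
  obtains y where "y \<in> ball_net I" "dot I (\<lambda>i. u i - y i) (\<lambda>i. u i - y i) \<le> 1 / 16"
proof (cases "I = {}")
  case True
  have "(\<lambda>i\<in>I. 0) \<in> int_grid I" using True by (simp add: int_grid_def)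
  then show ?thesis using that True by (auto simp: ball_net_def dot_def)
next
  case False
  then have N: "real (card I) > 0" using I by (simp add: card_gt_0_iff)
  define s where "s = 4 * sqrt (real (card I))"
  have s: "s > 0" "s\<^sup>2 = 16 * real (card I)" using N by (auto simp: s_def power_mult_distrib)
  have N1: "real (card I) \<ge> 1" using N by (simp add: Suc_le_eq flip: of_nat_0_less_iff)
  have s4: "s \<le> 4 * real (card I)"
  proof -
    have "sqrt (real (card I)) \<le> real (card I)" using N1 by (simp add: real_le_lsqrt power2_eq_square)
    then show ?thesis by (simp add: s_def)
  qed
  define t where "t x = (if x \<ge> 0 then \<lfloor>x\<rfloor> else \<lceil>x\<rceil>)" for x :: real
  have t12: "\<bar>x - t x\<bar> \<le> 1 \<and> \<bar>real_of_int (t x)\<bar> \<le> \<bar>x\<bar>" for x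
  proof (cases "x \<ge> 0")
    case True
    then have "real_of_int \<lfloor>x\<rfloor> \<ge> 0" by simp
    moreover have "real_of_int \<lfloor>x\<rfloor> \<le> x" "x < real_of_int \<lfloor>x\<rfloor> + 1" by linarith+
    moreover have "real_of_int (t x) = \<lfloor>x\<rfloor>" using True by (simp add: t_def)
    ultimately show ?thesis using True by (intro conjI) (linarith, linarith)
  next
    case False
    then have "\<lceil>x\<rceil> \<le> 0" by (simp add: ceiling_le_iff)
    then have "real_of_int \<lceil>x\<rceil> \<le> 0" by simp
    moreover have "real_of_int \<lceil>x\<rceil> \<ge> x" "real_of_int \<lceil>x\<rceil> < x + 1" by linarith+
    moreover have "real_of_int (t x) = \<lceil>x\<rceil>" using False by (simp add: t_def)
    ultimately show ?thesis using False by (intro conjI) (linarith, linarith)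
  qed
  then have t: "\<bar>x - t x\<bar> \<le> 1" "\<bar>real_of_int (t x)\<bar> \<le> \<bar>x\<bar>" for x by blast+
  define z where "z = (\<lambda>i\<in>I. t (s * u i))"
  have ui: "\<bar>u i\<bar> \<le> 1" if "i \<in> I" for i
  proof -
    have "(u i)\<^sup>2 \<le> dot I u u" using member_le_sum[OF that, of "\<lambda>i. (u i)\<^sup>2"] I by (simp add: dot_def power2_eq_square)
    with u have "(u i)\<^sup>2 \<le> 1" by linarith
    then show ?thesis by (simp add: abs_square_le_1)
  qed
  have "z i \<in> {- int (4 * card I)..int (4 * card I)}" if "i \<in> I" for i
  proof -
    have "\<bar>real_of_int (z i)\<bar> \<le> \<bar>s * u i\<bar>" using t(2) that by (simp add: z_def)
    also have "\<dots> \<le> s * 1" using ui[OF that] s by (simp add: abs_mult mult_left_le)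
    finally have "\<bar>real_of_int (z i)\<bar> \<le> real (4 * card I)" using s4 by simp
    then show ?thesis by (simp add: abs_le_iff)
  qed
  moreover have "(\<Sum>i\<in>I. (z i)\<^sup>2) \<le> 16 * int (card I)"
  proof -
    have "real_of_int (\<Sum>i\<in>I. (z i)\<^sup>2) = (\<Sum>i\<in>I. \<bar>real_of_int (z i)\<bar>\<^sup>2)" by simp
    also have "\<dots> \<le> (\<Sum>i\<in>I. \<bar>s * u i\<bar>\<^sup>2)" using t(2) by (intro sum_mono power_mono) (auto simp: z_def)
    also have "\<dots> = s\<^sup>2 * dot I u u" by (simp add: dot_def sum_distrib_left power2_eq_square mult_ac)
    also have "\<dots> \<le> s\<^sup>2 * 1" using u by (intro mult_left_mono) auto
    also have "\<dots> = real_of_int (16 * int (card I))" using s by simp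
    finally show ?thesis by (simp only: of_int_le_iff)
  qed
  ultimately have "z \<in> int_grid I" by (auto simp: int_grid_def z_def)
  then have y: "(\<lambda>i. real_of_int (z i) / s) \<in> ball_net I" by (auto simp: ball_net_def s_def)
  have "dot I (\<lambda>i. u i - z i / s) (\<lambda>i. u i - z i / s) = (\<Sum>i\<in>I. (\<bar>s * u i - t (s * u i)\<bar> / s)\<^sup>2)"
    unfolding dot_def using s by (intro sum.cong refl) (simp add: z_def field_simps power2_eq_square)
  also have "\<dots> \<le> (\<Sum>i\<in>I. (1 / s)\<^sup>2)" using t(1) s by (intro sum_mono power_mono divide_right_mono) auto
  also have "\<dots> = 1 / 16" using s N by (simp add: power_divide)
  finally show ?thesis using that[OF y] by simp
qed

text \<open>With \<open>M\<close> the norm of the form and \<open>y\<close> a net point near \<open>u\<close>,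
  \<open>q u - q y = b (u - y) (u + y) \<le> M / 2\<close>, so \<open>M \<le> m + M / 2\<close>.\<close>

lemma quadratic_form_net_bound:
  fixes h :: "'j \<Rightarrow> 'i \<Rightarrow> real" and J :: "'j set" and c m :: real
  assumes I: "finite I"
  defines "q \<equiv> \<lambda>u. (\<Sum>j\<in>J. (dot I (h j) u)\<^sup>2) - c * dot I u u"
  assumes net: "\<And>y. y \<in> ball_net I \<Longrightarrow> \<bar>q y\<bar> \<le> m"
  shows "\<bar>q u\<bar> \<le> 2 * m * dot I u u"
proof -
  define b where "b x y = (\<Sum>j\<in>J. dot I (h j) x * dot I (h j) y) - c * dot I x y" for x y
  have q_scale: "q (\<lambda>i. a * x i) = a\<^sup>2 * q x" for a x
    by (simp add: q_def dot_scale_left dot_scale_right power_mult_distrib power2_eq_square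
        sum_distrib_left algebra_simps)
  have par: "q (\<lambda>i. x i + y i) - q (\<lambda>i. x i - y i) = 4 * b x y" for x y
    by (simp add: q_def b_def dot_add_left dot_add_right dot_diff_left dot_diff_right power2_eq_square
        sum.distrib sum_subtractf sum_distrib_left algebra_simps dot_commute[of I y x])
  have dif: "q u - q y = b (\<lambda>i. u i - y i) (\<lambda>i. u i + y i)" for u y
    by (simp add: q_def b_def dot_add_left dot_add_right dot_diff_left dot_diff_right power2_eq_square
        sum.distrib sum_subtractf sum_distrib_left algebra_simps dot_commute[of I y u])
  have parn: "dot I (\<lambda>i. x i + y i) (\<lambda>i. x i + y i) + dot I (\<lambda>i. x i - y i) (\<lambda>i. x i - y i)
      = 2 * dot I x x + 2 * dot I y y" for x y
    by (simp add: dot_add_left dot_add_right dot_diff_left dot_diff_right)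
  define U where "U = {\<bar>q u\<bar> | u. dot I u u \<le> 1}"
  define C where "C = (\<Sum>j\<in>J. dot I (h j) (h j)) + \<bar>c\<bar>"
  have qC: "\<bar>q u\<bar> \<le> C" if "dot I u u \<le> 1" for u
  proof -
    have "(\<Sum>j\<in>J. (dot I (h j) u)\<^sup>2) \<le> (\<Sum>j\<in>J. dot I (h j) (h j) * dot I u u)"
      by (intro sum_mono dot_Cauchy_Schwarz)
    also have "\<dots> \<le> (\<Sum>j\<in>J. dot I (h j) (h j) * 1)"
      using that by (intro sum_mono mult_left_mono dot_self_nonneg)
    finally have 1: "(\<Sum>j\<in>J. (dot I (h j) u)\<^sup>2) \<le> (\<Sum>j\<in>J. dot I (h j) (h j))" by simp
    have 2: "0 \<le> (\<Sum>j\<in>J. (dot I (h j) u)\<^sup>2)" by (simp add: sum_nonneg)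
    have "\<bar>c * dot I u u\<bar> \<le> \<bar>c\<bar> * 1"
      unfolding abs_mult using that dot_self_nonneg[of I u] by (intro mult_left_mono) auto
    with 1 2 show ?thesis unfolding q_def C_def by linarith
  qed
  have bdd: "bdd_above U" using qC by (auto simp: U_def intro!: bdd_aboveI[of _ C])
  define M where "M = Sup U"
  have qM1: "\<bar>q u\<bar> \<le> M" if "dot I u u \<le> 1" for u
    unfolding M_def by (rule cSup_upper[OF _ bdd]) (use that in \<open>auto simp: U_def\<close>)
  have q0: "q x = 0" if "dot I x x = 0" for x
  proof -
    have "dot I (h j) x = 0" for j using that dot_Cauchy_Schwarz[of I "h j" x] by simp
    then show ?thesis using that by (simp add: q_def)
  qed
  have qM: "\<bar>q x\<bar> \<le> M * dot I x x" for x
  proof (cases "dot I x x = 0")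
    case False
    then have p: "dot I x x > 0" using dot_self_nonneg[of I x] by simp
    define a where "a = 1 / sqrt (dot I x x)"
    have a: "a\<^sup>2 = 1 / dot I x x" using p by (simp add: a_def power_divide)
    have "dot I (\<lambda>i. a * x i) (\<lambda>i. a * x i) = 1"
      using p a by (simp add: dot_scale_left dot_scale_right mult.assoc[symmetric] power2_eq_square[symmetric])
    from qM1[of "\<lambda>i. a * x i"] this have "a\<^sup>2 * \<bar>q x\<bar> \<le> M" unfolding q_scale by (simp add: abs_mult)
    then show ?thesis using p by (simp add: a field_simps)
  qed (simp add: q0)
  have bM: "\<bar>b x y\<bar> \<le> M / 2 * (dot I x x + dot I y y)" for x y
  proof -
    have "4 * \<bar>b x y\<bar> \<le> \<bar>q (\<lambda>i. x i + y i)\<bar> + \<bar>q (\<lambda>i. x i - y i)\<bar>" using par[of x y] by linarith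
    also have "\<dots> \<le> M * dot I (\<lambda>i. x i + y i) (\<lambda>i. x i + y i) + M * dot I (\<lambda>i. x i - y i) (\<lambda>i. x i - y i)"
      by (intro add_mono qM)
    also have "\<dots> = M * (2 * dot I x x + 2 * dot I y y)" unfolding parn[symmetric] by (simp add: algebra_simps)
    finally show ?thesis by (simp add: algebra_simps)
  qed
  have "M \<le> m + M / 2"
  proof -
    have M0: "0 \<le> M" using qM1[of "\<lambda>_. 0"] by (simp add: dot_def) 
    have "v \<le> m + M / 2" if vU: "v \<in> U" for v
    proof -
      obtain u where u: "v = \<bar>q u\<bar>" "dot I u u \<le> 1" using vU by (auto simp: U_def)
      obtain y where y: "y \<in> ball_net I" "dot I (\<lambda>i. u i - y i) (\<lambda>i. u i - y i) \<le> 1 / 16"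
        using ball_net_approx[OF I u(2)] .
      let ?a = "\<lambda>i. u i - y i" and ?c = "\<lambda>i. u i + y i"
      have c4: "dot I ?c ?c \<le> 4"
        using parn[of u y] dot_self_nonneg[of I ?a] u(2) ball_net_norm_le[OF I y(1)] by linarith
      \<comment> \<open>The factors u - y and u + y have squared norms at most 1/16 and 4. Rescaling
        them by \<open>s\<close> and \<open>1 / s\<close> with \<open>s\<^sup>2 = 8\<close> makes
        both contribute 1/2.\<close>
      define s where "s = sqrt 8"
      have s: "s > 0" "s\<^sup>2 = 8" by (simp_all add: s_def)
      have bs: "b ?a ?c = b (\<lambda>i. s * ?a i) (\<lambda>i. (1 / s) * ?c i)"
        unfolding b_def dot_scale_left dot_scale_right using s by simp
      have "\<bar>b ?a ?c\<bar> \<le> M / 2 * (s\<^sup>2 * dot I ?a ?a + (1 / s)\<^sup>2 * dot I ?c ?c)"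
        using bM[of "\<lambda>i. s * ?a i" "\<lambda>i. (1 / s) * ?c i"]
        unfolding bs[symmetric] unfolding dot_scale_left dot_scale_right by (simp add: power2_eq_square mult.assoc)
      also have "\<dots> = M / 2 * (8 * dot I ?a ?a + dot I ?c ?c / 8)" using s by (simp add: power_divide)
      also have "\<dots> \<le> M / 2 * 1" using y(2) c4 M0 by (intro mult_left_mono) auto
      finally have "\<bar>q u - q y\<bar> \<le> M / 2" unfolding dif by simp
      with net[OF y(1)] u(1) show ?thesis by linarith
    qed
    then show ?thesis unfolding M_def by (intro cSup_least) (auto simp: U_def dot_def intro!: exI[of _ "\<lambda>_. 0"])
  qed
  then have "M \<le> 2 * m" by simp
  then show ?thesis using qM[of u] mult_right_mono[OF _ dot_self_nonneg[of I u], of M "2 * m"] by linarith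
qed

section \<open>Bias and variance of the interpolator\<close>

text \<open>The block of the design with columns \<open>h j\<close> applied to coefficients
  \<open>v\<close>; it is the transpose of the map sending x to the family
  \<open>dot I (h j) x\<close>.\<close>

definition comb :: "'j set \<Rightarrow> ('j \<Rightarrow> 'i \<Rightarrow> real) \<Rightarrow> ('j \<Rightarrow> real) \<Rightarrow> 'i \<Rightarrow> real" where
  "comb J h v = (\<lambda>i. \<Sum>j\<in>J. v j * h j i)"

lemma dot_comb: "dot I (comb J h v) x = (\<Sum>j\<in>J. v j * dot I (h j) x)"
  by (simp add: comb_def dot_sum_left dot_scale_left)

lemma gram_eq_comb: "gram I J h x = comb J h (\<lambda>j. dot I (h j) x)"
  by (simp add: gram_def comb_def)

lemma comb_diff: "comb J h (\<lambda>j. v j - w j) i = comb J h v i - comb J h w i"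
  by (simp add: comb_def algebra_simps sum_subtractf)

lemma comb_union:
  "finite J \<Longrightarrow> finite K \<Longrightarrow> J \<inter> K = {} \<Longrightarrow> comb (J \<union> K) h v i = comb J h v i + comb K h v i"
  by (simp add: comb_def sum.union_disjoint)

text \<open>The two blocks of an orthogonal design: \<open>S\<close> collects the few directions whose variance may be
  large and on which the design is a near isometry, \<open>B\<close> the many small directions whose Gram matrix
  is well conditioned.\<close>

locale split_design =
  fixes I :: "'i set" and S B :: "'j set" and h :: "'j \<Rightarrow> 'i \<Rightarrow> real" and m :: "'j \<Rightarrow> real"
    and \<kappa> c L \<tau> :: real
  assumes fin: "finite I" "finite S" "finite B" and disj: "S \<inter> B = {}"
    and m_nonneg: "\<And>j. 0 \<le> m j"
    and iso: "\<And>v. (\<Sum>j\<in>S. m j * (v j)\<^sup>2) \<le> \<kappa> * dot I (comb S h v) (comb S h v)" and \<kappa>: "\<kappa> > 0"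
    and c: "c > 0" "\<And>x. c * dot I x x \<le> (\<Sum>j\<in>B. (dot I (h j) x)\<^sup>2)"
    and L: "L > 0" "\<And>x. (\<Sum>j\<in>B. (dot I (h j) x)\<^sup>2) \<le> L * dot I x x"
    and \<tau>: "\<And>j. j \<in> B \<Longrightarrow> m j \<le> \<tau>" "\<tau> \<ge> 0"
begin

lemma solve: "\<exists>x. \<forall>i\<in>I. gram I B h x i = y i"
  by (rule gram_surj[OF fin(1) c])

text \<open>Write K for the Gram operator of B. The near isometry bounds the risk on S by the
  squared length of the image of v, which is |K q|^2, and |K q|^2 <= L <q, K q>. The energy of
  \<open>q\<close> is the quantity that the bias and the variance arguments can control.\<close>

lemma spikes_le:
  assumes q: "\<And>i. i \<in> I \<Longrightarrow> gram I B h q i = comb S h v i"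
  shows "(\<Sum>j\<in>S. m j * (v j)\<^sup>2) \<le> \<kappa> * L * (\<Sum>j\<in>B. (dot I (h j) q)\<^sup>2)"
proof -
  have "dot I (comb S h v) (comb S h v) = dot I (gram I B h q) (gram I B h q)"
    using q by (intro dot_cong) auto
  also have "\<dots> \<le> L * (\<Sum>j\<in>B. (dot I (h j) q)\<^sup>2)" by (rule gram_norm_le[OF L(2)])
  finally show ?thesis using iso[of v] \<kappa> by (smt (verit) mult.assoc mult_left_mono)
qed

lemma full_gram_ge: "c * dot I x x \<le> (\<Sum>j\<in>S \<union> B. (dot I (h j) x)\<^sup>2)"
  using c(2)[of x] fin disj by (simp add: sum.union_disjoint sum_nonneg add_increasing)

text \<open>Here \<open>v\<close> is the projection of \<open>w\<close> onto the kernel of the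
  design: its images through S and B cancel. With K the Gram operator of B, K q = H_S v and K r =
  H_B w, evaluating <H_S v, lam> in two ways gives <v_S, w_S> = |v_S|^2 + a2 + e, where a2 = <q, K
  q> and e = <H_B w, q>. This controls a2 and thereby, through \<open>spikes_le\<close>, the risk on
  S; on B the eigenvalue bound and |v| <= |w| suffice.\<close>

lemma bias_bound:
  assumes lam: "\<And>i. i \<in> I \<Longrightarrow> gram I (S \<union> B) h lam i = comb (S \<union> B) h w i"
    and \<psi>: "dot I (comb B h w) (comb B h w) \<le> \<psi>"
  defines "v \<equiv> \<lambda>j. w j - dot I (h j) lam"
  shows "(\<Sum>j\<in>S \<union> B. m j * (v j)\<^sup>2)
    \<le> \<kappa> * L * (((\<Sum>j\<in>S. (w j)\<^sup>2) / 4 + 5 / 2 * (\<psi> / c)) * (10 / 9)) + \<tau> * (\<Sum>j\<in>S \<union> B. (w j)\<^sup>2)"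
proof -
  have v0: "comb (S \<union> B) h v i = 0" if "i \<in> I" for i
    using lam[OF that] by (simp add: v_def comb_diff gram_eq_comb)
  have vB: "comb B h v i = - comb S h v i" if "i \<in> I" for i
    using v0[OF that] fin disj by (simp add: comb_union)
  have gl: "gram I B h lam i = comb B h w i + comb S h v i" if "i \<in> I" for i
  proof -
    have "comb B h v i = comb B h w i - gram I B h lam i" by (simp add: v_def comb_diff gram_eq_comb)
    then show ?thesis using vB[OF that] by simp
  qed
  obtain q where q: "\<And>i. i \<in> I \<Longrightarrow> gram I B h q i = comb S h v i" using solve by blast
  obtain r where r: "\<And>i. i \<in> I \<Longrightarrow> gram I B h r i = comb B h w i" using solve by blast
  define a2 where "a2 = (\<Sum>j\<in>B. (dot I (h j) q)\<^sup>2)"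
  define x2 where "x2 = (\<Sum>j\<in>B. (dot I (h j) r)\<^sup>2)"
  define e where "e = dot I (comb B h w) q"
  have a20: "0 \<le> a2" and x20: "0 \<le> x2" by (simp_all add: a2_def x2_def sum_nonneg)
  have mq: "dot I (comb S h v) q = a2"
  proof -
    have "dot I (comb S h v) q = dot I (gram I B h q) q" using q by (intro dot_cong) auto
    then show ?thesis by (simp add: a2_def dot_commute[of I "gram I B h q"] dot_gram_self)
  qed
  have e2: "e\<^sup>2 \<le> x2 * a2"
  proof -
    have "e = dot I q (gram I B h r)" unfolding e_def using r by (subst dot_commute) (intro dot_cong, auto)
    then have "e = (\<Sum>j\<in>B. dot I (h j) r * dot I (h j) q)" by (simp add: dot_gram mult.commute)
    then show ?thesis unfolding x2_def a2_def using Cauchy_Schwarz_ineq_sum by simp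
  qed
  \<comment> \<open>\<open>r\<close> is K^-1 applied to H_B w, so its energy is at most the squared
    length of H_B w divided by the lower bound \<open>c\<close> of K.\<close>
  have x2le: "x2 \<le> \<psi> / c"
  proof (cases "x2 = 0")
    case True
    have "0 \<le> \<psi>" using \<psi> dot_self_nonneg[of I "comb B h w"] by linarith
    with True show ?thesis using c(1) by simp
  next
    case False
    have "x2 = dot I r (gram I B h r)" by (simp add: x2_def dot_gram_self)
    also have "\<dots> = dot I r (comb B h w)" using r by (intro dot_cong) auto
    finally have "x2\<^sup>2 \<le> dot I r r * dot I (comb B h w) (comb B h w)" using dot_Cauchy_Schwarz by simp
    also have "\<dots> \<le> dot I r r * \<psi>" using \<psi> by (intro mult_left_mono dot_self_nonneg)
    finally have "c * x2\<^sup>2 \<le> (c * dot I r r) * \<psi>" using c(1) by (simp add: mult.assoc)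
    also have "\<dots> \<le> x2 * \<psi>"
      using c(2)[of r] \<psi> dot_self_nonneg[of I "comb B h w"] unfolding x2_def by (intro mult_right_mono) auto
    finally have "x2 * (c * x2) \<le> x2 * \<psi>" by (simp add: power2_eq_square mult_ac)
    then have "c * x2 \<le> \<psi>" using False x20 by simp
    then show ?thesis using c(1) by (simp add: pos_le_divide_eq mult.commute)
  qed
  have lq: "dot I (comb S h v) lam = e + a2"
  proof -
    have "dot I (comb S h v) lam = dot I (gram I B h q) lam" using q by (intro dot_cong) auto
    also have "\<dots> = dot I q (gram I B h lam)" by (rule dot_gram_sym[symmetric])
    also have "\<dots> = dot I q (\<lambda>i. comb B h w i + comb S h v i)" using gl by (intro dot_cong) auto
    also have "\<dots> = e + a2" by (simp add: dot_add_right e_def dot_commute[of I q] mq)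
    finally show ?thesis .
  qed
  have vw: "(\<Sum>j\<in>S. v j * w j) = (\<Sum>j\<in>S. (v j)\<^sup>2) + (e + a2)"
  proof -
    have "(\<Sum>j\<in>S. v j * w j) = (\<Sum>j\<in>S. (v j)\<^sup>2 + v j * dot I (h j) lam)"
      by (intro sum.cong refl) (simp add: v_def power2_eq_square algebra_simps)
    then show ?thesis by (simp add: sum.distrib lq[symmetric] dot_comb)
  qed
  \<comment> \<open>The square |v_S|^2 is cancelled exactly, which leaves the factor 1/4 on
    |w_S|^2.\<close>
  have "(\<Sum>j\<in>S. v j * w j) \<le> (\<Sum>j\<in>S. (v j)\<^sup>2 + (w j)\<^sup>2 / 4)"
  proof (rule sum_mono)
    fix j
    show "v j * w j \<le> (v j)\<^sup>2 + (w j)\<^sup>2 / 4"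
      using zero_le_power2[of "v j - w j / 2"] by (simp add: power2_eq_square algebra_simps)
  qed
  then have a2: "a2 \<le> (\<Sum>j\<in>S. (w j)\<^sup>2) / 4 - e"
    using vw by (simp add: sum.distrib sum_divide_distrib)
  \<comment> \<open>Young's inequality for \<open>e\<^sup>2 \<le> x2 * a2\<close>: the weights
    satisfy 4 * (1/10) * (5/2) = 1. Absorbing a tenth of a2 costs the factor 10/9 below.\<close>
  have "- e \<le> a2 / 10 + 5 / 2 * x2"
  proof -
    have "(2 * e)\<^sup>2 \<le> 4 * (x2 * a2)" using e2 by simp
    also have "\<dots> \<le> (2 * (a2 / 10 + 5 / 2 * x2))\<^sup>2"
      using zero_le_power2[of "a2 / 10 - 5 / 2 * x2"] by (simp add: power2_eq_square algebra_simps)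
    finally have "\<bar>2 * e\<bar> \<le> \<bar>2 * (a2 / 10 + 5 / 2 * x2)\<bar>" by (simp only: abs_le_square_iff)
    moreover have "\<bar>2 * (a2 / 10 + 5 / 2 * x2)\<bar> = 2 * (a2 / 10 + 5 / 2 * x2)" using a20 x20 by simp
    ultimately have "- (2 * e) \<le> 2 * (a2 / 10 + 5 / 2 * x2)" by (metis abs_le_D2)
    then show ?thesis by simp
  qed
  then have a2': "a2 \<le> ((\<Sum>j\<in>S. (w j)\<^sup>2) / 4 + 5 / 2 * (\<psi> / c)) * (10 / 9)"
    using a2 x2le by argo
  have S: "(\<Sum>j\<in>S. m j * (v j)\<^sup>2) \<le> \<kappa> * L * (((\<Sum>j\<in>S. (w j)\<^sup>2) / 4 + 5 / 2 * (\<psi> / c)) * (10 / 9))"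
  proof (rule order_trans)
    show "(\<Sum>j\<in>S. m j * (v j)\<^sup>2) \<le> \<kappa> * L * a2" using spikes_le q unfolding a2_def by blast
    show "\<kappa> * L * a2 \<le> \<kappa> * L * (((\<Sum>j\<in>S. (w j)\<^sup>2) / 4 + 5 / 2 * (\<psi> / c)) * (10 / 9))"
      by (rule mult_left_mono[OF a2']) (use \<kappa> L(1) in simp)
  qed
  \<comment> \<open>Pythagoras: the coefficients \<open>dot I (h j) lam\<close> are orthogonal to
    the kernel vector \<open>v\<close>.\<close>
  have vn: "(\<Sum>j\<in>S \<union> B. (v j)\<^sup>2) \<le> (\<Sum>j\<in>S \<union> B. (w j)\<^sup>2)"
  proof -
    have "(\<Sum>j\<in>S \<union> B. v j * dot I (h j) lam) = dot I (comb (S \<union> B) h v) lam" by (simp add: dot_comb)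
    also have "\<dots> = dot I (\<lambda>_. 0) lam" using v0 by (intro dot_cong) auto
    finally have o: "(\<Sum>j\<in>S \<union> B. v j * dot I (h j) lam) = 0" by (simp add: dot_def)
    have "(\<Sum>j\<in>S \<union> B. (w j)\<^sup>2) = (\<Sum>j\<in>S \<union> B. (v j)\<^sup>2 + 2 * (v j * dot I (h j) lam) + (dot I (h j) lam)\<^sup>2)"
      by (intro sum.cong refl) (simp add: v_def power2_eq_square algebra_simps)
    also have "\<dots> = (\<Sum>j\<in>S \<union> B. (v j)\<^sup>2) + (\<Sum>j\<in>S \<union> B. (dot I (h j) lam)\<^sup>2)"
      using o by (simp add: sum.distrib flip: sum_distrib_left)
    finally show ?thesis by (simp add: sum_nonneg)
  qed
  have "(\<Sum>j\<in>B. m j * (v j)\<^sup>2) \<le> (\<Sum>j\<in>B. \<tau> * (v j)\<^sup>2)" using \<tau>(1) by (intro sum_mono mult_right_mono) auto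
  also have "\<dots> \<le> \<tau> * (\<Sum>j\<in>S \<union> B. (v j)\<^sup>2)"
    unfolding sum_distrib_left[symmetric] using \<tau>(2) fin by (intro mult_left_mono sum_mono2) auto
  also have "\<dots> \<le> \<tau> * (\<Sum>j\<in>S \<union> B. (w j)\<^sup>2)" using vn \<tau>(2) by (intro mult_left_mono)
  finally have "(\<Sum>j\<in>B. m j * (v j)\<^sup>2) \<le> \<tau> * (\<Sum>j\<in>S \<union> B. (w j)\<^sup>2)" .
  with S show ?thesis
    unfolding sum.union_disjoint[OF fin(2,3) disj, of "\<lambda>j. m j * (v j)\<^sup>2"] by (rule add_mono)
qed

text \<open>The noise response is compared with that of block B alone, \<open>z\<close> = K^-1 y,
  for which Gaussian tail bounds are available. If M is the image of the S-coefficients u and q =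
  K^-1 M, then lam = z - q, and <M, z> = |u_S|^2 + <q, K q> dominates the energy of q. The resulting
  inequality is self-bounding: the risk W on S is at most \<kappa> L <M, z>, while <M, z>^2 is at
  most W * s2.\<close>

lemma variance_bound:
  assumes lam: "\<And>i. i \<in> I \<Longrightarrow> gram I (S \<union> B) h lam i = y i"
    and z: "\<And>i. i \<in> I \<Longrightarrow> gram I B h z i = y i"
    and g: "\<And>j i. j \<in> S \<Longrightarrow> h j i = sqrt (m j) * g j i"
    and s2: "(\<Sum>j\<in>S. (dot I (g j) z)\<^sup>2) \<le> s2"
    and \<beta>: "(\<Sum>j\<in>B. m j * (dot I (h j) z)\<^sup>2) \<le> \<beta>"
  shows "(\<Sum>j\<in>S \<union> B. m j * (dot I (h j) lam)\<^sup>2) \<le> (\<kappa> * L)\<^sup>2 * s2 + 2 * \<beta> + 2 * \<tau> * (\<kappa> * L * s2)"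
proof -
  define u where "u = (\<lambda>j. dot I (h j) lam)"
  define M where "M = comb S h u"
  have gl: "gram I B h lam i = y i - M i" if "i \<in> I" for i
    using lam[OF that] fin disj by (simp add: gram_eq_comb comb_union M_def u_def)
  obtain q where q: "\<And>i. i \<in> I \<Longrightarrow> gram I B h q i = comb S h u i" using solve by blast
  define a2 where "a2 = (\<Sum>j\<in>B. (dot I (h j) q)\<^sup>2)"
  have a20: "0 \<le> a2" by (simp add: a2_def sum_nonneg)
  have qM: "dot I q M = a2"
  proof -
    have "dot I q M = dot I q (gram I B h q)" using q by (intro dot_cong) (auto simp: M_def)
    then show ?thesis by (simp add: a2_def dot_gram_self)
  qed
  define t where "t = dot I M z"
  have "(\<Sum>j\<in>S. (u j)\<^sup>2) = dot I M lam" by (simp add: M_def dot_comb u_def power2_eq_square)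
  also have "\<dots> = dot I (gram I B h q) lam" using q by (intro dot_cong) (auto simp: M_def)
  also have "\<dots> = dot I q (gram I B h lam)" by (rule dot_gram_sym[symmetric])
  also have "\<dots> = dot I q (\<lambda>i. y i - M i)" using gl by (intro dot_cong) auto
  also have "\<dots> = dot I q y - a2" by (simp add: dot_diff_right qM)
  also have "dot I q y = dot I q (gram I B h z)" using z by (intro dot_cong) auto
  also have "\<dots> = dot I (gram I B h q) z" by (rule dot_gram_sym)
  also have "\<dots> = t" unfolding t_def using q by (intro dot_cong) (auto simp: M_def)
  finally have at: "a2 \<le> t" using sum_nonneg[of S "\<lambda>j. (u j)\<^sup>2"] by simp
  then have t0: "0 \<le> t" using a20 by simp
  define W where "W = (\<Sum>j\<in>S. m j * (u j)\<^sup>2)"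
  have W0: "0 \<le> W" using m_nonneg by (simp add: W_def sum_nonneg)
  have \<kappa>L: "0 < \<kappa> * L" using \<kappa> L(1) by simp
  have Wt: "W \<le> \<kappa> * L * t"
    using spikes_le[OF q] mult_left_mono[OF at, of "\<kappa> * L"] \<kappa>L unfolding W_def a2_def by linarith
  have s20: "0 \<le> s2" using s2 sum_nonneg[of S "\<lambda>j. (dot I (g j) z)\<^sup>2"] by simp
  \<comment> \<open>Splitting the eigenvalue as \<open>sqrt (m j) * sqrt (m j)\<close> gives one
    factor to the risk and one to the standardised column \<open>g j\<close>, so no bound on the
    eigenvalues over S is needed.\<close>
  have tW: "t\<^sup>2 \<le> W * s2"
  proof -
    have "t = (\<Sum>j\<in>S. (sqrt (m j) * u j) * dot I (g j) z)"
      unfolding t_def M_def dot_comb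
    proof (intro sum.cong refl)
      fix j assume "j \<in> S"
      then have "dot I (h j) z = sqrt (m j) * dot I (g j) z"
        using g by (simp add: dot_def sum_distrib_left mult_ac)
      then show "u j * dot I (h j) z = (sqrt (m j) * u j) * dot I (g j) z" by simp
    qed
    then have "t\<^sup>2 \<le> (\<Sum>j\<in>S. (sqrt (m j) * u j)\<^sup>2) * (\<Sum>j\<in>S. (dot I (g j) z)\<^sup>2)"
      using Cauchy_Schwarz_ineq_sum by simp
    also have "(\<Sum>j\<in>S. (sqrt (m j) * u j)\<^sup>2) = W" using m_nonneg by (simp add: W_def power_mult_distrib)
    also have "W * (\<Sum>j\<in>S. (dot I (g j) z)\<^sup>2) \<le> W * s2" using s2 W0 by (intro mult_left_mono)
    finally show ?thesis .
  qed
  \<comment> \<open>Combining t^2 <= W * s2 with W <= \<kappa> L t and dividing by t closes the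
    self-bounding inequality.\<close>
  have ts: "t \<le> \<kappa> * L * s2"
  proof (cases "t = 0")
    case True
    then show ?thesis using \<kappa>L s20 by simp
  next
    case False
    have "t * t \<le> t * (\<kappa> * L * s2)"
      using tW mult_right_mono[OF Wt s20] by (simp add: power2_eq_square mult_ac)
    then show ?thesis using False t0 by simp
  qed
  have WS: "W \<le> (\<kappa> * L)\<^sup>2 * s2"
    using Wt mult_left_mono[OF ts, of "\<kappa> * L"] \<kappa>L by (simp add: power2_eq_square mult.assoc)
  \<comment> \<open>Both sides are mapped to y - M by the injective Gram operator of B.\<close>
  have lz: "lam i = z i - q i" if "i \<in> I" for i
  proof (rule gram_inj[OF fin(1) c _ that])
    fix i assume "i \<in> I"
    then show "gram I B h lam i = gram I B h (\<lambda>i. z i - q i) i" using gl z q by (simp add: gram_diff M_def)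
  qed
  have uB: "u j = dot I (h j) z - dot I (h j) q" for j
  proof -
    have "u j = dot I (h j) (\<lambda>i. z i - q i)" unfolding u_def using lz by (intro dot_cong) auto
    then show ?thesis by (simp add: dot_diff_right)
  qed
  have "(\<Sum>j\<in>B. m j * (u j)\<^sup>2) \<le> (\<Sum>j\<in>B. 2 * (m j * (dot I (h j) z)\<^sup>2) + 2 * \<tau> * (dot I (h j) q)\<^sup>2)"
  proof (rule sum_mono)
    fix j assume j: "j \<in> B"
    have "m j * (u j)\<^sup>2 \<le> m j * (2 * (dot I (h j) z)\<^sup>2 + 2 * (dot I (h j) q)\<^sup>2)"
      using zero_le_power2[of "dot I (h j) z + dot I (h j) q"] m_nonneg
      by (intro mult_left_mono) (auto simp: uB power2_eq_square algebra_simps)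
    also have "\<dots> \<le> 2 * (m j * (dot I (h j) z)\<^sup>2) + 2 * \<tau> * (dot I (h j) q)\<^sup>2"
      using mult_right_mono[OF \<tau>(1)[OF j], of "2 * (dot I (h j) q)\<^sup>2"] by (simp add: algebra_simps)
    finally show "m j * (u j)\<^sup>2 \<le> 2 * (m j * (dot I (h j) z)\<^sup>2) + 2 * \<tau> * (dot I (h j) q)\<^sup>2" .
  qed
  also have "\<dots> = 2 * (\<Sum>j\<in>B. m j * (dot I (h j) z)\<^sup>2) + 2 * \<tau> * a2"
    by (simp add: sum.distrib a2_def flip: sum_distrib_left)
  also have "\<dots> \<le> 2 * \<beta> + 2 * \<tau> * (\<kappa> * L * s2)"
    using \<beta> \<tau>(2) at ts by (intro add_mono mult_left_mono) auto
  finally show ?thesis using WS fin disj by (simp add: sum.union_disjoint W_def u_def)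
qed

end

text \<open>The cross term between bias and noise is absorbed by the cross term of \<open>(\<sigma> + b)\<^sup>2\<close>,
  which is possible because the bias is below \<open>b\<^sup>2\<close> with room to spare.\<close>

lemma bias_variance_combine:
  fixes \<sigma> b \<theta> :: real
  assumes "finite J" and m: "\<And>j. j \<in> J \<Longrightarrow> 0 \<le> m j" and \<sigma>: "0 \<le> \<sigma>" and b: "0 \<le> b" and \<theta>: "0 \<le> \<theta>" "\<theta> \<le> 1"
    and v: "(\<Sum>j\<in>J. m j * (v j)\<^sup>2) \<le> b\<^sup>2" and u: "(\<Sum>j\<in>J. m j * (u j)\<^sup>2) \<le> \<theta>"
  shows "\<sigma>\<^sup>2 + (\<Sum>j\<in>J. m j * (\<sigma> * u j - v j)\<^sup>2) \<le> (1 + \<theta>) * (\<sigma> + b)\<^sup>2"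
proof -
  let ?V = "\<Sum>j\<in>J. m j * (v j)\<^sup>2" and ?U = "\<Sum>j\<in>J. m j * (u j)\<^sup>2" and ?X = "\<Sum>j\<in>J. m j * (u j * v j)"
  have "?X\<^sup>2 = (\<Sum>j\<in>J. (sqrt (m j) * u j) * (sqrt (m j) * v j))\<^sup>2"
  proof (intro arg_cong[where f = "\<lambda>x. x\<^sup>2"] sum.cong refl)
    fix j assume "j \<in> J"
    have "(sqrt (m j) * u j) * (sqrt (m j) * v j) = (sqrt (m j) * sqrt (m j)) * (u j * v j)" by (simp only: mult_ac)
    then show "m j * (u j * v j) = (sqrt (m j) * u j) * (sqrt (m j) * v j)" using m[OF \<open>j \<in> J\<close>] by simp
  qed
  also have "\<dots> \<le> (\<Sum>j\<in>J. (sqrt (m j) * u j)\<^sup>2) * (\<Sum>j\<in>J. (sqrt (m j) * v j)\<^sup>2)"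
    by (rule Cauchy_Schwarz_ineq_sum)
  also have "\<dots> = ?U * ?V" using m by (simp add: power_mult_distrib)
  \<comment> \<open>The noise enters only through \<theta> <= 1 here: the cross term is then at most
    2 \<sigma> b, which is the one of \<open>(\<sigma> + b)\<^sup>2\<close>.\<close>
  also have "\<dots> \<le> 1 * b\<^sup>2" using u \<theta> v m by (intro mult_mono) (auto intro!: sum_nonneg)
  finally have "\<bar>?X\<bar> \<le> \<bar>b\<bar>" by (simp add: abs_le_square_iff)
  then have X: "- ?X \<le> b" using b by linarith
  have "(\<Sum>j\<in>J. m j * (\<sigma> * u j - v j)\<^sup>2) = \<sigma>\<^sup>2 * ?U - 2 * \<sigma> * ?X + ?V"
    by (simp add: power2_eq_square algebra_simps sum.distrib sum_subtractf sum_distrib_left)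
  also have "\<dots> \<le> \<sigma>\<^sup>2 * \<theta> + 2 * \<sigma> * b + b\<^sup>2"
    using mult_left_mono[OF u, of "\<sigma>\<^sup>2"] mult_left_mono[OF X, of "2 * \<sigma>"] v \<sigma> by auto
  finally have "\<sigma>\<^sup>2 + (\<Sum>j\<in>J. m j * (\<sigma> * u j - v j)\<^sup>2) \<le> \<sigma>\<^sup>2 * (1 + \<theta>) + 2 * \<sigma> * b + b\<^sup>2"
    by (simp add: algebra_simps)
  also have "\<dots> \<le> \<sigma>\<^sup>2 * (1 + \<theta>) + 2 * \<sigma> * b * (1 + \<theta>) + b\<^sup>2 * (1 + \<theta>)"
  proof -
    have "0 \<le> (2 * \<sigma> * b + b\<^sup>2) * \<theta>" using \<sigma> b \<theta> by simp
    then show ?thesis by (simp add: algebra_simps)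
  qed
  also have "\<dots> = (1 + \<theta>) * (\<sigma> + b)\<^sup>2" by (simp add: power2_eq_square algebra_simps)
  finally show ?thesis .
qed

section \<open>Gaussian designs\<close>

lemma gram_solve_norm_le:
  assumes I: "finite I" and L: "L > 0" "\<And>x. (\<Sum>j\<in>J. (dot I (h j) x)\<^sup>2) \<le> L * dot I x x"
    and c: "c > 0" "\<And>x. c * dot I x x \<le> (\<Sum>j\<in>J. (dot I (h j) x)\<^sup>2)"
  shows "dot I (gram_solve I J h L y) (gram_solve I J h L y) \<le> dot I y y / c\<^sup>2"
proof -
  let ?x = "gram_solve I J h L y"
  have "c * dot I ?x ?x \<le> dot I ?x (gram I J h ?x)" using c(2) by (simp add: dot_gram_self)
  also have "\<dots> = dot I ?x y" using gram_gram_solve[OF I L c] by (intro dot_cong) auto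
  finally have "(c * dot I ?x ?x)\<^sup>2 \<le> (dot I ?x y)\<^sup>2"
    using c(1) dot_self_nonneg[of I ?x] by (intro power_mono) auto
  also have "\<dots> \<le> dot I ?x ?x * dot I y y" by (rule dot_Cauchy_Schwarz)
  finally have *: "dot I ?x ?x * (c\<^sup>2 * dot I ?x ?x) \<le> dot I ?x ?x * dot I y y"
    by (simp add: power2_eq_square mult_ac)
  show ?thesis
  proof (cases "dot I ?x ?x = 0")
    case True
    then show ?thesis using dot_self_nonneg[of I y] by simp
  next
    case False
    then have "c\<^sup>2 * dot I ?x ?x \<le> dot I y y" using * dot_self_nonneg[of I ?x] by (simp add: less_le)
    then show ?thesis using c(1) by (simp add: pos_le_divide_eq mult.commute)
  qed
qed

lemma dot_gram_solve:
  "dot I x (gram_solve I J h L y) = dot I (\<lambda>k. dot I x (gram_inv I J h L k)) y"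
proof -
  have "dot I x (gram_solve I J h L y) = (\<Sum>k\<in>I. dot I x (\<lambda>i. y k * gram_inv I J h L k i))"
    unfolding gram_solve_def by (rule dot_sum_right)
  then show ?thesis
    by (simp add: dot_scale_right) (simp add: dot_def[of I "\<lambda>k. dot I x (gram_inv I J h L k)"] mult.commute)
qed

text \<open>Duality replaces symmetry of the inverse: if y is the transposed inverse applied to x,
  then |y|^2 = <x, K^-1 y>, and the bound on K^-1 applies to the right-hand side.\<close>

lemma gram_inv_transpose_norm_le:
  assumes I: "finite I" and L: "L > 0" "\<And>x. (\<Sum>j\<in>J. (dot I (h j) x)\<^sup>2) \<le> L * dot I x x"
    and c: "c > 0" "\<And>x. c * dot I x x \<le> (\<Sum>j\<in>J. (dot I (h j) x)\<^sup>2)"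
  shows "(\<Sum>k\<in>I. (dot I x (gram_inv I J h L k))\<^sup>2) \<le> dot I x x / c\<^sup>2"
proof -
  let ?y = "\<lambda>k. dot I x (gram_inv I J h L k)"
  note eq = dot_gram_solve[of I x J h L]
  have "(dot I ?y ?y)\<^sup>2 \<le> dot I x x * dot I (gram_solve I J h L ?y) (gram_solve I J h L ?y)"
    unfolding eq[symmetric] by (rule dot_Cauchy_Schwarz)
  also have "\<dots> \<le> dot I x x * (dot I ?y ?y / c\<^sup>2)"
    by (intro mult_left_mono gram_solve_norm_le[OF I L c] dot_self_nonneg)
  finally have *: "dot I ?y ?y * dot I ?y ?y \<le> dot I ?y ?y * (dot I x x / c\<^sup>2)"
    by (simp add: power2_eq_square mult_ac)
  have "dot I ?y ?y \<le> dot I x x / c\<^sup>2"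
  proof (cases "dot I ?y ?y = 0")
    case True
    then show ?thesis using dot_self_nonneg[of I x] by simp
  next
    case False
    then have "0 < dot I ?y ?y" using dot_self_nonneg[of I ?y] by linarith
    with * show ?thesis by (rule mult_left_le_imp_le)
  qed
  then show ?thesis by (simp add: dot_def[of I ?y] power2_eq_square)
qed

text \<open>Tonelli in the form used for conditioning: a bound on the noise that holds for every
  fixed design holds for the pair.\<close>

lemma measure_pair_le_sections:
  assumes "prob_space M" "prob_space N" and A: "A \<in> sets (M \<Otimes>\<^sub>M N)"
    and le: "\<And>x. x \<in> space M \<Longrightarrow> measure N (Pair x -` A) \<le> \<epsilon>" and \<epsilon>: "\<epsilon> \<ge> 0"
  shows "measure (M \<Otimes>\<^sub>M N) A \<le> \<epsilon>"
proof -
  interpret M: prob_space M by fact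
  interpret N: prob_space N by fact
  interpret MN: pair_prob_space M N ..
  have "emeasure (M \<Otimes>\<^sub>M N) A = (\<integral>\<^sup>+x. emeasure N (Pair x -` A) \<partial>M)"
    by (rule N.emeasure_pair_measure_alt[OF A])
  also have "\<dots> \<le> (\<integral>\<^sup>+x. ennreal \<epsilon> \<partial>M)"
    using le by (intro nn_integral_mono) (simp add: N.emeasure_eq_measure ennreal_leI)
  also have "\<dots> = ennreal \<epsilon>" by (simp add: M.emeasure_space_1)
  finally show ?thesis using \<epsilon> by (simp add: MN.P.emeasure_eq_measure)
qed

section \<open>Independent coordinates of the design and their tails\<close>

definition coord :: "nat \<Rightarrow> (nat \<Rightarrow> nat \<Rightarrow> real) \<Rightarrow> (nat \<times> nat \<Rightarrow> real) \<Rightarrow> nat \<Rightarrow> nat \<Rightarrow> real" where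
  "coord d f Z j i = (\<Sum>k<d. f j k * Z (i, k))"

text \<open>Orthonormality of the \<open>f j\<close> makes the coordinates of the samples along them
  independent standard Gaussians. It is asked only on \<open>D\<close>, which will be the set of
  directions of positive eigenvalue, because \<open>f\<close> arises there by division by
  \<open>sqrt (m j)\<close>.\<close>

locale gaussian_coordinates =
  fixes n d :: nat and f :: "nat \<Rightarrow> nat \<Rightarrow> real" and D :: "nat set"
  assumes finD: "finite D"
    and orth: "\<And>j l. j \<in> D \<Longrightarrow> l \<in> D \<Longrightarrow> dot {..<d} (f j) (f l) = (if j = l then 1 else 0)"
begin

abbreviation "idx \<equiv> {..<n} \<times> {..<d}"

lemma finite_idx: "finite idx" by simp

text \<open>All linear forms in the Gaussian array that occur below are products of a sample part
  and a coordinate part; this factorisation reduces their orthogonality to that of the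
  parts.\<close>

lemma dot_tensor:
  "dot idx (\<lambda>p. a (fst p) * b (snd p)) (\<lambda>p. a' (fst p) * b' (snd p)) = dot {..<n} a a' * dot {..<d} b b'"
proof -
  have "dot idx (\<lambda>p. a (fst p) * b (snd p)) (\<lambda>p. a' (fst p) * b' (snd p))
      = (\<Sum>i<n. \<Sum>k<d. (a i * b k) * (a' i * b' k))"
    by (simp add: dot_def sum.cartesian_product split_beta')
  also have "\<dots> = (\<Sum>i<n. \<Sum>k<d. (a i * a' i) * (b k * b' k))" by (simp add: mult_ac)
  also have "\<dots> = dot {..<n} a a' * dot {..<d} b b'"
    unfolding dot_def by (simp only: sum_product)
  finally show ?thesis .
qed

lemma dot_tensor_Z:
  "dot idx (\<lambda>p. a (fst p) * b (snd p)) Z = dot {..<n} a (\<lambda>i. dot {..<d} b (\<lambda>k. Z (i, k)))"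
proof -
  have "dot idx (\<lambda>p. a (fst p) * b (snd p)) Z = (\<Sum>i<n. \<Sum>k<d. (a i * b k) * Z (i, k))"
    by (simp add: dot_def sum.cartesian_product split_beta')
  then show ?thesis by (simp add: dot_def sum_distrib_left mult.assoc)
qed

lemma coord_dot: "coord d f Z j i = dot {..<d} (f j) (\<lambda>k. Z (i, k))"
  by (simp add: coord_def dot_def)

lemma dot_coord: "dot {..<n} y (coord d f Z j) = dot idx (\<lambda>p. y (fst p) * f j (snd p)) Z"
  unfolding dot_tensor_Z by (intro dot_cong) (auto simp: coord_dot)

lemma comb_coord:
  "i < n \<Longrightarrow> comb J (coord d f Z) u i
    = dot idx (\<lambda>p. (if fst p = i then 1 else 0) * (\<Sum>j\<in>J. u j * f j (snd p))) Z"
  unfolding dot_tensor_Z[of "\<lambda>i'. if i' = i then 1 else 0" "\<lambda>k. \<Sum>j\<in>J. u j * f j k"]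
  by (simp add: comb_def coord_dot dot_sum_left dot_scale_left dot_def[of "{..<n}"] if_distrib[of "\<lambda>x. x * _"] cong: if_cong)

lemma dot_indicator: "i < n \<Longrightarrow> i' < n \<Longrightarrow>
  dot {..<n} (\<lambda>x. if x = i then 1 else 0) (\<lambda>x. if x = i' then 1 else 0) = (if i = i' then 1 else 0)"
  by (simp add: dot_def if_distrib[of "\<lambda>x. x * _"] cong: if_cong)

lemma measurable_coord:
  "i < n \<Longrightarrow> (\<lambda>Z. coord d f Z j i) \<in> borel_measurable (gaussians idx)"
  unfolding coord_def by (intro borel_measurable_sum borel_measurable_times measurable_gaussians_component borel_measurable_const) auto

lemma dot_combination_self:
  assumes "J \<subseteq> D"
  shows "dot {..<d} (\<lambda>k. \<Sum>j\<in>J. u j * f j k) (\<lambda>k. \<Sum>j\<in>J. u j * f j k) = dot J u u"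
proof -
  have "finite J" using assms finD finite_subset by blast
  moreover have "dot {..<d} (f j) (f k) = 0" if "j \<in> J" "k \<in> J" "j \<noteq> k" for j k
    using orth[of j k] that assms by (auto simp: subset_iff)
  ultimately have "(\<Sum>k<d. (\<Sum>j\<in>J. u j * f j k)\<^sup>2) = (\<Sum>j\<in>J. dot {..<d} (f j) (f j) * (u j)\<^sup>2)"
    by (rule norm_square_orthogonal_combination)
  also have "\<dots> = dot J u u" unfolding dot_def[of J]
  proof (intro sum.cong refl)
    fix j assume "j \<in> J"
    then show "dot {..<d} (f j) (f j) * (u j)\<^sup>2 = u j * u j"
      using orth[of j j] assms by (auto simp: power2_eq_square)
  qed
  finally show ?thesis by (simp add: dot_def[of "{..<d}" "\<lambda>k. \<Sum>j\<in>J. u j * f j k"] power2_eq_square)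
qed

text \<open>The n entries of the combination are linear forms with mutually orthogonal coefficient
  vectors, one for each sample, all of squared length |u|^2.\<close>

lemma comb_tail:
  assumes J: "J \<subseteq> D" and t: "t > 0" "4 * t * dot J u u \<le> 1"
  defines "Q \<equiv> \<lambda>Z. dot {..<n} (comb J (coord d f Z) u) (comb J (coord d f Z) u)"
  shows "measure (gaussians idx) {Z \<in> space (gaussians idx). Q Z \<ge> n * dot J u u + s} \<le> exp (- t * s + 4 * t\<^sup>2 * (n * (dot J u u)\<^sup>2))"
    and "measure (gaussians idx) {Z \<in> space (gaussians idx). Q Z \<le> n * dot J u u - s} \<le> exp (- t * s + 4 * t\<^sup>2 * (n * (dot J u u)\<^sup>2))"
proof -
  let ?v = "\<lambda>i p. (if fst p = i then 1 else 0) * (\<Sum>j\<in>J. u j * f j (snd p))"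
  have vv: "dot idx (?v i) (?v i') = (if i = i' then dot J u u else 0)" if "i < n" "i' < n" for i i'
    using dot_tensor[of "\<lambda>x. if x = i then 1 else 0" "\<lambda>k. \<Sum>j\<in>J. u j * f j k" "\<lambda>x. if x = i' then 1 else 0" "\<lambda>k. \<Sum>j\<in>J. u j * f j k"]
    unfolding dot_indicator[OF that] dot_combination_self[OF J] by simp
  have mu: "(\<Sum>i<n. dot idx (?v i) (?v i)) = n * dot J u u" and V: "(\<Sum>i<n. (dot idx (?v i) (?v i))\<^sup>2) = n * (dot J u u)\<^sup>2"
    using vv by simp_all
  have Q: "(\<Sum>i<n. (dot idx (?v i) Z)\<^sup>2) = Q Z" for Z
    unfolding Q_def dot_def[of "{..<n}"] power2_eq_square[symmetric]
    by (intro sum.cong refl arg_cong[where f = "\<lambda>x. x\<^sup>2"] comb_coord[symmetric]) simp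
  have o: "dot idx (?v i) (?v i') = 0" if "i \<in> {..<n}" "i' \<in> {..<n}" "i \<noteq> i'" for i i' using vv that by simp
  have b: "4 * t * dot idx (?v i) (?v i) \<le> 1" if "i \<in> {..<n}" for i using vv that t(2) by simp
  note * = gaussian_quadratic_tail[where v = ?v and J = "{..<n}" and s = s, OF finite_idx finite_lessThan o t(1) b, unfolded mu V Q]
  show "measure (gaussians idx) {Z \<in> space (gaussians idx). Q Z \<ge> n * dot J u u + s} \<le> exp (- t * s + 4 * t\<^sup>2 * (n * (dot J u u)\<^sup>2))"
    using *(1) .
  show "measure (gaussians idx) {Z \<in> space (gaussians idx). Q Z \<le> n * dot J u u - s} \<le> exp (- t * s + 4 * t\<^sup>2 * (n * (dot J u u)\<^sup>2))"
    using *(2) .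
qed

text \<open>For a fixed y the forms indexed by j are orthogonal with squared lengths m j |y|^2 <= m
  j, so the largest eigenvalue in \<open>J\<close> limits the admissible \<open>t\<close>.\<close>

lemma weighted_gram_tail:
  fixes m :: "nat \<Rightarrow> real"
  assumes J: "J \<subseteq> D" and m: "\<And>j. 0 \<le> m j" and t: "t > 0" "\<And>j. j \<in> J \<Longrightarrow> 4 * t * m j \<le> 1"
    and y: "dot {..<n} y y \<le> 1"
  defines "Q \<equiv> \<lambda>Z. \<Sum>j\<in>J. (dot {..<n} (\<lambda>i. sqrt (m j) * coord d f Z j i) y)\<^sup>2"
    and "\<mu> \<equiv> (\<Sum>j\<in>J. m j) * dot {..<n} y y"
  shows "measure (gaussians idx) {Z \<in> space (gaussians idx). Q Z \<ge> \<mu> + s} \<le> exp (- t * s + 4 * t\<^sup>2 * (\<Sum>j\<in>J. (m j)\<^sup>2))"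
    and "measure (gaussians idx) {Z \<in> space (gaussians idx). Q Z \<le> \<mu> - s} \<le> exp (- t * s + 4 * t\<^sup>2 * (\<Sum>j\<in>J. (m j)\<^sup>2))"
proof -
  have finJ: "finite J" using J finD finite_subset by blast
  let ?v = "\<lambda>j p. (sqrt (m j) * y (fst p)) * f j (snd p)"
  have y0: "0 \<le> dot {..<n} y y" by (rule dot_self_nonneg)
  have vv: "dot idx (?v j) (?v l) = (if j = l then m j * dot {..<n} y y else 0)" if "j \<in> J" "l \<in> J" for j l
  proof -
    have "j \<in> D" "l \<in> D" using that J by auto
    then have "dot idx (?v j) (?v l) = sqrt (m j) * (sqrt (m l) * dot {..<n} y y) * (if j = l then 1 else 0)"
      using dot_tensor[of "\<lambda>i. sqrt (m j) * y i" "f j" "\<lambda>i. sqrt (m l) * y i" "f l"] orth[of j l]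
      by (simp add: dot_scale_left dot_scale_right)
    then show ?thesis using m[of l] by (simp add: mult.assoc[symmetric])
  qed
  have mu: "(\<Sum>j\<in>J. dot idx (?v j) (?v j)) = \<mu>"
    using vv by (simp add: \<mu>_def sum_distrib_right)
  have V: "(\<Sum>j\<in>J. (dot idx (?v j) (?v j))\<^sup>2) \<le> (\<Sum>j\<in>J. (m j)\<^sup>2)"
  proof (intro sum_mono power_mono)
    fix j assume "j \<in> J"
    then show "dot idx (?v j) (?v j) \<le> m j" using vv y m[of j] by (simp add: mult_left_le)
  qed (rule dot_self_nonneg)
  have Q: "(\<Sum>j\<in>J. (dot idx (?v j) Z)\<^sup>2) = Q Z" for Z
    unfolding Q_def
  proof (intro sum.cong refl arg_cong[where f = "\<lambda>x. x\<^sup>2"])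
    fix j
    have "dot idx (?v j) Z = dot {..<n} (\<lambda>i. sqrt (m j) * y i) (coord d f Z j)" by (rule dot_coord[symmetric])
    then show "dot idx (?v j) Z = dot {..<n} (\<lambda>i. sqrt (m j) * coord d f Z j i) y"
      by (simp add: dot_scale_left dot_commute[of "{..<n}" y])
  qed
  have o: "dot idx (?v i) (?v i') = 0" if "i \<in> J" "i' \<in> J" "i \<noteq> i'" for i i' using vv that by simp
  have b: "4 * t * dot idx (?v j) (?v j) \<le> 1" if "j \<in> J" for j
  proof -
    have "4 * t * (m j * dot {..<n} y y) \<le> 4 * t * (m j * 1)" using t y m by (intro mult_left_mono) auto
    then show ?thesis using vv[OF that that] t(2)[OF that] by simp
  qed
  note * = gaussian_quadratic_tail[where v = ?v and J = J and s = s, OF finite_idx finJ o t(1) b, unfolded mu Q]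
  have le: "exp (- t * s + 4 * t\<^sup>2 * (\<Sum>j\<in>J. (dot idx (?v j) (?v j))\<^sup>2)) \<le> exp (- t * s + 4 * t\<^sup>2 * (\<Sum>j\<in>J. (m j)\<^sup>2))"
    using V t(1) by (simp add: mult_left_mono)
  show "measure (gaussians idx) {Z \<in> space (gaussians idx). Q Z \<ge> \<mu> + s} \<le> exp (- t * s + 4 * t\<^sup>2 * (\<Sum>j\<in>J. (m j)\<^sup>2))"
    using *(1) le by (rule order_trans)
  show "measure (gaussians idx) {Z \<in> space (gaussians idx). Q Z \<le> \<mu> - s} \<le> exp (- t * s + 4 * t\<^sup>2 * (\<Sum>j\<in>J. (m j)\<^sup>2))"
    using *(2) le by (rule order_trans)
qed

text \<open>The forms are indexed by pairs of a sample and a direction and have squared lengths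
  \<open>(m j)\<^sup>2\<close>, all at most V. Hence t = 1/(8 V) is admissible, and the exponent is
  -n/8 + n/16.\<close>

lemma trace_tail:
  fixes m :: "nat \<Rightarrow> real" and V :: real
  assumes J: "J \<subseteq> D" and V: "(\<Sum>j\<in>J. (m j)\<^sup>2) > 0"
  defines "V \<equiv> \<Sum>j\<in>J. (m j)\<^sup>2"
  shows "measure (gaussians idx) {Z \<in> space (gaussians idx). (\<Sum>j\<in>J. (m j)\<^sup>2 * dot {..<n} (coord d f Z j) (coord d f Z j)) \<ge> 2 * n * V}
    \<le> exp (- (real n / 16))"
proof -
  have finJ: "finite J" using J finD finite_subset by blast
  let ?v = "\<lambda>q p. (if fst p = fst q then 1 else 0) * (m (snd q) * f (snd q) (snd p))"
  let ?J = "{..<n} \<times> J"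
  have vv: "dot idx (?v q) (?v q') = (if q = q' then (m (snd q))\<^sup>2 else 0)" if "q \<in> ?J" "q' \<in> ?J" for q q'
  proof -
    have "snd q \<in> D" "snd q' \<in> D" "fst q < n" "fst q' < n" using that J by auto
    then have "dot idx (?v q) (?v q') = (if fst q = fst q' then 1 else 0)
        * (m (snd q) * (m (snd q') * (if snd q = snd q' then 1 else 0)))"
      using dot_tensor[of "\<lambda>x. if x = fst q then 1 else 0" "\<lambda>k. m (snd q) * f (snd q) k"
          "\<lambda>x. if x = fst q' then 1 else 0" "\<lambda>k. m (snd q') * f (snd q') k"]
        orth[of "snd q" "snd q'"] dot_indicator[of "fst q" "fst q'"]
      by (simp only: dot_scale_left dot_scale_right)
    then show ?thesis by (simp add: power2_eq_square prod_eq_iff)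
  qed
  have mu: "(\<Sum>q\<in>?J. dot idx (?v q) (?v q)) = n * V"
  proof -
    have "(\<Sum>q\<in>?J. dot idx (?v q) (?v q)) = (\<Sum>q\<in>?J. (m (snd q))\<^sup>2)" using vv by (intro sum.cong) auto
    also have "\<dots> = (\<Sum>i<n. \<Sum>j\<in>J. (m j)\<^sup>2)" unfolding sum.cartesian_product split_beta' ..
    finally show ?thesis by (simp add: V_def)
  qed
  have mV: "(m j)\<^sup>2 \<le> V" if "j \<in> J" for j unfolding V_def using that finJ by (intro member_le_sum) auto
  have V2: "(\<Sum>q\<in>?J. (dot idx (?v q) (?v q))\<^sup>2) \<le> n * V\<^sup>2"
  proof -
    have "(\<Sum>q\<in>?J. (dot idx (?v q) (?v q))\<^sup>2) = (\<Sum>q\<in>?J. (m (snd q))\<^sup>2 * (m (snd q))\<^sup>2)"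
      using vv by (intro sum.cong) (auto simp: power2_eq_square)
    also have "\<dots> = (\<Sum>i<n. \<Sum>j\<in>J. (m j)\<^sup>2 * (m j)\<^sup>2)" unfolding sum.cartesian_product split_beta' ..
    also have "\<dots> \<le> (\<Sum>i<n. \<Sum>j\<in>J. (m j)\<^sup>2 * V)" using mV by (intro sum_mono mult_left_mono) auto
    also have "\<dots> = n * V\<^sup>2" by (simp add: V_def power2_eq_square flip: sum_distrib_right)
    finally show ?thesis .
  qed
  have Q: "(\<Sum>q\<in>?J. (dot idx (?v q) Z)\<^sup>2) = (\<Sum>j\<in>J. (m j)\<^sup>2 * dot {..<n} (coord d f Z j) (coord d f Z j))" for Z
  proof -
    have "dot idx (?v q) Z = m (snd q) * coord d f Z (snd q) (fst q)" if "q \<in> ?J" for q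
    proof -
      have "dot idx (?v q) Z = dot {..<n} (\<lambda>x. if x = fst q then 1 else 0) (\<lambda>i. dot {..<d} (\<lambda>k. m (snd q) * f (snd q) k) (\<lambda>k. Z (i, k)))"
        by (rule dot_tensor_Z)
      also have "\<dots> = dot {..<d} (\<lambda>k. m (snd q) * f (snd q) k) (\<lambda>k. Z (fst q, k))"
        using that by (simp add: dot_def[of "{..<n}"] if_distrib[of "\<lambda>x. x * _"] mem_Times_iff cong: if_cong)
      finally show ?thesis by (simp add: dot_scale_left coord_dot)
    qed
    then have "(\<Sum>q\<in>?J. (dot idx (?v q) Z)\<^sup>2) = (\<Sum>q\<in>?J. (m (snd q))\<^sup>2 * (coord d f Z (snd q) (fst q))\<^sup>2)"
      by (intro sum.cong refl) (simp add: power_mult_distrib)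
    also have "\<dots> = (\<Sum>i<n. \<Sum>j\<in>J. (m j)\<^sup>2 * (coord d f Z j i)\<^sup>2)" unfolding sum.cartesian_product split_beta' ..
    also have "\<dots> = (\<Sum>j\<in>J. \<Sum>i<n. (m j)\<^sup>2 * (coord d f Z j i)\<^sup>2)" by (rule sum.swap)
    finally show ?thesis by (simp add: dot_def power2_eq_square sum_distrib_left)
  qed
  have V0: "V > 0" using V by (simp add: V_def)
  define t where "t = 1 / (8 * V)"
  have t: "t > 0" using V0 by (simp add: t_def)
  have o: "dot idx (?v q) (?v q') = 0" if "q \<in> ?J" "q' \<in> ?J" "q \<noteq> q'" for q q' using vv that by simp
  have b: "4 * t * dot idx (?v q) (?v q) \<le> 1" if "q \<in> ?J" for q
    using vv[OF that that] mV[of "snd q"] that V0 by (auto simp: t_def field_simps)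
  have "measure (gaussians idx) {Z \<in> space (gaussians idx). (\<Sum>q\<in>?J. (dot idx (?v q) Z)\<^sup>2) \<ge> n * V + n * V}
    \<le> exp (- t * (n * V) + 4 * t\<^sup>2 * (\<Sum>q\<in>?J. (dot idx (?v q) (?v q))\<^sup>2))"
    using gaussian_quadratic_tail(1)[where v = ?v and J = ?J and s = "n * V", OF finite_idx _ o t b] finJ
    unfolding mu by auto
  also have "\<dots> \<le> exp (- t * (n * V) + 4 * t\<^sup>2 * (n * V\<^sup>2))" using V2 t by (simp add: mult_left_mono)
  also have "- t * (n * V) + 4 * t\<^sup>2 * (n * V\<^sup>2) = - (real n / 16)"
    using V0 by (simp add: t_def power2_eq_square field_simps)
  finally show ?thesis unfolding Q by (simp add: algebra_simps)
qed

end

section \<open>High-probability events\<close>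

lemma twentytwo_pow_le_exp: "(22 :: real) ^ p \<le> exp (4 * real p)"
proof -
  have "(5 / 2 :: real) \<le> exp 1" using exp_lower_Taylor_quadratic[of 1] by simp
  then have "(5 / 2 :: real) ^ 4 \<le> exp 1 ^ 4" by (intro power_mono) auto
  also have "\<dots> = exp (4 :: real)" by (simp flip: exp_of_nat_mult)
  finally have "22 \<le> exp (4 :: real)" by (simp add: eval_nat_numeral)
  then have "(22 :: real) ^ p \<le> exp 4 ^ p" by (intro power_mono) auto
  also have "\<dots> = exp (4 * real p)" by (simp add: mult.commute flip: exp_of_nat_mult)
  finally show ?thesis .
qed

lemma (in prob_space) ball_net_union_bound:
  assumes I: "finite I"
    and A: "\<And>y. y \<in> ball_net I \<Longrightarrow> A y \<in> events" "\<And>y. y \<in> ball_net I \<Longrightarrow> prob (A y) \<le> \<epsilon>"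
    and \<epsilon>: "\<epsilon> \<ge> 0"
  shows "prob (\<Union>y\<in>ball_net I. A y) \<le> exp (4 * real (card I)) * \<epsilon>"
proof -
  have "prob (\<Union>y\<in>ball_net I. A y) \<le> (\<Sum>y\<in>ball_net I. prob (A y))"
    using finite_ball_net[OF I] A(1) by (intro finite_measure_subadditive_finite) auto
  also have "\<dots> \<le> (\<Sum>y\<in>ball_net I. \<epsilon>)" by (intro sum_mono A(2))
  also have "\<dots> = real (card (ball_net I)) * \<epsilon>" by simp
  also have "\<dots> \<le> exp (4 * real (card I)) * \<epsilon>"
    by (intro mult_right_mono \<epsilon> order_trans[OF card_ball_net_le[OF I] twentytwo_pow_le_exp])
  finally show ?thesis .
qed

context gaussian_coordinates
begin

lemma measurable_dot_comb:
  "(\<lambda>Z. dot {..<n} (comb J (coord d f Z) u) (comb J (coord d f Z) u)) \<in> borel_measurable (gaussians idx)"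
  unfolding dot_def comb_def
  by (intro borel_measurable_sum borel_measurable_times measurable_coord borel_measurable_const) auto

text \<open>A net of the unit ball over S with deviation n/4 at its points gives n/2 everywhere. The
  restriction on \<open>card S\<close> is what lets the net be paid for by the exponent
  n/256.\<close>

lemma isometry_event:
  assumes S: "S \<subseteq> D" and p: "4000 * card S \<le> n"
  obtains A where "A \<in> sets (gaussians idx)" "measure (gaussians idx) A \<le> 2 * exp (- (real n / 400))"
    "\<And>Z u. Z \<in> space (gaussians idx) - A \<Longrightarrow>
       real n / 2 * dot S u u \<le> dot {..<n} (comb S (coord d f Z) u) (comb S (coord d f Z) u)
       \<and> dot {..<n} (comb S (coord d f Z) u) (comb S (coord d f Z) u) \<le> 3 * real n / 2 * dot S u u"
proof -
  interpret P: prob_space "gaussians idx" by (rule prob_space_gaussians)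
  have finS: "finite S" using S finD finite_subset by blast
  define Q where "Q = (\<lambda>u Z. dot {..<n} (comb S (coord d f Z) u) (comb S (coord d f Z) u))"
  have [measurable]: "Q u \<in> borel_measurable (gaussians idx)" for u unfolding Q_def by (rule measurable_dot_comb)
  define U where "U = (\<lambda>y. {Z \<in> space (gaussians idx). Q y Z \<ge> n * dot S y y + n / 4})"
  define W where "W = (\<lambda>y. {Z \<in> space (gaussians idx). Q y Z \<le> n * dot S y y - n / 4})"
  have UW: "U y \<in> sets (gaussians idx)" "W y \<in> sets (gaussians idx)" for y
    unfolding U_def W_def by measurable
  have tail: "measure (gaussians idx) (U y \<union> W y) \<le> 2 * exp (- (real n / 256))" if y: "y \<in> ball_net S" for y
  proof -
    have y1: "dot S y y \<le> 1" by (rule ball_net_norm_le[OF finS y])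
    have b: "4 * (1 / 32) * dot S y y \<le> 1" using y1 by simp
    have "(dot S y y)\<^sup>2 \<le> 1" using y1 dot_self_nonneg[of S y] by (simp add: power_le_one)
    then have "real n * (dot S y y)\<^sup>2 \<le> real n * 1" by (intro mult_left_mono) auto
    \<comment> \<open>With t = 1/32 and s = n/4 the exponent is -n/128 + n/256 at most.\<close>
    then have e: "- (1 / 32) * (real n / 4) + 4 * (1 / 32)\<^sup>2 * (real n * (dot S y y)\<^sup>2) \<le> - (real n / 256)"
      by (simp add: power2_eq_square)
    then have e': "exp (- (1 / 32) * (real n / 4) + 4 * (1 / 32)\<^sup>2 * (real n * (dot S y y)\<^sup>2)) \<le> exp (- (real n / 256))"
      by (simp only: exp_le_cancel_iff)
    have t0: "(0 :: real) < 1 / 32" by simp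
    have "measure (gaussians idx) (U y) \<le> exp (- (real n / 256))" "measure (gaussians idx) (W y) \<le> exp (- (real n / 256))"
      unfolding U_def W_def Q_def by (rule order_trans[OF comb_tail(1)[OF S t0 b] e'] order_trans[OF comb_tail(2)[OF S t0 b] e'])+
    moreover have "measure (gaussians idx) (U y \<union> W y) \<le> measure (gaussians idx) (U y) + measure (gaussians idx) (W y)"
      by (rule measure_Un_le[OF UW])
    ultimately show ?thesis by linarith
  qed
  let ?A = "\<Union>y\<in>ball_net S. U y \<union> W y"
  show ?thesis
  proof (rule that[of ?A])
    show "?A \<in> sets (gaussians idx)" using finite_ball_net[OF finS] UW by (intro sets.finite_UN sets.Un) auto
    have "measure (gaussians idx) ?A \<le> exp (4 * real (card S)) * (2 * exp (- (real n / 256)))"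
      using UW tail by (intro P.ball_net_union_bound[OF finS]) auto
    also have "\<dots> = 2 * exp (4 * real (card S) + - (real n / 256))" unfolding exp_add by simp
    \<comment> \<open>The net costs 4 |S| <= n/1000, and 1/256 - 1/1000 exceeds 1/400.\<close>
    also have "\<dots> \<le> 2 * exp (- (real n / 400))"
    proof -
      have "4000 * real (card S) \<le> real n" using p by (simp flip: of_nat_le_iff)
      then show ?thesis by simp
    qed
    finally show "measure (gaussians idx) ?A \<le> 2 * exp (- (real n / 400))" .
    fix Z u assume Z: "Z \<in> space (gaussians idx) - ?A"
    have Qs: "Q u Z = (\<Sum>i<n. (dot S (\<lambda>j. coord d f Z j i) u)\<^sup>2)" for u
      unfolding Q_def dot_def[of "{..<n}"]
      by (intro sum.cong refl) (simp add: comb_def dot_def power2_eq_square mult.commute)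
    have "\<bar>(\<Sum>i<n. (dot S (\<lambda>j. coord d f Z j i) u)\<^sup>2) - n * dot S u u\<bar> \<le> 2 * (real n / 4) * dot S u u"
    proof (rule quadratic_form_net_bound[OF finS])
      fix y assume "y \<in> ball_net S"
      then have "Z \<notin> U y" "Z \<notin> W y" "Z \<in> space (gaussians idx)" using Z by auto
      then show "\<bar>(\<Sum>i<n. (dot S (\<lambda>j. coord d f Z j i) y)\<^sup>2) - n * dot S y y\<bar> \<le> real n / 4"
        unfolding U_def W_def Qs[symmetric] abs_le_iff by (simp only: mem_Collect_eq simp_thms) linarith
    qed
    then have "\<bar>Q u Z - n * dot S u u\<bar> \<le> 1 / 2 * (n * dot S u u)" by (simp add: Qs)
    then have "1 / 2 * (n * dot S u u) \<le> Q u Z \<and> Q u Z \<le> 3 / 2 * (n * dot S u u)"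
      unfolding abs_le_iff by linarith
    then show "real n / 2 * dot S u u \<le> dot {..<n} (comb S (coord d f Z) u) (comb S (coord d f Z) u)
       \<and> dot {..<n} (comb S (coord d f Z) u) (comb S (coord d f Z) u) \<le> 3 * real n / 2 * dot S u u"
      by (simp add: Q_def algebra_simps)
  qed
qed

text \<open>Here the net lives in the sample space. Deviation T/25 at its points becomes 2 T/25
  everywhere, and with a mean between 0.99 T and T the form stays between 0.9 T and 1.1 T.\<close>

lemma gram_event:
  fixes m :: "nat \<Rightarrow> real"
  assumes n: "0 < n" and B: "B \<subseteq> D" and m: "\<And>j. 0 \<le> m j" and T: "T > 0"
    and TB: "99 / 100 * T \<le> (\<Sum>j\<in>B. m j)" "(\<Sum>j\<in>B. m j) \<le> T"
    and mB: "\<And>j. j \<in> B \<Longrightarrow> 1000 * real n * m j \<le> T"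
    and V: "250000 * real n * (\<Sum>j\<in>B. (m j)\<^sup>2) \<le> T\<^sup>2"
  obtains A where "A \<in> sets (gaussians idx)" "measure (gaussians idx) A \<le> 2 * exp (- (real n / 400))"
    "\<And>Z x. Z \<in> space (gaussians idx) - A \<Longrightarrow>
       9 / 10 * T * dot {..<n} x x \<le> (\<Sum>j\<in>B. (dot {..<n} (\<lambda>i. sqrt (m j) * coord d f Z j i) x)\<^sup>2)
       \<and> (\<Sum>j\<in>B. (dot {..<n} (\<lambda>i. sqrt (m j) * coord d f Z j i) x)\<^sup>2) \<le> 11 / 10 * T * dot {..<n} x x"
proof -
  interpret P: prob_space "gaussians idx" by (rule prob_space_gaussians)
  define c where "c = (\<Sum>j\<in>B. m j)"
  \<comment> \<open>The value for which 4 t m j <= 1 is exactly the threshold 1000 n m j <= T. At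
    deviation T/25 it gives the exponent -10 n, to which the variance term adds at most n, and the
    net costs 4 n.\<close>
  define t where "t = 250 * real n / T"
  have t: "t > 0" using n T by (simp add: t_def)
  define Q where "Q = (\<lambda>y Z. \<Sum>j\<in>B. (dot {..<n} (\<lambda>i. sqrt (m j) * coord d f Z j i) y)\<^sup>2)"
  have [measurable]: "Q u \<in> borel_measurable (gaussians idx)" for u unfolding Q_def dot_def
    by (intro borel_measurable_sum borel_measurable_times borel_measurable_power measurable_coord borel_measurable_const) auto
  define U where "U = (\<lambda>y. {Z \<in> space (gaussians idx). Q y Z \<ge> c * dot {..<n} y y + T / 25})"
  define W where "W = (\<lambda>y. {Z \<in> space (gaussians idx). Q y Z \<le> c * dot {..<n} y y - T / 25})"
  have UW: "U y \<in> sets (gaussians idx)" "W y \<in> sets (gaussians idx)" for y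
    unfolding U_def W_def by measurable
  have tm: "4 * t * m j \<le> 1" if "j \<in> B" for j using mB[OF that] T by (simp add: t_def field_simps)
  have e: "- t * (T / 25) + 4 * t\<^sup>2 * (\<Sum>j\<in>B. (m j)\<^sup>2) \<le> - (9 * real n)"
  proof -
    have "4 * t\<^sup>2 * (\<Sum>j\<in>B. (m j)\<^sup>2) = (250000 * real n * (\<Sum>j\<in>B. (m j)\<^sup>2)) * (real n / T\<^sup>2)"
      by (simp add: t_def power2_eq_square field_simps)
    also have "\<dots> \<le> T\<^sup>2 * (real n / T\<^sup>2)" using V by (intro mult_right_mono) auto
    also have "\<dots> = real n" using T by simp
    finally show ?thesis using T by (simp add: t_def)
  qed
  then have e': "exp (- t * (T / 25) + 4 * t\<^sup>2 * (\<Sum>j\<in>B. (m j)\<^sup>2)) \<le> exp (- (9 * real n))"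
    by (simp only: exp_le_cancel_iff)
  have tail: "measure (gaussians idx) (U y \<union> W y) \<le> 2 * exp (- (9 * real n))" if y: "y \<in> ball_net {..<n}" for y
  proof -
    have y1: "dot {..<n} y y \<le> 1" by (rule ball_net_norm_le[OF finite_lessThan y])
    have "measure (gaussians idx) (U y) \<le> exp (- (9 * real n))" "measure (gaussians idx) (W y) \<le> exp (- (9 * real n))"
      unfolding U_def W_def Q_def c_def
      by (rule order_trans[OF weighted_gram_tail(1)[where m = m, OF B m t tm y1] e'] order_trans[OF weighted_gram_tail(2)[where m = m, OF B m t tm y1] e'] | assumption)+
    moreover have "measure (gaussians idx) (U y \<union> W y) \<le> measure (gaussians idx) (U y) + measure (gaussians idx) (W y)"
      by (rule measure_Un_le[OF UW])
    ultimately show ?thesis by linarith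
  qed
  let ?A = "\<Union>y\<in>ball_net {..<n}. U y \<union> W y"
  show ?thesis
  proof (rule that[of ?A])
    show "?A \<in> sets (gaussians idx)"
      using finite_ball_net[OF finite_lessThan[of n]] UW by (intro sets.finite_UN sets.Un) auto
    have "measure (gaussians idx) ?A \<le> exp (4 * real (card {..<n})) * (2 * exp (- (9 * real n)))"
      using UW tail by (intro P.ball_net_union_bound) auto
    also have "\<dots> = 2 * exp (4 * real n + - (9 * real n))" unfolding exp_add by simp
    also have "\<dots> \<le> 2 * exp (- (real n / 400))" by simp
    finally show "measure (gaussians idx) ?A \<le> 2 * exp (- (real n / 400))" .
    fix Z x assume Z: "Z \<in> space (gaussians idx) - ?A"
    have "\<bar>(\<Sum>j\<in>B. (dot {..<n} (\<lambda>i. sqrt (m j) * coord d f Z j i) x)\<^sup>2) - c * dot {..<n} x x\<bar> \<le> 2 * (T / 25) * dot {..<n} x x"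
    proof (rule quadratic_form_net_bound[OF finite_lessThan])
      fix y assume "y \<in> ball_net {..<n}"
      then have "Z \<notin> U y" "Z \<notin> W y" "Z \<in> space (gaussians idx)" using Z by auto
      then have "\<not> Q y Z \<ge> c * dot {..<n} y y + T / 25" "\<not> Q y Z \<le> c * dot {..<n} y y - T / 25"
        by (auto simp: U_def W_def)
      then show "\<bar>(\<Sum>j\<in>B. (dot {..<n} (\<lambda>i. sqrt (m j) * coord d f Z j i) y)\<^sup>2) - c * dot {..<n} y y\<bar> \<le> T / 25"
        unfolding Q_def by linarith
    qed
    then have q: "\<bar>Q x Z - c * dot {..<n} x x\<bar> \<le> 2 / 25 * (T * dot {..<n} x x)" by (simp add: Q_def)
    have "99 / 100 * (T * dot {..<n} x x) \<le> c * dot {..<n} x x" "c * dot {..<n} x x \<le> T * dot {..<n} x x"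
      using TB by (simp_all only: c_def mult_right_mono dot_self_nonneg mult.assoc[symmetric])
    moreover have "0 \<le> T * dot {..<n} x x" using T dot_self_nonneg[of "{..<n}" x] by simp
    ultimately have "9 / 10 * (T * dot {..<n} x x) \<le> Q x Z \<and> Q x Z \<le> 11 / 10 * (T * dot {..<n} x x)"
      using q[unfolded abs_le_iff] by (intro conjI) linarith+
    then show "9 / 10 * T * dot {..<n} x x \<le> (\<Sum>j\<in>B. (dot {..<n} (\<lambda>i. sqrt (m j) * coord d f Z j i) x)\<^sup>2)
       \<and> (\<Sum>j\<in>B. (dot {..<n} (\<lambda>i. sqrt (m j) * coord d f Z j i) x)\<^sup>2) \<le> 11 / 10 * T * dot {..<n} x x"
      by (simp add: Q_def mult.assoc)
  qed
qed

text \<open>Only one fixed vector is concerned, so no net is required and \<open>J\<close> may be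
  arbitrarily large compared with n.\<close>

lemma comb_event:
  assumes J: "J \<subseteq> D"
  obtains A where "A \<in> sets (gaussians idx)" "measure (gaussians idx) A \<le> 2 * exp (- (real n / 400))"
    "\<And>Z. Z \<in> space (gaussians idx) - A \<Longrightarrow>
       dot {..<n} (comb J (coord d f Z) u) (comb J (coord d f Z) u) \<le> 2 * real n * dot J u u"
proof (cases "dot J u u = 0")
  case True
  have finJ: "finite J" using J finD finite_subset by blast
  then have "\<forall>j\<in>J. u j = 0" using True by (simp add: dot_self_eq_0)
  then have "comb J (coord d f Z) u = (\<lambda>_. 0)" for Z by (simp add: comb_def)
  then have "dot {..<n} (comb J (coord d f Z) u) (comb J (coord d f Z) u) \<le> 2 * real n * dot J u u" for Z
    unfolding True by (simp add: dot_def)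
  then show ?thesis using that[of "{}"] by simp
next
  case False
  then have pos: "dot J u u > 0" using dot_self_nonneg[of J u] by linarith
  define b where "b = dot J u u"
  have b: "b > 0" using pos by (simp add: b_def)
  define Q where "Q = (\<lambda>Z. dot {..<n} (comb J (coord d f Z) u) (comb J (coord d f Z) u))"
  have [measurable]: "Q \<in> borel_measurable (gaussians idx)" unfolding Q_def by (rule measurable_dot_comb)
  let ?A = "{Z \<in> space (gaussians idx). Q Z \<ge> n * b + n * b}"
  show ?thesis
  proof (rule that[of ?A])
    show "?A \<in> sets (gaussians idx)" by measurable
    have "measure (gaussians idx) ?A \<le> exp (- (1 / (8 * b)) * (n * b) + 4 * (1 / (8 * b))\<^sup>2 * (n * b\<^sup>2))"
      unfolding b_def Q_def by (rule comb_tail(1)[OF J]) (use pos in auto)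
    also have "- (1 / (8 * b)) * (n * b) + 4 * (1 / (8 * b))\<^sup>2 * (n * b\<^sup>2) = - (real n / 16)"
      using b by (simp add: power2_eq_square field_simps)
    also have "exp (- (real n / 16)) \<le> 2 * exp (- (real n / 400))"
      by (rule order_trans[of _ "exp (- (real n / 400))"]) auto
    finally show "measure (gaussians idx) ?A \<le> 2 * exp (- (real n / 400))" .
    show "dot {..<n} (comb J (coord d f Z) u) (comb J (coord d f Z) u) \<le> 2 * real n * dot J u u"
      if "Z \<in> space (gaussians idx) - ?A" for Z
      using that by (auto simp: Q_def b_def)
  qed
qed

text \<open>For a given design this quantity controls the trace of the quadratic form in the noise
  contributed by block B.\<close>

lemma trace_event:
  fixes m :: "nat \<Rightarrow> real"
  assumes J: "J \<subseteq> D" and V: "(\<Sum>j\<in>J. (m j)\<^sup>2) > 0"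
  obtains A where "A \<in> sets (gaussians idx)" "measure (gaussians idx) A \<le> 2 * exp (- (real n / 400))"
    "\<And>Z. Z \<in> space (gaussians idx) - A \<Longrightarrow>
       (\<Sum>j\<in>J. (m j)\<^sup>2 * dot {..<n} (coord d f Z j) (coord d f Z j)) \<le> 2 * n * (\<Sum>j\<in>J. (m j)\<^sup>2)"
proof -
  define Q where "Q = (\<lambda>Z. (\<Sum>j\<in>J. (m j)\<^sup>2 * dot {..<n} (coord d f Z j) (coord d f Z j)))"
  have [measurable]: "Q \<in> borel_measurable (gaussians idx)" unfolding Q_def dot_def
    by (intro borel_measurable_sum borel_measurable_times borel_measurable_power measurable_coord borel_measurable_const) auto
  let ?A = "{Z \<in> space (gaussians idx). Q Z \<ge> 2 * n * (\<Sum>j\<in>J. (m j)\<^sup>2)}"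
  show ?thesis
  proof (rule that[of ?A])
    show "?A \<in> sets (gaussians idx)" by measurable
    have "measure (gaussians idx) ?A \<le> exp (- (real n / 16))"
      using trace_tail[OF J V] by (simp add: Q_def)
    also have "exp (- (real n / 16)) \<le> 2 * exp (- (real n / 400))"
      by (rule order_trans[of _ "exp (- (real n / 400))"]) auto
    finally show "measure (gaussians idx) ?A \<le> 2 * exp (- (real n / 400))" .
    show "(\<Sum>j\<in>J. (m j)\<^sup>2 * dot {..<n} (coord d f Z j) (coord d f Z j)) \<le> 2 * n * (\<Sum>j\<in>J. (m j)\<^sup>2)"
      if "Z \<in> space (gaussians idx) - ?A" for Z
      using that by (auto simp: Q_def)
  qed
qed

end

text \<open>The two sides are powers of \<delta>: \<delta>^4 and 2 \<delta>^5 are both below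
  \<delta>/8 for \<delta> <= 1/2. Each exceptional set is thereby charged \<delta>/8.\<close>

lemma delta_power_le:
  fixes \<delta> :: real
  assumes "0 < \<delta>" "\<delta> \<le> 1 / 2"
  shows "exp (- (4 * ln (1 / \<delta>))) \<le> \<delta> / 8" "2 * exp (- (5 * ln (1 / \<delta>))) \<le> \<delta> / 8"
proof -
  have p: "exp (- (real k * ln (1 / \<delta>))) = \<delta> ^ k" for k
    using assms(1) by (simp add: ln_div exp_of_nat_mult)
  have "\<delta> ^ 3 \<le> (1 / 2) ^ 3" "\<delta> ^ 4 \<le> (1 / 2) ^ 4" using assms by (intro power_mono; simp)+
  then have "\<delta> * \<delta> ^ 3 \<le> \<delta> * (1 / 8)" "\<delta> * \<delta> ^ 4 \<le> \<delta> * (1 / 16)"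
    using assms(1) by (intro mult_left_mono; simp add: eval_nat_numeral)+
  then show "exp (- (4 * ln (1 / \<delta>))) \<le> \<delta> / 8" "2 * exp (- (5 * ln (1 / \<delta>))) \<le> \<delta> / 8"
    using p[of 4] p[of 5] by (simp_all add: eval_nat_numeral)
qed

context gaussian_coordinates
begin

text \<open>Four exceptional sets concern the design alone. The two noise bounds hold conditionally
  on a good design, for z = K^-1 g, which is linear in the noise g. Six sets of probability at most
  \<delta>/8 each stay within \<delta>.\<close>

theorem design_events:
  fixes m w :: "nat \<Rightarrow> real" and T \<delta> :: real
  assumes n: "0 < n" and SB: "S \<subseteq> D" "B \<subseteq> D" "S \<inter> B = {}" and m: "\<And>j. 0 \<le> m j"
    and p: "4000 * card S \<le> n" and T: "T > 0"
    and TB: "99 / 100 * T \<le> (\<Sum>j\<in>B. m j)" "(\<Sum>j\<in>B. m j) \<le> T"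
    and mB: "\<And>j. j \<in> B \<Longrightarrow> 1000 * real n * m j \<le> T"
    and V: "250000 * real n * (\<Sum>j\<in>B. (m j)\<^sup>2) \<le> T\<^sup>2"
    and \<delta>: "0 < \<delta>" "\<delta> \<le> 1 / 2" and n\<delta>: "2000 * ln (1 / \<delta>) \<le> real n"
  defines "h \<equiv> \<lambda>Z j i. sqrt (m j) * coord d f Z j i"
    and "s2 \<equiv> 4 * (3 * real n / 2 / (9 / 10 * T)\<^sup>2) * (real (card S) + 4 * ln (1 / \<delta>))"
    and "\<beta> \<equiv> 4 * (2 * real n * (\<Sum>j\<in>B. (m j)\<^sup>2) / (9 / 10 * T)\<^sup>2) * (5 * ln (1 / \<delta>))"
  shows "\<exists>E\<in>sets (sample_space n d). measure (sample_space n d) E \<ge> 1 - \<delta> \<and> (\<forall>\<omega>\<in>E.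
     split_design {..<n} S B (h (fst \<omega>)) m (2 / real n) (9 / 10 * T) (11 / 10 * T) (T / (1000 * real n)) \<and>
     dot {..<n} (comb B (h (fst \<omega>)) w) (comb B (h (fst \<omega>)) w) \<le> 2 * real n * (\<Sum>j\<in>B. m j * (w j)\<^sup>2) \<and>
     (\<exists>z. (\<forall>i<n. gram {..<n} B (h (fst \<omega>)) z i = snd \<omega> i) \<and>
        (\<Sum>j\<in>S. (dot {..<n} (coord d f (fst \<omega>) j) z)\<^sup>2) \<le> s2 \<and>
        (\<Sum>j\<in>B. m j * (dot {..<n} (h (fst \<omega>) j) z)\<^sup>2) \<le> \<beta>))"
proof -
  let ?M = "gaussians idx" and ?N = "gaussians {..<n}" and ?I = "{..<n}"
  interpret M: prob_space ?M by (rule prob_space_gaussians)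
  interpret N: prob_space ?N by (rule prob_space_gaussians)
  interpret MN: pair_prob_space ?M ?N ..
  have finS: "finite S" and finB: "finite B" using SB finD finite_subset by blast+
  define L where "L = ln (1 / \<delta>)"
  have L0: "L > 0" using \<delta> by (simp add: L_def)
  define V2 where "V2 = (\<Sum>j\<in>B. (m j)\<^sup>2)"
  have V20: "V2 > 0"
  proof (rule ccontr)
    assume "\<not> V2 > 0"
    moreover have "V2 \<ge> 0" by (simp add: V2_def sum_nonneg)
    ultimately have "V2 = 0" by simp
    then have "\<forall>j\<in>B. m j = 0" using finB by (simp add: V2_def sum_nonneg_eq_0_iff)
    then have "(\<Sum>j\<in>B. m j) = 0" by simp
    with TB(1) T show False by simp
  qed
  define c where "c = 9 / 10 * T"
  define K where "K = 11 / 10 * T"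
  have c0: "c > 0" and K0: "K > 0" using T by (simp_all add: c_def K_def)
  define b2 where "b2 = 3 * real n / 2 / c\<^sup>2"
  have b20: "b2 > 0" using n c0 by (simp add: b2_def)
  define tr where "tr = 2 * real n * V2 / c\<^sup>2"
  have tr0: "tr > 0" using n c0 V20 by (simp add: tr_def)
  have s2: "s2 = 4 * b2 * (real (card S) + 4 * L)" by (simp add: s2_def b2_def c_def L_def)
  have \<beta>: "\<beta> = 4 * tr * (5 * L)" by (simp add: \<beta>_def tr_def c_def L_def V2_def)
  define eps where "eps = \<delta> / 8"
  have small: "2 * exp (- (real n / 400)) \<le> eps"
  proof -
    \<comment> \<open>The bound 2000 ln (1/\<delta>) <= n is n/400 >= 5 ln (1/\<delta>).\<close>
    have "2 * exp (- (real n / 400)) \<le> 2 * exp (- (5 * ln (1 / \<delta>)))" using n\<delta> by simp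
    also have "\<dots> \<le> eps" unfolding eps_def by (rule delta_power_le(2)[OF \<delta>])
    finally show ?thesis .
  qed
  obtain A1 where A1: "A1 \<in> sets ?M" "measure ?M A1 \<le> 2 * exp (- (real n / 400))"
    "\<And>Z u. Z \<in> space ?M - A1 \<Longrightarrow>
       real n / 2 * dot S u u \<le> dot ?I (comb S (coord d f Z) u) (comb S (coord d f Z) u)
       \<and> dot ?I (comb S (coord d f Z) u) (comb S (coord d f Z) u) \<le> 3 * real n / 2 * dot S u u"
    using isometry_event[OF SB(1) p] by blast
  obtain A2 where A2: "A2 \<in> sets ?M" "measure ?M A2 \<le> 2 * exp (- (real n / 400))"
    "\<And>Z x. Z \<in> space ?M - A2 \<Longrightarrow> c * dot ?I x x \<le> (\<Sum>j\<in>B. (dot ?I (h Z j) x)\<^sup>2)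
       \<and> (\<Sum>j\<in>B. (dot ?I (h Z j) x)\<^sup>2) \<le> K * dot ?I x x"
    using gram_event[where m = m, OF n SB(2) m T TB mB V] unfolding h_def c_def K_def by blast
  define u where "u = (\<lambda>j. sqrt (m j) * w j)"
  obtain A3 where A3: "A3 \<in> sets ?M" "measure ?M A3 \<le> 2 * exp (- (real n / 400))"
    "\<And>Z. Z \<in> space ?M - A3 \<Longrightarrow> dot ?I (comb B (coord d f Z) u) (comb B (coord d f Z) u) \<le> 2 * real n * dot B u u"
    using comb_event[OF SB(2), of u] by blast
  obtain A4 where A4: "A4 \<in> sets ?M" "measure ?M A4 \<le> 2 * exp (- (real n / 400))"
    "\<And>Z. Z \<in> space ?M - A4 \<Longrightarrow> (\<Sum>j\<in>B. (m j)\<^sup>2 * dot ?I (coord d f Z j) (coord d f Z j)) \<le> 2 * n * V2"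
    using trace_event[OF SB(2), of m] V20 unfolding V2_def by blast
  define A where "A = A1 \<union> A2 \<union> A3 \<union> A4"
  have Asets [measurable]: "A \<in> sets ?M" using A1 A2 A3 A4 by (simp add: A_def)
  have "measure ?M A \<le> measure ?M A1 + measure ?M A2 + measure ?M A3 + measure ?M A4"
    unfolding A_def using A1(1) A2(1) A3(1) A4(1)
    by (smt (verit) measure_Un_le sets.Un)
  then have PA: "measure ?M A \<le> 4 * eps" using A1(2) A2(2) A3(2) A4(2) small by linarith
  define R where "R = (\<lambda>Z. gram_inv ?I B (h Z) K)"
  \<comment> \<open>\<open>v6 Z j\<close> and \<open>v7 Z j\<close> are the coefficient vectors, as
    linear forms in the noise, of <coord j, z> and of sqrt (m j) <h j, z>.\<close>
  define v6 where "v6 = (\<lambda>Z j k. dot ?I (coord d f Z j) (R Z k))"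
  define v7 where "v7 = (\<lambda>Z j k. sqrt (m j) * dot ?I (h Z j) (R Z k))"
  define F6 where "F6 = (\<lambda>Z g. \<Sum>j\<in>S. (dot ?I (v6 Z j) g)\<^sup>2)"
  define F7 where "F7 = (\<lambda>Z g. \<Sum>j\<in>B. (dot ?I (v7 Z j) g)\<^sup>2)"
  have mh: "(\<lambda>Z. h Z j i) \<in> borel_measurable ?M" if "i < n" for i j
    unfolding h_def by (intro borel_measurable_times measurable_coord that borel_measurable_const)
  have mR: "(\<lambda>Z. R Z k i) \<in> borel_measurable ?M" if "i < n" for k i
    unfolding R_def by (rule measurable_gram_inv) (use mh that in auto)
  have mv6: "(\<lambda>Z. v6 Z j k) \<in> borel_measurable ?M" for j k
    unfolding v6_def dot_def by (intro borel_measurable_sum borel_measurable_times measurable_coord mR) auto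
  have mv7: "(\<lambda>Z. v7 Z j k) \<in> borel_measurable ?M" for j k
    unfolding v7_def dot_def by (intro borel_measurable_sum borel_measurable_times mh mR borel_measurable_const) auto
  have mF6: "(\<lambda>\<omega>. F6 (fst \<omega>) (snd \<omega>)) \<in> borel_measurable (?M \<Otimes>\<^sub>M ?N)"
    unfolding F6_def dot_def
    by (intro borel_measurable_sum borel_measurable_power borel_measurable_times
        measurable_compose[OF measurable_fst mv6] measurable_compose[OF measurable_snd measurable_gaussians_component])
  have mF7: "(\<lambda>\<omega>. F7 (fst \<omega>) (snd \<omega>)) \<in> borel_measurable (?M \<Otimes>\<^sub>M ?N)"
    unfolding F7_def dot_def
    by (intro borel_measurable_sum borel_measurable_power borel_measurable_times
        measurable_compose[OF measurable_fst mv7] measurable_compose[OF measurable_snd measurable_gaussians_component])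
  have good: "c * dot ?I x x \<le> (\<Sum>j\<in>B. (dot ?I (h Z j) x)\<^sup>2)" "(\<Sum>j\<in>B. (dot ?I (h Z j) x)\<^sup>2) \<le> K * dot ?I x x"
    if "Z \<in> space ?M - A" for Z x using A2(3)[of Z x] that by (auto simp: A_def)
  have tail6: "measure ?N {g \<in> space ?N. F6 Z g \<ge> s2} \<le> eps" if Z: "Z \<in> space ?M - A" for Z
  proof -
    \<comment> \<open>The form is the S block followed by the transposed inverse of K: squared norm
      at most 3 n / 2 for the first and 1 / c^2 for the second.\<close>
    have op: "(\<Sum>i\<in>?I. (\<Sum>j\<in>S. a j * v6 Z j i)\<^sup>2) \<le> b2 * (\<Sum>j\<in>S. (a j)\<^sup>2)" for a
    proof -
      have "(\<Sum>i\<in>?I. (\<Sum>j\<in>S. a j * v6 Z j i)\<^sup>2) = (\<Sum>k\<in>?I. (dot ?I (comb S (coord d f Z) a) (R Z k))\<^sup>2)"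
        by (simp add: v6_def dot_comb)
      also have "\<dots> \<le> dot ?I (comb S (coord d f Z) a) (comb S (coord d f Z) a) / c\<^sup>2"
        unfolding R_def by (rule gram_inv_transpose_norm_le[OF _ K0 good(2)[OF Z] c0 good(1)[OF Z]]) simp
      also have "\<dots> \<le> 3 * real n / 2 * dot S a a / c\<^sup>2"
        using A1(3)[of Z a] Z by (intro divide_right_mono) (auto simp: A_def)
      also have "\<dots> = b2 * (\<Sum>j\<in>S. (a j)\<^sup>2)" by (simp add: b2_def dot_def power2_eq_square)
      finally show ?thesis .
    qed
    have "measure ?N {g \<in> space ?N. F6 Z g \<ge> s2} \<le> exp (- (4 * L))"
      unfolding F6_def s2 by (rule gaussian_low_rank_tail[OF _ finS b20 op]) simp
    then show ?thesis using delta_power_le(1)[OF \<delta>] by (simp add: eps_def L_def)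
  qed
  have tail7: "measure ?N {g \<in> space ?N. F7 Z g \<ge> \<beta>} \<le> eps" if Z: "Z \<in> space ?M - A" for Z
  proof -
    \<comment> \<open>The trace of the form: one factor \<open>m j\<close> is explicit and a second
      one comes from \<open>h Z j\<close>, so the fourth design event bounds it by the sum of
      squared eigenvalues.\<close>
    have "(\<Sum>j\<in>B. dot ?I (v7 Z j) (v7 Z j)) = (\<Sum>j\<in>B. m j * (\<Sum>k\<in>?I. (dot ?I (h Z j) (R Z k))\<^sup>2))"
    proof (intro sum.cong refl)
      fix j
      have "sqrt (m j) * sqrt (m j) = m j" using m by simp
      then show "dot ?I (v7 Z j) (v7 Z j) = m j * (\<Sum>k\<in>?I. (dot ?I (h Z j) (R Z k))\<^sup>2)"
        unfolding v7_def dot_scale_left dot_scale_right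
        by (simp add: mult.assoc[symmetric]) (simp add: dot_def[of ?I "\<lambda>k. dot ?I (h Z j) (R Z k)"] power2_eq_square)
    qed
    also have "\<dots> \<le> (\<Sum>j\<in>B. m j * (dot ?I (h Z j) (h Z j) / c\<^sup>2))"
      unfolding R_def
      by (intro sum_mono mult_left_mono gram_inv_transpose_norm_le[OF _ K0 good(2)[OF Z] c0 good(1)[OF Z]] m) simp
    also have "\<dots> = (\<Sum>j\<in>B. (m j)\<^sup>2 * dot ?I (coord d f Z j) (coord d f Z j)) / c\<^sup>2"
      unfolding sum_divide_distrib
    proof (intro sum.cong refl)
      fix j
      have "sqrt (m j) * sqrt (m j) = m j" using m by simp
      then have "dot ?I (h Z j) (h Z j) = m j * dot ?I (coord d f Z j) (coord d f Z j)"
        unfolding h_def dot_scale_left dot_scale_right by (simp add: mult.assoc[symmetric])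
      then show "m j * (dot ?I (h Z j) (h Z j) / c\<^sup>2) = (m j)\<^sup>2 * dot ?I (coord d f Z j) (coord d f Z j) / c\<^sup>2"
        by (simp add: power2_eq_square)
    qed
    also have "\<dots> \<le> 2 * real n * V2 / c\<^sup>2" using A4(3)[of Z] Z by (intro divide_right_mono) (auto simp: A_def)
    finally have "(\<Sum>j\<in>B. dot ?I (v7 Z j) (v7 Z j)) \<le> tr" by (simp add: tr_def)
    then have "measure ?N {g \<in> space ?N. F7 Z g \<ge> \<beta>} \<le> 2 * exp (- (5 * L))"
      unfolding F7_def \<beta> using L0 by (intro gaussian_trace_tail[OF _ finB _ _ tr0]) auto
    then show ?thesis using delta_power_le(2)[OF \<delta>] by (simp add: eps_def L_def)
  qed
  have eps0: "eps \<ge> 0" using \<delta> by (simp add: eps_def)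
  let ?P = "?M \<Otimes>\<^sub>M ?N"
  have spP: "space ?P = space ?M \<times> space ?N" by (rule space_pair_measure)
  \<comment> \<open>With the bad designs removed, every section is either empty or covered by the
    conditional tail bound.\<close>
  define B6 where "B6 = {\<omega> \<in> space ?P. s2 \<le> F6 (fst \<omega>) (snd \<omega>)} - A \<times> space ?N"
  define B7 where "B7 = {\<omega> \<in> space ?P. \<beta> \<le> F7 (fst \<omega>) (snd \<omega>)} - A \<times> space ?N"
  have AN: "A \<times> space ?N \<in> sets ?P" by (intro pair_measureI Asets sets.top)
  have B6s: "B6 \<in> sets ?P" unfolding B6_def using mF6 AN by (intro sets.Diff borel_measurable_le) auto
  have B7s: "B7 \<in> sets ?P" unfolding B7_def using mF7 AN by (intro sets.Diff borel_measurable_le) auto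
  have P6: "measure ?P B6 \<le> eps"
  proof (rule measure_pair_le_sections[OF M.prob_space_axioms N.prob_space_axioms B6s _ eps0])
    fix Z assume Z: "Z \<in> space ?M"
    show "measure ?N (Pair Z -` B6) \<le> eps"
    proof (cases "Z \<in> A")
      case True
      then have "Pair Z -` B6 = {}" by (auto simp: B6_def spP)
      then show ?thesis using eps0 by simp
    next
      case False
      then have "Pair Z -` B6 = {g \<in> space ?N. F6 Z g \<ge> s2}" using Z by (auto simp: B6_def spP)
      then show ?thesis using tail6 Z False by simp
    qed
  qed
  have P7: "measure ?P B7 \<le> eps"
  proof (rule measure_pair_le_sections[OF M.prob_space_axioms N.prob_space_axioms B7s _ eps0])
    fix Z assume Z: "Z \<in> space ?M"
    show "measure ?N (Pair Z -` B7) \<le> eps"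
    proof (cases "Z \<in> A")
      case True
      then have "Pair Z -` B7 = {}" by (auto simp: B7_def spP)
      then show ?thesis using eps0 by simp
    next
      case False
      then have "Pair Z -` B7 = {g \<in> space ?N. F7 Z g \<ge> \<beta>}" using Z by (auto simp: B7_def spP)
      then show ?thesis using tail7 Z False by simp
    qed
  qed
  have PAN: "measure ?P (A \<times> space ?N) \<le> 4 * eps"
  proof -
    have "emeasure ?P (A \<times> space ?N) = emeasure ?M A * emeasure ?N (space ?N)"
      by (rule N.emeasure_pair_measure_Times[OF Asets sets.top])
    then have "measure ?P (A \<times> space ?N) = measure ?M A"
      by (simp add: measure_def N.emeasure_space_1)
    then show ?thesis using PA by simp
  qed
  define E where "E = space ?P - (A \<times> space ?N \<union> B6 \<union> B7)"
  have bad: "A \<times> space ?N \<union> B6 \<union> B7 \<in> sets ?P" using AN B6s B7s by blast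
  have "measure ?P (A \<times> space ?N \<union> B6 \<union> B7) \<le> measure ?P (A \<times> space ?N) + measure ?P B6 + measure ?P B7"
    using measure_Un_le[OF sets.Un[OF AN B6s] B7s] measure_Un_le[OF AN B6s] by linarith
  then have "measure ?P (A \<times> space ?N \<union> B6 \<union> B7) \<le> 6 * eps" using PAN P6 P7 by linarith
  then have "measure ?P E \<ge> 1 - \<delta>"
    unfolding E_def MN.P.prob_compl[OF bad] using \<delta> by (simp add: eps_def)
  moreover have "E \<in> sets ?P" unfolding E_def using bad by (rule sets.compl_sets)
  moreover have "split_design ?I S B (h (fst \<omega>)) m (2 / real n) (9 / 10 * T) (11 / 10 * T) (T / (1000 * real n)) \<and>
     dot ?I (comb B (h (fst \<omega>)) w) (comb B (h (fst \<omega>)) w) \<le> 2 * real n * (\<Sum>j\<in>B. m j * (w j)\<^sup>2) \<and>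
     (\<exists>z. (\<forall>i<n. gram ?I B (h (fst \<omega>)) z i = snd \<omega> i) \<and>
        (\<Sum>j\<in>S. (dot ?I (coord d f (fst \<omega>) j) z)\<^sup>2) \<le> s2 \<and>
        (\<Sum>j\<in>B. m j * (dot ?I (h (fst \<omega>) j) z)\<^sup>2) \<le> \<beta>)" if \<omega>: "\<omega> \<in> E" for \<omega>
  proof -
    obtain Z g where Zg: "\<omega> = (Z, g)" by (cases \<omega>)
    have Z: "Z \<in> space ?M - A" and g: "g \<in> space ?N" using \<omega> by (auto simp: Zg E_def spP)
    have F: "F6 Z g < s2" "F7 Z g < \<beta>" using \<omega> Z g by (auto simp: Zg E_def spP B6_def B7_def not_le)
    have sd: "split_design ?I S B (h Z) m (2 / real n) c K (T / (1000 * real n))"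
    proof
      show "(\<Sum>j\<in>S. m j * (v j)\<^sup>2) \<le> 2 / real n * dot ?I (comb S (h Z) v) (comb S (h Z) v)" for v
      proof -
        let ?v = "\<lambda>j. sqrt (m j) * v j"
        have "dot S ?v ?v = (\<Sum>j\<in>S. m j * (v j)\<^sup>2)"
          unfolding dot_def
        proof (intro sum.cong refl)
          fix j
          have "sqrt (m j) * v j * (sqrt (m j) * v j) = (sqrt (m j) * sqrt (m j)) * (v j * v j)" by (simp only: mult_ac)
          then show "sqrt (m j) * v j * (sqrt (m j) * v j) = m j * (v j)\<^sup>2" using m by (simp add: power2_eq_square)
        qed
        moreover have "comb S (coord d f Z) ?v = comb S (h Z) v" by (simp add: comb_def h_def mult_ac)
        ultimately show ?thesis using A1(3)[of Z ?v] Z n by (simp add: A_def field_simps)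
      qed
      show "c * dot ?I x x \<le> (\<Sum>j\<in>B. (dot ?I (h Z j) x)\<^sup>2)" for x by (rule good(1)[OF Z])
      show "(\<Sum>j\<in>B. (dot ?I (h Z j) x)\<^sup>2) \<le> K * dot ?I x x" for x by (rule good(2)[OF Z])
      show "m j \<le> T / (1000 * real n)" if "j \<in> B" for j using mB[OF that] n by (simp add: field_simps)
    qed (use finS finB SB m n c0 K0 T in auto)
    have cw: "dot ?I (comb B (h Z) w) (comb B (h Z) w) \<le> 2 * real n * (\<Sum>j\<in>B. m j * (w j)\<^sup>2)"
    proof -
      have "dot B u u = (\<Sum>j\<in>B. m j * (w j)\<^sup>2)"
        unfolding dot_def u_def
      proof (intro sum.cong refl)
        fix j
        have "sqrt (m j) * w j * (sqrt (m j) * w j) = (sqrt (m j) * sqrt (m j)) * (w j * w j)" by (simp only: mult_ac)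
        then show "sqrt (m j) * w j * (sqrt (m j) * w j) = m j * (w j)\<^sup>2" using m by (simp add: power2_eq_square)
      qed
      moreover have "comb B (coord d f Z) u = comb B (h Z) w" by (simp add: comb_def h_def u_def mult_ac)
      ultimately show ?thesis using A3(3)[of Z] Z by (simp add: A_def)
    qed
    let ?z = "gram_solve ?I B (h Z) K g"
    have "\<forall>i<n. gram ?I B (h Z) ?z i = g i"
      using gram_gram_solve[OF _ K0 good(2)[OF Z] c0 good(1)[OF Z]] by simp
    moreover have "(\<Sum>j\<in>S. (dot ?I (coord d f Z j) ?z)\<^sup>2) \<le> s2"
      using F(1) by (simp add: dot_gram_solve F6_def v6_def R_def)
    moreover have "(\<Sum>j\<in>B. m j * (dot ?I (h Z j) ?z)\<^sup>2) \<le> \<beta>"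
    proof -
      have "m j * (dot ?I (h Z j) ?z)\<^sup>2 = (dot ?I (v7 Z j) g)\<^sup>2" for j
        using m unfolding v7_def dot_scale_left dot_gram_solve R_def by (simp add: power_mult_distrib)
      then show ?thesis using F(2) by (simp add: F7_def)
    qed
    ultimately show ?thesis using sd cw by (auto simp: Zg c_def K_def)
  qed
  ultimately show ?thesis unfolding sample_space_def by blast
qed

end

section \<open>The risk bound\<close>

text \<open>The supremum dominates its members only if the set is bounded, hence the crude constant
  \<open>C\<close>; the member at x = 0 then gives the sign.\<close>

lemma op_norm_nonneg: "0 \<le> op_norm d A"
proof -
  let ?U = "{vnorm d (mvmul d A x) | x. vnorm d x \<le> 1}"
  define C where "C = sqrt (\<Sum>i<d. (\<Sum>j<d. \<bar>A i j\<bar>)\<^sup>2)"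
  have "vnorm d (mvmul d A x) \<le> C" if x: "vnorm d x \<le> 1" for x
  proof -
    have xj: "\<bar>x j\<bar> \<le> 1" if "j < d" for j
    proof -
      have "(x j)\<^sup>2 \<le> (\<Sum>j<d. (x j)\<^sup>2)" using that by (intro member_le_sum) auto
      then have "sqrt ((x j)\<^sup>2) \<le> vnorm d x" unfolding vnorm_def by (rule real_sqrt_le_mono)
      with x show ?thesis by simp
    qed
    have "\<bar>mvmul d A x i\<bar> \<le> (\<Sum>j<d. \<bar>A i j\<bar>)" for i
    proof -
      have "\<bar>mvmul d A x i\<bar> \<le> (\<Sum>j<d. \<bar>A i j * x j\<bar>)" unfolding mvmul_def by (rule sum_abs)
      also have "\<dots> \<le> (\<Sum>j<d. \<bar>A i j\<bar>)" using xj by (intro sum_mono) (auto simp: abs_mult mult_left_le)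
      finally show ?thesis .
    qed
    then show ?thesis unfolding vnorm_def C_def
      by (intro real_sqrt_le_mono sum_mono) (metis abs_ge_zero power2_abs power_mono)
  qed
  then have bdd: "bdd_above ?U" by (intro bdd_aboveI[of _ C]) auto
  have "vnorm d (mvmul d A (\<lambda>_. 0)) \<in> ?U" by (intro CollectI exI[of _ "\<lambda>_. 0"]) (simp add: vnorm_def)
  from cSup_upper[OF this bdd] show ?thesis by (simp add: op_norm_def vnorm_def mvmul_def)
qed

section \<open>The minimum-norm interpolator and its risk\<close>

lemma vnorm_dot: "vnorm d x = sqrt (dot {..<d} x x)"
  by (simp add: vnorm_def dot_def power2_eq_square)

text \<open>A combination w of the rows has the same inner product with every interpolant v, namely
  <w, v> = <w, w>; Cauchy-Schwarz then gives |w| <= |v|.\<close>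

lemma min_norm_interp_row_combination:
  assumes w: "\<And>a. w a = (\<Sum>i<n. lam i * X i a)" and interp: "\<And>i. i < n \<Longrightarrow> mvmul d X w i = Y i"
  shows "min_norm_interp n d X Y w"
  unfolding min_norm_interp_def
proof (intro conjI allI impI)
  fix v assume v: "\<forall>i<n. mvmul d X v i = Y i"
  have wx: "dot {..<d} w x = (\<Sum>i<n. lam i * mvmul d X x i)" for x
    using w by (simp add: dot_sum_left dot_scale_left mvmul_dot cong: dot_cong)
  have "dot {..<d} w v = dot {..<d} w w" unfolding wx using v interp by simp
  then have "dot {..<d} w w * dot {..<d} w w \<le> dot {..<d} w w * dot {..<d} v v"
    using dot_Cauchy_Schwarz[of "{..<d}" w v] by (simp add: power2_eq_square)
  then have "dot {..<d} w w \<le> dot {..<d} v v"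
    using dot_self_nonneg[of "{..<d}" w] dot_self_nonneg[of "{..<d}" v]
    by (cases "dot {..<d} w w = 0") (auto simp: less_le)
  then show "vnorm d w \<le> vnorm d v" unfolding vnorm_dot by (rule real_sqrt_le_mono)
qed (use interp in auto)

text \<open>The interpolator is linear in the responses, so its dual vector is the one for the
  signal plus \<sigma> times the one for the noise. Directions outside S and B carry neither design
  nor risk, and in the remaining ones the error separates into noise minus bias.\<close>

lemma min_norm_interpolator_risk:
  assumes e: "orthonormal_basis d e" and ev: "\<And>j. j < d \<Longrightarrow> eigenvector d \<Sigma> (m j) (e j)"
    and sym: "\<forall>i<d. \<forall>j<d. \<Sigma> i j = \<Sigma> j i"
    and h: "\<And>j i. j < d \<Longrightarrow> i < n \<Longrightarrow> dot {..<d} (e j) (X i) = h j i"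
    and SB: "S \<subseteq> {..<d}" "B \<subseteq> {..<d}" and m0: "\<And>j. j < d \<Longrightarrow> j \<notin> S \<union> B \<Longrightarrow> m j = 0"
    and h0: "\<And>j i. j < d \<Longrightarrow> j \<notin> S \<union> B \<Longrightarrow> i < n \<Longrightarrow> h j i = 0"
    and Y: "\<And>i. i < n \<Longrightarrow> Y i = mvmul d X wstar i + \<sigma> * g i"
    and lamw: "\<And>i. i < n \<Longrightarrow> gram {..<n} (S \<union> B) h lamw i = comb (S \<union> B) h (\<lambda>j. dot {..<d} (e j) wstar) i"
    and lamg: "\<And>i. i < n \<Longrightarrow> gram {..<n} (S \<union> B) h lamg i = g i"
  shows "\<exists>w. min_norm_interp n d X Y w \<and> pop_loss d \<Sigma> \<sigma> wstar w = \<sigma>\<^sup>2 + (\<Sum>j\<in>S \<union> B. m j *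
    (\<sigma> * dot {..<n} (h j) lamg - (dot {..<d} (e j) wstar - dot {..<n} (h j) lamw))\<^sup>2)"
proof -
  define lam where "lam = (\<lambda>i. lamw i + \<sigma> * lamg i)"
  define w where "w = (\<lambda>a. \<Sum>i<n. lam i * X i a)"
  have SBd: "S \<union> B \<subseteq> {..<d}" using SB by auto
  have ew: "dot {..<d} (e j) w = dot {..<n} (h j) lam" if "j < d" for j
    using h[OF that] unfolding w_def dot_sum_right dot_scale_right
    by (simp add: dot_def[of "{..<n}"] mult.commute)
  have restrict: "(\<Sum>j<d. h j i * F j) = (\<Sum>j\<in>S \<union> B. h j i * F j)" if "i < n" for i F
    using h0 that SBd by (intro sum.mono_neutral_right) auto
  have Xx: "mvmul d X x i = (\<Sum>j\<in>S \<union> B. h j i * dot {..<d} (e j) x)" if "i < n" for x i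
    unfolding mvmul_dot orthonormal_Parseval[OF e, of "X i"] using h that restrict[OF that] by simp
  have "mvmul d X w i = Y i" if i: "i < n" for i
  proof -
    have "mvmul d X w i = (\<Sum>j\<in>S \<union> B. h j i * dot {..<n} (h j) lam)"
      unfolding Xx[OF i] using ew SBd by (intro sum.cong) auto
    also have "\<dots> = gram {..<n} (S \<union> B) h lam i" by (simp add: gram_def mult.commute)
    also have "\<dots> = comb (S \<union> B) h (\<lambda>j. dot {..<d} (e j) wstar) i + \<sigma> * g i"
      unfolding lam_def gram_add gram_scale using lamw[OF i] lamg[OF i] by simp
    also have "comb (S \<union> B) h (\<lambda>j. dot {..<d} (e j) wstar) i = mvmul d X wstar i"
      unfolding Xx[OF i] by (simp add: comb_def mult.commute)
    finally show ?thesis using Y[OF i] by simp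
  qed
  then have "min_norm_interp n d X Y w" by (intro min_norm_interp_row_combination[where lam = lam]) (auto simp: w_def)
  moreover have "pop_loss d \<Sigma> \<sigma> wstar w = \<sigma>\<^sup>2 + (\<Sum>j\<in>S \<union> B. m j *
    (\<sigma> * dot {..<n} (h j) lamg - (dot {..<d} (e j) wstar - dot {..<n} (h j) lamw))\<^sup>2)"
  proof -
    have "qform d \<Sigma> (\<lambda>j. w j - wstar j) = (\<Sum>j<d. m j * (dot {..<d} (e j) w - dot {..<d} (e j) wstar)\<^sup>2)"
      using qform_eigen[where m = m and e = e, OF e ev sym, of "\<lambda>j. w j - wstar j"] by (simp only: dot_diff_right)
    also have "\<dots> = (\<Sum>j\<in>S \<union> B. m j * (dot {..<d} (e j) w - dot {..<d} (e j) wstar)\<^sup>2)"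
      using m0 SBd by (intro sum.mono_neutral_right) auto
    also have "\<dots> = (\<Sum>j\<in>S \<union> B. m j *
      (\<sigma> * dot {..<n} (h j) lamg - (dot {..<d} (e j) wstar - dot {..<n} (h j) lamw))\<^sup>2)"
    proof (intro sum.cong refl)
      fix j assume "j \<in> S \<union> B"
      then have "dot {..<d} (e j) w = dot {..<n} (h j) lamw + \<sigma> * dot {..<n} (h j) lamg"
        using ew[of j] SBd unfolding lam_def dot_add_right dot_scale_right by auto
      then show "m j * (dot {..<d} (e j) w - dot {..<d} (e j) wstar)\<^sup>2 = m j *
        (\<sigma> * dot {..<n} (h j) lamg - (dot {..<d} (e j) wstar - dot {..<n} (h j) lamw))\<^sup>2"
        by (simp add: algebra_simps)
    qed
    finally show ?thesis by (simp add: pop_loss_def)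
  qed
  ultimately show ?thesis by blast
qed

lemma split_design_risk:
  fixes n p :: nat and \<sigma> :: real
  assumes sd: "split_design I S B h m (2 / real n) (9 / 10 * T) (11 / 10 * T) (T / (1000 * real n))"
    and n: "0 < n" and T: "T > 0" and \<Lambda>: "0 \<le> \<Lambda>" and \<sigma>: "0 \<le> \<sigma>"
    and cw: "dot I (comb B h w) (comb B h w) \<le> 2 * real n * (\<Sum>j\<in>B. m j * (w j)\<^sup>2)"
    and z: "\<And>i. i \<in> I \<Longrightarrow> gram I B h z i = y i"
    and g: "\<And>j i. j \<in> S \<Longrightarrow> h j i = sqrt (m j) * g j i"
    and s2: "(\<Sum>j\<in>S. (dot I (g j) z)\<^sup>2) \<le> 4 * (3 * real n / 2 / (9 / 10 * T)\<^sup>2) * (real p + 4 * \<Lambda>)"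
    and \<beta>: "(\<Sum>j\<in>B. m j * (dot I (h j) z)\<^sup>2) \<le> 4 * (2 * real n * V / (9 / 10 * T)\<^sup>2) * (5 * \<Lambda>)"
    and V: "0 \<le> V"
    and lam1: "\<And>i. i \<in> I \<Longrightarrow> gram I (S \<union> B) h lam1 i = comb (S \<union> B) h w i"
    and lam2: "\<And>i. i \<in> I \<Longrightarrow> gram I (S \<union> B) h lam2 i = y i"
    and \<theta>: "36 * (real p + 4 * \<Lambda>) / real n + 100 * real n * V * \<Lambda> / T\<^sup>2 \<le> \<theta>" "\<theta> \<le> 1"
    and b: "0 \<le> b" "T / real n * (\<Sum>j\<in>S \<union> B. (w j)\<^sup>2) \<le> b\<^sup>2"
  shows "\<sigma>\<^sup>2 + (\<Sum>j\<in>S \<union> B. m j * (\<sigma> * dot I (h j) lam2 - (w j - dot I (h j) lam1))\<^sup>2) \<le> (1 + \<theta>) * (\<sigma> + b)\<^sup>2"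
proof -
  interpret split_design I S B h m "2 / real n" "9 / 10 * T" "11 / 10 * T" "T / (1000 * real n)" by (rule sd)
  have finSB: "finite (S \<union> B)" using fin by simp
  have n0: "real n > 0" using n by simp
  let ?s2 = "4 * (3 * real n / 2 / (9 / 10 * T)\<^sup>2) * (real p + 4 * \<Lambda>)"
  let ?\<beta> = "4 * (2 * real n * V / (9 / 10 * T)\<^sup>2) * (5 * \<Lambda>)"
  define q where "q = (real p + 4 * \<Lambda>) / real n"
  have q0: "0 \<le> q" using \<Lambda> by (simp add: q_def)
  define a where "a = real n * V * \<Lambda> / T\<^sup>2"
  have a0: "0 \<le> a" using \<Lambda> V by (simp add: a_def)
  have \<theta>q: "36 * q + 100 * a \<le> \<theta>" using \<theta>(1) by (simp add: q_def a_def mult.assoc)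
  have var: "(\<Sum>j\<in>S \<union> B. m j * (dot I (h j) lam2)\<^sup>2) \<le> \<theta>"
  proof -
    have "(\<Sum>j\<in>S \<union> B. m j * (dot I (h j) lam2)\<^sup>2)
      \<le> (2 / real n * (11 / 10 * T))\<^sup>2 * ?s2 + 2 * ?\<beta> + 2 * (T / (1000 * real n)) * (2 / real n * (11 / 10 * T) * ?s2)"
      by (rule variance_bound[OF lam2 z g s2 \<beta>])
    \<comment> \<open>Numerically 2904/81 + 264/8100 is below 36 and 8000/81 is below 100; these are
      the coefficients in the definition of \<theta>.\<close>
    also have "(2 / real n * (11 / 10 * T))\<^sup>2 * ?s2 = 2904 / 81 * q"
      using n0 T by (simp add: q_def field_simps power2_eq_square)
    also have "?\<beta> = 4000 / 81 * a" using T by (simp add: a_def field_simps power2_eq_square)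
    also have "2 * (T / (1000 * real n)) * (2 / real n * (11 / 10 * T) * ?s2) = 264 / 8100 * q"
      using n0 T by (simp add: q_def field_simps power2_eq_square)
    also have "2904 / 81 * q + 2 * (4000 / 81 * a) + 264 / 8100 * q \<le> 36 * q + 100 * a" using q0 a0 by simp
    finally show ?thesis using \<theta>q by linarith
  qed
  have \<theta>0: "0 \<le> \<theta>" using \<theta>q q0 a0 by linarith
  have bias: "(\<Sum>j\<in>S \<union> B. m j * (w j - dot I (h j) lam1)\<^sup>2) \<le> b\<^sup>2"
  proof -
    define P where "P = (\<Sum>j\<in>S. (w j)\<^sup>2)"
    define Q where "Q = (\<Sum>j\<in>B. (w j)\<^sup>2)"
    have P0: "0 \<le> P" and Q0: "0 \<le> Q" by (simp_all add: P_def Q_def sum_nonneg)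
    have PQ: "(\<Sum>j\<in>S \<union> B. (w j)\<^sup>2) = P + Q" unfolding P_def Q_def by (rule sum.union_disjoint[OF fin(2,3) disj])
    have "(\<Sum>j\<in>B. m j * (w j)\<^sup>2) \<le> (\<Sum>j\<in>B. T / (1000 * real n) * (w j)\<^sup>2)"
      using \<tau>(1) by (intro sum_mono mult_right_mono) auto
    also have "\<dots> = T / (1000 * real n) * Q" by (simp add: Q_def sum_distrib_left)
    finally have "2 * real n * (\<Sum>j\<in>B. m j * (w j)\<^sup>2) \<le> 2 * real n * (T / (1000 * real n) * Q)" by (intro mult_left_mono) auto
    also have "\<dots> = T * Q / 500" using n0 by simp
    finally have \<psi>: "dot I (comb B h w) (comb B h w) \<le> T * Q / 500" using cw by linarith
    have "(\<Sum>j\<in>S \<union> B. m j * (w j - dot I (h j) lam1)\<^sup>2)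
      \<le> 2 / real n * (11 / 10 * T) * ((P / 4 + 5 / 2 * (T * Q / 500 / (9 / 10 * T))) * (10 / 9)) + T / (1000 * real n) * (P + Q)"
      using bias_bound[OF lam1 \<psi>] unfolding P_def[symmetric] PQ .
    \<comment> \<open>11/18 = 2.2 * (1/4) * (10/9) is the decisive coefficient: with the extra
      1/1000 it is about 0.612, well below 1.\<close>
    also have "\<dots> = T / real n * (11 / 18 * P + 11 / 810 * Q + (P + Q) / 1000)"
      using T n0 by (simp add: field_simps)
    also have "\<dots> \<le> T / real n * (P + Q)"
    proof (rule mult_left_mono)
      show "11 / 18 * P + 11 / 810 * Q + (P + Q) / 1000 \<le> P + Q" using P0 Q0 by argo
    qed (use T in simp)
    also have "\<dots> \<le> b\<^sup>2" using b(2) PQ by simp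
    finally show ?thesis .
  qed
  show ?thesis
    by (rule bias_variance_combine[OF finSB _ \<sigma> b(1) \<theta>0 \<theta>(2) bias var]) (rule m_nonneg)
qed

section \<open>Numerical constants and eigenvalue counts\<close>

lemma rate_bounds:
  fixes n k :: nat and L R r :: real
  assumes n: "0 < n" and L: "1 / 2 \<le> L" and R: "0 < R" and r: "0 \<le> r"
  defines "\<gamma> \<equiv> 66 * (sqrt (L / r) + sqrt (L / real n) + sqrt (real k / real n))"
    and "\<epsilon> \<equiv> 10 ^ 12 * (sqrt (L / r) + sqrt (L / real n) + real n * L / R)"
  assumes \<gamma>: "\<gamma> \<le> 1" and \<epsilon>: "\<epsilon> \<le> 1"
  shows "4356 * real k \<le> real n" "10 ^ 12 * L \<le> real n" "10 ^ 12 * (real n * L) \<le> R"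
    "36 * (real k / real n) + 10 ^ 9 * (real n * L / R) + 144 * (L / real n) \<le> \<gamma> + \<epsilon>" "0 \<le> \<gamma>" "0 \<le> \<epsilon>"
proof -
  have n0: "real n > 0" using n by simp
  have nn: "0 \<le> sqrt (L / r)" "0 \<le> sqrt (L / real n)" "0 \<le> sqrt (real k / real n)" "0 \<le> real n * L / R"
    using L r R by auto
  show "0 \<le> \<gamma>" "0 \<le> \<epsilon>" using nn by (simp_all add: \<gamma>_def \<epsilon>_def)
  have lin: "c \<le> 1 / C" if "0 \<le> a" "0 \<le> b" "C * (a + b + c) \<le> 1" "C > 0" for a b c C :: real
  proof -
    have "C * c \<le> C * (a + b + c)" using that by (intro mult_left_mono) auto
    then have "C * c \<le> 1" using that(3) by linarith
    then show ?thesis using that(4) by (simp add: pos_le_divide_eq mult.commute)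
  qed
  \<comment> \<open>Squaring this gives k <= n/4356, which leaves some room above the 4000 demanded
    by the isometry event.\<close>
  have sk: "sqrt (real k / real n) \<le> 1 / 66"
    by (rule lin[OF nn(1,2) \<gamma>[unfolded \<gamma>_def]]) simp
  have RL: "real n * L / R \<le> 1 / 10 ^ 12"
    by (rule lin[OF nn(1,2) \<epsilon>[unfolded \<epsilon>_def]]) simp
  have sL: "sqrt (L / real n) \<le> 1 / 10 ^ 12"
    by (rule lin[OF nn(1,4)]) (use \<epsilon>[unfolded \<epsilon>_def] in \<open>simp_all add: add_ac\<close>)
  have "(sqrt (real k / real n))\<^sup>2 \<le> (1 / 66)\<^sup>2" using sk nn by (intro power_mono) auto
  then have "real k / real n \<le> 1 / 4356" by (simp add: power_divide)
  then show "4356 * real k \<le> real n" using n0 by (simp add: pos_divide_le_eq)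
  \<comment> \<open>A number whose square root is at most 1 is at most that square root. In this way
    the linear rates of the noise term fit under the square roots in \<gamma> and
    \<epsilon>.\<close>
  have Ln: "L / real n = sqrt (L / real n) * sqrt (L / real n)" using L n0 by simp
  also have "\<dots> \<le> 1 * sqrt (L / real n)"
    by (rule mult_right_mono[OF order_trans[OF sL] nn(2)]) simp
  finally have Ls: "L / real n \<le> sqrt (L / real n)" by simp
  then have "L / real n \<le> 1 / 10 ^ 12" using sL by linarith
  then show "10 ^ 12 * L \<le> real n" using n0 by (simp add: pos_divide_le_eq)
  show "10 ^ 12 * (real n * L) \<le> R" using RL R by (simp add: pos_divide_le_eq)
  have "real k / real n = sqrt (real k / real n) * sqrt (real k / real n)" by simp
  also have "\<dots> \<le> 1 * sqrt (real k / real n)"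
    by (rule mult_right_mono[OF order_trans[OF sk] nn(3)]) simp
  finally have ks: "real k / real n \<le> sqrt (real k / real n)" by simp
  show "36 * (real k / real n) + 10 ^ 9 * (real n * L / R) + 144 * (L / real n) \<le> \<gamma> + \<epsilon>"
  proof -
    have "36 * a + 10 ^ 9 * x + 144 * y \<le> 66 * (u + v + s) + 10 ^ 12 * (u + v + x)"
      if "a \<le> s" "y \<le> v" "0 \<le> u" "0 \<le> v" "0 \<le> s" "0 \<le> x" for a x y u v s :: real
      using that by simp
    from this[OF ks Ls nn] show ?thesis unfolding \<gamma>_def \<epsilon>_def .
  qed
qed

text \<open>Markov's inequality: on \<open>P\<close> the ratio 1000 n m j / T exceeds 1, so the
  count is bounded by the sum of its squares and the trace over \<open>P\<close> by 1000 n / T times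
  the sum of squared eigenvalues. Since T^2 over that sum is R, both are small when R is much larger
  than n.\<close>

lemma split_eigenvalue_counts:
  fixes m :: "nat \<Rightarrow> real" and n d :: nat and T :: real
  assumes m: "\<And>j. j < d \<Longrightarrow> 0 \<le> m j" and T: "T = (\<Sum>j<d. m j)" "T > 0" and n: "0 < n"
    and V: "5 * 10 ^ 11 * real n * (\<Sum>j<d. (m j)\<^sup>2) \<le> T\<^sup>2"
  defines "P \<equiv> {j. j < d \<and> T < 1000 * real n * m j}" and "B \<equiv> {j. j < d \<and> 0 < m j \<and> 1000 * real n * m j \<le> T}"
  shows "real (card P) * T\<^sup>2 \<le> 10 ^ 6 * (real n)\<^sup>2 * (\<Sum>j<d. (m j)\<^sup>2)" "99 / 100 * T \<le> (\<Sum>j\<in>B. m j)" "(\<Sum>j\<in>B. m j) \<le> T"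
proof -
  have n0: "real n > 0" using n by simp
  have fin: "finite P" "finite B" by (simp_all add: P_def B_def)
  have PB: "P \<inter> B = {}" by (auto simp: P_def B_def)
  have "(\<Sum>j\<in>P. T\<^sup>2) \<le> (\<Sum>j\<in>P. (1000 * real n * m j)\<^sup>2)"
    using T(2) by (intro sum_mono power_mono) (auto simp: P_def)
  also have "\<dots> = 10 ^ 6 * (real n)\<^sup>2 * (\<Sum>j\<in>P. (m j)\<^sup>2)" by (simp add: power_mult_distrib sum_distrib_left)
  also have "\<dots> \<le> 10 ^ 6 * (real n)\<^sup>2 * (\<Sum>j<d. (m j)\<^sup>2)" by (intro mult_left_mono sum_mono2) (auto simp: P_def)
  finally show "real (card P) * T\<^sup>2 \<le> 10 ^ 6 * (real n)\<^sup>2 * (\<Sum>j<d. (m j)\<^sup>2)" by simp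
  have "T = (\<Sum>j\<in>P \<union> B. m j)"
    unfolding T(1)
  proof (rule sum.mono_neutral_right)
    show "\<forall>j\<in>{..<d} - (P \<union> B). m j = 0"
    proof
      fix j assume j: "j \<in> {..<d} - (P \<union> B)"
      then show "m j = 0" using m[of j] by (cases "0 < m j") (auto simp: P_def B_def not_less not_le)
    qed
  qed (auto simp: P_def B_def)
  then have TPB: "T = (\<Sum>j\<in>P. m j) + (\<Sum>j\<in>B. m j)" by (simp add: sum.union_disjoint[OF fin PB])
  have P0: "0 \<le> (\<Sum>j\<in>P. m j)" using m by (intro sum_nonneg) (auto simp: P_def)
  then show "(\<Sum>j\<in>B. m j) \<le> T" using TPB by linarith
  have "T * (\<Sum>j\<in>P. m j) \<le> (\<Sum>j\<in>P. 1000 * real n * (m j)\<^sup>2)"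
    unfolding sum_distrib_left
  proof (rule sum_mono)
    fix j assume "j \<in> P"
    then have "T \<le> 1000 * real n * m j" "0 \<le> m j" using m by (auto simp: P_def)
    then have "T * m j \<le> (1000 * real n * m j) * m j" by (rule mult_right_mono)
    then show "T * m j \<le> 1000 * real n * (m j)\<^sup>2" by (simp add: power2_eq_square mult.assoc)
  qed
  also have "\<dots> \<le> 1000 * real n * (\<Sum>j<d. (m j)\<^sup>2)"
    unfolding sum_distrib_left[symmetric] by (intro mult_left_mono sum_mono2) (auto simp: P_def)
  also have "\<dots> \<le> T * (T / 100)"
  proof -
    have "100000 * (real n * (\<Sum>j<d. (m j)\<^sup>2)) \<le> 5 * 10 ^ 11 * (real n * (\<Sum>j<d. (m j)\<^sup>2))"
      by (intro mult_right_mono mult_nonneg_nonneg sum_nonneg) auto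
    also have "\<dots> \<le> T * T" using V by (simp add: power2_eq_square mult.assoc)
    finally show ?thesis by simp
  qed
  finally have "(\<Sum>j\<in>P. m j) \<le> T / 100" using T(2) by simp
  then show "99 / 100 * T \<le> (\<Sum>j\<in>B. m j)" using TPB by linarith
qed

text \<open>\<open>A\<close> is any factor with A A^T = \<Sigma>, not necessarily the symmetric
  root; the vectors are A^T e_j, and <A^T e_j, A^T e_l> = <e_j, \<Sigma> e_l>.\<close>

lemma design_coordinates_orthonormal:
  assumes e: "orthonormal_basis d e" and ev: "\<And>j. j < d \<Longrightarrow> eigenvector d \<Sigma> (m j) (e j)"
    and A: "\<forall>i<d. \<forall>j<d. (\<Sum>k<d. A i k * A j k) = \<Sigma> i j"
    and jl: "j < d" "l < d"
  shows "dot {..<d} (\<lambda>k. \<Sum>a<d. A a k * e j a) (\<lambda>k. \<Sum>a<d. A a k * e l a) = (if j = l then m l else 0)"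
proof -
  have "dot {..<d} (\<lambda>k. \<Sum>a<d. A a k * e j a) (\<lambda>k. \<Sum>b<d. A b k * e l b)
      = (\<Sum>a<d. \<Sum>b<d. dot {..<d} (\<lambda>k. A a k * e j a) (\<lambda>k. A b k * e l b))"
    by (simp add: dot_sum_left dot_sum_right)
  also have "\<dots> = (\<Sum>a<d. \<Sum>b<d. e j a * (\<Sigma> a b * e l b))"
  proof (intro sum.cong refl)
    fix a b assume "a \<in> {..<d}" "b \<in> {..<d}"
    have "dot {..<d} (\<lambda>k. A a k * e j a) (\<lambda>k. A b k * e l b) = (\<Sum>k<d. A a k * A b k) * (e j a * e l b)"
      by (simp add: dot_def sum_distrib_left mult_ac)
    then show "dot {..<d} (\<lambda>k. A a k * e j a) (\<lambda>k. A b k * e l b) = e j a * (\<Sigma> a b * e l b)"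
      using A \<open>a \<in> {..<d}\<close> \<open>b \<in> {..<d}\<close> by (simp add: mult_ac)
  qed
  also have "\<dots> = dot {..<d} (e j) (mvmul d \<Sigma> (e l))" by (simp add: dot_def mvmul_def sum_distrib_left)
  also have "\<dots> = dot {..<d} (e j) (\<lambda>i. m l * e l i)"
    using ev[OF jl(2)] by (intro dot_cong) (auto simp: eigenvector_def)
  also have "\<dots> = (if j = l then m l else 0)"
    using e jl by (simp add: dot_scale_right orthonormal_basis_def)
  finally show ?thesis .
qed

section \<open>Assembly of the risk bound\<close>

lemma benign_overfitting:
  fixes n d :: nat and \<sigma> \<delta> :: real
  assumes n: "0 < n" and psd: "psd d \<Sigma>" and A: "\<forall>i<d. \<forall>j<d. (\<Sum>k<d. A i k * A j k) = \<Sigma> i j"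
    and \<sigma>: "0 \<le> \<sigma>" and \<delta>: "0 < \<delta>" "\<delta> \<le> 1 / 2" and split: "cov_split d \<Sigma> \<Sigma>1 \<Sigma>2"
    and nz: "\<exists>i<d. \<exists>j<d. \<Sigma>2 i j \<noteq> 0"
  defines "\<gamma> \<equiv> 66 * (sqrt (ln (1/\<delta>) / eff_rank_r d \<Sigma>2) + sqrt (ln (1/\<delta>) / real n)
                      + sqrt (real (mrank d \<Sigma>1) / real n))"
    and "\<epsilon> \<equiv> 10 ^ 12 * (sqrt (ln (1/\<delta>) / eff_rank_r d \<Sigma>2) + sqrt (ln (1/\<delta>) / real n)
                      + real n * ln (1/\<delta>) / eff_rank_R d \<Sigma>2)"
  assumes \<gamma>: "\<gamma> \<le> 1" and \<epsilon>: "\<epsilon> \<le> 1"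
  shows "\<exists>E\<in>sets (sample_space n d). measure (sample_space n d) E \<ge> 1 - \<delta> \<and>
     (\<forall>\<omega>\<in>E. \<exists>w. min_norm_interp n d (design d A (fst \<omega>)) (response d A \<sigma> wstar \<omega>) w \<and>
         pop_loss d \<Sigma> \<sigma> wstar w
           \<le> (1 + \<gamma>) * (1 + \<epsilon>) * (\<sigma> + vnorm d wstar * sqrt (mtrace d \<Sigma>2 / real n))\<^sup>2)"
proof -
  obtain e m1 m2 where e: "orthonormal_basis d e"
    and ev1: "\<And>j. j < d \<Longrightarrow> eigenvector d \<Sigma>1 (m1 j) (e j)" and ev2: "\<And>j. j < d \<Longrightarrow> eigenvector d \<Sigma>2 (m2 j) (e j)"
    and m1: "\<And>j. j < d \<Longrightarrow> 0 \<le> m1 j" and m2: "\<And>j. j < d \<Longrightarrow> 0 \<le> m2 j"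
    and m12: "\<And>j. j < d \<Longrightarrow> m1 j = 0 \<or> m2 j = 0"
    using cov_split_eigenbasis[OF split] by blast
  have n0: "real n > 0" using n by simp
  define T where "T = mtrace d \<Sigma>2"
  have T: "T = (\<Sum>j<d. m2 j)" unfolding T_def by (rule mtrace_eigen[OF e ev2])
  define V where "V = (\<Sum>j<d. (m2 j)\<^sup>2)"
  have Vsq: "mtrace_sq d \<Sigma>2 = V" unfolding V_def by (rule mtrace_sq_eigen[OF e ev2])
  obtain j0 where j0: "j0 < d" "m2 j0 > 0"
  proof -
    have "\<exists>j<d. m2 j \<noteq> 0"
    proof (rule ccontr)
      assume "\<not> ?thesis"
      then have "\<Sigma>2 i l = 0" if "i < d" "l < d" for i l
        using spectral_decomposition[OF e ev2 that] by simp
      with nz show False by blast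
    qed
    then obtain j where j: "j < d" "m2 j \<noteq> 0" by blast
    then have "0 < m2 j" using m2[of j] by linarith
    with j(1) show ?thesis by (rule that)
  qed
  have T0: "T > 0" unfolding T using j0 m2 by (intro sum_pos2[of _ j0]) auto
  have V0: "V > 0" unfolding V_def using j0 by (intro sum_pos2[of _ j0]) auto
  define \<Lambda> where "\<Lambda> = ln (1 / \<delta>)"
  \<comment> \<open>A positive lower bound on \<Lambda> lets n / R be replaced by 2 n \<Lambda> / R,
    so that \<epsilon> <= 1 controls the bare ratio n / R as well.\<close>
  have \<Lambda>: "1 / 2 \<le> \<Lambda>"
  proof -
    have "1 / 2 \<le> ln (2 :: real)" using ln2_ge_two_thirds by simp
    also have "\<dots> \<le> \<Lambda>" unfolding \<Lambda>_def using \<delta> by (intro ln_mono) (auto simp: field_simps)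
    finally show ?thesis .
  qed
  define R where "R = eff_rank_R d \<Sigma>2"
  have RV: "R = T\<^sup>2 / V" by (simp add: R_def eff_rank_R_def Vsq T_def)
  have R0: "R > 0" using T0 V0 by (simp add: RV)
  have r0: "0 \<le> eff_rank_r d \<Sigma>2" using T0 op_norm_nonneg by (simp add: eff_rank_r_def T_def)
  have \<gamma>': "\<gamma> = 66 * (sqrt (\<Lambda> / eff_rank_r d \<Sigma>2) + sqrt (\<Lambda> / real n) + sqrt (real (mrank d \<Sigma>1) / real n))"
    and \<epsilon>': "\<epsilon> = 10 ^ 12 * (sqrt (\<Lambda> / eff_rank_r d \<Sigma>2) + sqrt (\<Lambda> / real n) + real n * \<Lambda> / R)"
    unfolding \<gamma>_def \<epsilon>_def \<Lambda>_def R_def by (rule refl)+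
  note rb = rate_bounds[OF n \<Lambda> R0 r0 \<gamma>[unfolded \<gamma>'] \<epsilon>[unfolded \<epsilon>'], folded \<gamma>' \<epsilon>']
  let ?k = "mrank d \<Sigma>1"
  have nR: "5 * 10 ^ 11 * real n \<le> R"
  proof -
    have "5 * 10 ^ 11 * real n = 10 ^ 12 * (real n * (1 / 2))" by simp
    also have "\<dots> \<le> 10 ^ 12 * (real n * \<Lambda>)" using \<Lambda> by (intro mult_left_mono) auto
    finally show ?thesis using rb(3) by linarith
  qed
  have nV: "5 * 10 ^ 11 * real n * V \<le> T\<^sup>2" using nR V0 by (simp add: RV pos_le_divide_eq)
  \<comment> \<open>The value 0 beyond \<open>d\<close> makes the eigenvalues nonnegative at every
    index, as the locale \<open>split_design\<close> asks.\<close>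
  define m where "m = (\<lambda>j. if j < d then m1 j + m2 j else 0)"
  have mnn: "0 \<le> m j" for j using m1 m2 by (simp add: m_def)
  have ev: "eigenvector d \<Sigma> (m j) (e j)" if "j < d" for j
    unfolding eigenvector_def
  proof (intro allI impI)
    fix i assume i: "i < d"
    have "mvmul d \<Sigma> (e j) i = mvmul d \<Sigma>1 (e j) i + mvmul d \<Sigma>2 (e j) i"
      using split i by (simp add: cov_split_def mvmul_def algebra_simps flip: sum.distrib)
    then show "mvmul d \<Sigma> (e j) i = m j * e j i"
      using ev1[OF that] ev2[OF that] i that by (simp add: eigenvector_def m_def algebra_simps)
  qed
  define P1 where "P1 = {j. j < d \<and> 0 < m1 j}"
  define P2 where "P2 = {j. j < d \<and> T < 1000 * real n * m2 j}"
  define B where "B = {j. j < d \<and> 0 < m2 j \<and> 1000 * real n * m2 j \<le> T}"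
  define S where "S = P1 \<union> P2"
  note cnt = split_eigenvalue_counts[OF m2 T T0 n nV[unfolded V_def], folded P2_def B_def V_def]
  have cP1: "card P1 \<le> ?k" unfolding P1_def by (rule card_pos_eigenvalues_le_mrank[OF e ev1])
  have cP2: "real (card P2) \<le> 10 ^ 6 * (real n * (real n / R))"
    using cnt(1) T0 V0 by (simp add: RV field_simps power2_eq_square)
  have nRs: "real n / R \<le> 2 / 10 ^ 12" using nR R0 by (simp add: field_simps)
  have p: "real (card S) \<le> real ?k + 10 ^ 6 * (real n * (real n / R))"
  proof -
    have "real (card S) \<le> real (card P1) + real (card P2)"
      unfolding S_def using card_Un_le[of P1 P2] by (simp flip: of_nat_add)
    then show ?thesis using cP1 cP2 by linarith
  qed
  have p4000: "4000 * card S \<le> n"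
  proof -
    \<comment> \<open>At most n/4356 directions come from \<Sigma>1 and at most 2 n / 10^6 from the
      large eigenvalues of \<Sigma>2; 4000 times the total is still below n.\<close>
    have "10 ^ 6 * (real n * (real n / R)) \<le> 10 ^ 6 * (real n * (2 / 10 ^ 12))"
      using nRs n0 by (intro mult_left_mono) auto
    then have "4000 * real (card S) \<le> real n" using p rb(1) by simp
    then show ?thesis by linarith
  qed
  have finS: "finite S" and finB: "finite B" by (simp_all add: S_def P1_def P2_def B_def)
  have SB: "S \<subseteq> {..<d}" "B \<subseteq> {..<d}" by (auto simp: S_def P1_def P2_def B_def)
  have disj: "S \<inter> B = {}" using m12 by (fastforce simp: S_def P1_def P2_def B_def)
  have mB2: "m j = m2 j" if "j \<in> B" for j using m12[of j] that by (auto simp: B_def m_def)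
  have mB: "1000 * real n * m j \<le> T" if "j \<in> B" for j using mB2[OF that] that by (simp add: B_def)
  have m0: "m j = 0" if "j < d" "j \<notin> S \<union> B" for j
    using that m1[of j] m2[of j] by (auto simp: S_def P1_def P2_def B_def m_def not_less not_le)
  have mpos: "m j > 0" if "j \<in> S \<union> B" for j
  proof (cases "j \<in> P2")
    case True
    then have "0 < 1000 * real n * m2 j" using T0 by (auto simp: P2_def)
    then have "0 < m2 j" using n0 by (simp add: zero_less_mult_iff)
    then show ?thesis using True m1[of j] by (simp add: P2_def m_def add_nonneg_pos)
  next
    case False
    then show ?thesis using that m1[of j] m2[of j] by (auto simp: S_def P1_def B_def m_def add_nonneg_pos add_pos_nonneg)
  qed
  have TB: "99 / 100 * T \<le> (\<Sum>j\<in>B. m j)" "(\<Sum>j\<in>B. m j) \<le> T" using cnt(2,3) mB2 by simp_all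
  define VB where "VB = (\<Sum>j\<in>B. (m j)\<^sup>2)"
  have VB0: "0 \<le> VB" by (simp add: VB_def sum_nonneg)
  have VBV: "VB \<le> V"
  proof -
    have "VB = (\<Sum>j\<in>B. (m2 j)\<^sup>2)" using mB2 by (simp add: VB_def)
    also have "\<dots> \<le> V" unfolding V_def using SB by (intro sum_mono2) auto
    finally show ?thesis .
  qed
  have VB: "250000 * real n * (\<Sum>j\<in>B. (m j)\<^sup>2) \<le> T\<^sup>2"
  proof -
    have "250000 * real n * VB \<le> 5 * 10 ^ 11 * real n * V"
      using VBV VB0 n0 by (intro mult_mono) auto
    also note nV
    finally show ?thesis unfolding VB_def .
  qed
  have n\<delta>: "2000 * ln (1 / \<delta>) \<le> real n" using rb(2) \<Lambda> by (simp add: \<Lambda>_def)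
  define F where "F = (\<lambda>j k. \<Sum>a<d. A a k * e j a)"
  have FF: "dot {..<d} (F j) (F l) = (if j = l then m l else 0)" if "j < d" "l < d" for j l
    unfolding F_def by (rule design_coordinates_orthonormal[OF e ev A that])
  \<comment> \<open>The vectors A^T e_j have squared length m j; normalising them yields the
    orthonormal family, and \<open>mpos\<close> guarantees that no division by 0 occurs on S and
    B.\<close>
  define f where "f = (\<lambda>j k. (1 / sqrt (m j)) * F j k)"
  interpret gaussian_coordinates n d f "S \<union> B"
  proof
    show "finite (S \<union> B)" using finS finB by simp
    fix j l assume jl: "j \<in> S \<union> B" "l \<in> S \<union> B"
    then have "j < d" "l < d" using SB by auto
    then have "dot {..<d} (f j) (f l) = (1 / sqrt (m j)) * ((1 / sqrt (m l)) * (if j = l then m l else 0))"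
      unfolding f_def dot_scale_left dot_scale_right by (simp only: FF)
    then show "dot {..<d} (f j) (f l) = (if j = l then 1 else 0)"
      using mpos[OF jl(2)] by (auto simp: field_simps)
  qed
  define h where "h = (\<lambda>Z j i. sqrt (m j) * coord d f Z j i)"
  define w0 where "w0 = (\<lambda>j. dot {..<d} (e j) wstar)"
  obtain E where E: "E \<in> sets (sample_space n d)" "measure (sample_space n d) E \<ge> 1 - \<delta>"
    and Ev: "\<And>\<omega>. \<omega> \<in> E \<Longrightarrow>
     split_design {..<n} S B (h (fst \<omega>)) m (2 / real n) (9 / 10 * T) (11 / 10 * T) (T / (1000 * real n)) \<and>
     dot {..<n} (comb B (h (fst \<omega>)) w0) (comb B (h (fst \<omega>)) w0) \<le> 2 * real n * (\<Sum>j\<in>B. m j * (w0 j)\<^sup>2) \<and>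
     (\<exists>z. (\<forall>i<n. gram {..<n} B (h (fst \<omega>)) z i = snd \<omega> i) \<and>
        (\<Sum>j\<in>S. (dot {..<n} (coord d f (fst \<omega>) j) z)\<^sup>2) \<le> 4 * (3 * real n / 2 / (9 / 10 * T)\<^sup>2) * (real (card S) + 4 * \<Lambda>) \<and>
        (\<Sum>j\<in>B. m j * (dot {..<n} (h (fst \<omega>) j) z)\<^sup>2) \<le> 4 * (2 * real n * VB / (9 / 10 * T)\<^sup>2) * (5 * \<Lambda>))"
    using design_events[where m = m and w = w0, OF n _ _ disj mnn p4000 T0 TB mB VB \<delta> n\<delta>]
    unfolding h_def \<Lambda>_def VB_def by blast
  define b where "b = vnorm d wstar * sqrt (T / real n)"
  have b0: "0 \<le> b" using T0 by (simp add: b_def vnorm_def sum_nonneg)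
  have b2: "T / real n * (\<Sum>j\<in>S \<union> B. (w0 j)\<^sup>2) \<le> b\<^sup>2"
  proof -
    have "(\<Sum>j\<in>S \<union> B. (w0 j)\<^sup>2) \<le> (\<Sum>j<d. (w0 j)\<^sup>2)" using SB by (intro sum_mono2) auto
    also have "\<dots> = dot {..<d} wstar wstar"
      unfolding orthonormal_Parseval[OF e, of wstar wstar] by (simp add: w0_def power2_eq_square)
    finally have "T / real n * (\<Sum>j\<in>S \<union> B. (w0 j)\<^sup>2) \<le> T / real n * dot {..<d} wstar wstar"
      using T0 by (intro mult_left_mono) auto
    also have "\<dots> = b\<^sup>2" using T0 dot_self_nonneg[of "{..<d}" wstar]
      by (simp add: b_def vnorm_dot power_mult_distrib)
    finally show ?thesis .
  qed
  define \<theta> where "\<theta> = 36 * (real (card S) + 4 * \<Lambda>) / real n + 100 * real n * VB * \<Lambda> / T\<^sup>2"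
  have \<theta>le: "\<theta> \<le> 36 * (real ?k / real n) + 10 ^ 9 * (real n * \<Lambda> / R) + 144 * (\<Lambda> / real n)"
  proof -
    have "real (card S) / real n \<le> (real ?k + 10 ^ 6 * (real n * (real n / R))) / real n"
      using p by (intro divide_right_mono) auto
    also have "\<dots> = real ?k / real n + 10 ^ 6 * (real n / R)" using n0 by (simp add: add_divide_distrib)
    \<comment> \<open>The number of additional directions, of order n^2 / R, becomes after division
      by n the third term of \<epsilon>, since 1 <= 2 \<Lambda>.\<close>
    also have "real n / R \<le> 2 * (real n * \<Lambda> / R)"
    proof -
      have "real n * 1 \<le> real n * (2 * \<Lambda>)" using \<Lambda> n0 by (intro mult_left_mono) auto
      then have "real n / R \<le> real n * (2 * \<Lambda>) / R" using R0 by (intro divide_right_mono) auto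
      then show ?thesis by (simp add: mult_ac)
    qed
    finally have c: "real (card S) / real n \<le> real ?k / real n + 10 ^ 6 * (2 * (real n * \<Lambda> / R))" by simp
    have "VB * (real n * \<Lambda>) \<le> V * (real n * \<Lambda>)" using VBV n0 \<Lambda> by (intro mult_right_mono) auto
    then have "real n * VB * \<Lambda> / T\<^sup>2 \<le> V * (real n * \<Lambda>) / T\<^sup>2" by (intro divide_right_mono) (auto simp: mult_ac)
    also have "\<dots> = real n * \<Lambda> / R" by (simp add: RV)
    finally have v: "real n * VB * \<Lambda> / T\<^sup>2 \<le> real n * \<Lambda> / R" .
    have lin: "t \<le> 36 * k + 10 ^ 9 * x + 144 * y"
      if "t = 36 * s + 144 * y + 100 * v" "0 \<le> x" "s \<le> k + 10 ^ 6 * (2 * x)" "v \<le> x" for t s y v x k :: real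
      using that by simp
    have "\<theta> = 36 * (real (card S) / real n) + 144 * (\<Lambda> / real n) + 100 * (real n * VB * \<Lambda> / T\<^sup>2)"
      by (simp add: \<theta>_def add_divide_distrib algebra_simps)
    moreover have "0 \<le> real n * \<Lambda> / R" using n0 \<Lambda> R0 by simp
    ultimately show ?thesis using c v by (rule lin)
  qed
  have \<theta>1: "\<theta> \<le> 1"
  proof -
    have lin: "t \<le> 1" if "k \<le> 1 / 4356" "y \<le> 1 / 10 ^ 12" "x \<le> 1 / 10 ^ 12" "t \<le> 36 * k + 10 ^ 9 * x + 144 * y"
      for t k x y :: real
      using that by simp
    have "real ?k / real n \<le> 1 / 4356" using rb(1) n0 by (simp add: pos_divide_le_eq)
    moreover have "\<Lambda> / real n \<le> 1 / 10 ^ 12" using rb(2) n0 by (simp add: pos_divide_le_eq)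
    moreover have "real n * \<Lambda> / R \<le> 1 / 10 ^ 12" using rb(3) R0 by (simp add: pos_divide_le_eq)
    ultimately show ?thesis using \<theta>le by (rule lin)
  qed
  \<comment> \<open>Only \<theta> <= \<gamma> + \<epsilon> is required; the product supplies the
    remaining nonnegative term \<gamma> \<epsilon>.\<close>
  have \<theta>2: "1 + \<theta> \<le> (1 + \<gamma>) * (1 + \<epsilon>)"
  proof -
    have "\<theta> \<le> \<gamma> + \<epsilon>" using \<theta>le rb(4) by linarith
    moreover have "0 \<le> \<gamma> * \<epsilon>" using rb(5,6) by simp
    ultimately show ?thesis by (simp add: algebra_simps)
  qed
  have "\<exists>w. min_norm_interp n d (design d A (fst \<omega>)) (response d A \<sigma> wstar \<omega>) w \<and>
         pop_loss d \<Sigma> \<sigma> wstar w \<le> (1 + \<gamma>) * (1 + \<epsilon>) * (\<sigma> + b)\<^sup>2" if \<omega>: "\<omega> \<in> E" for \<omega>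
  proof -
    let ?Z = "fst \<omega>" and ?h = "h (fst \<omega>)" and ?X = "design d A (fst \<omega>)"
    obtain z where sd: "split_design {..<n} S B ?h m (2 / real n) (9 / 10 * T) (11 / 10 * T) (T / (1000 * real n))"
      and cw: "dot {..<n} (comb B ?h w0) (comb B ?h w0) \<le> 2 * real n * (\<Sum>j\<in>B. m j * (w0 j)\<^sup>2)"
      and z: "\<And>i. i \<in> {..<n} \<Longrightarrow> gram {..<n} B ?h z i = snd \<omega> i"
      and z6: "(\<Sum>j\<in>S. (dot {..<n} (coord d f ?Z j) z)\<^sup>2) \<le> 4 * (3 * real n / 2 / (9 / 10 * T)\<^sup>2) * (real (card S) + 4 * \<Lambda>)"
      and z7: "(\<Sum>j\<in>B. m j * (dot {..<n} (?h j) z)\<^sup>2) \<le> 4 * (2 * real n * VB / (9 / 10 * T)\<^sup>2) * (5 * \<Lambda>)"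
      using Ev[OF \<omega>] by auto
    interpret sd: split_design "{..<n}" S B ?h m "2 / real n" "9 / 10 * T" "11 / 10 * T" "T / (1000 * real n)" by (rule sd)
    have surj: "\<exists>x. \<forall>i\<in>{..<n}. gram {..<n} (S \<union> B) ?h x i = y i" for y
      by (rule gram_surj[OF finite_lessThan sd.c(1) sd.full_gram_ge])
    obtain lam1 where lam1: "\<And>i. i \<in> {..<n} \<Longrightarrow> gram {..<n} (S \<union> B) ?h lam1 i = comb (S \<union> B) ?h w0 i"
      using surj by blast
    obtain lam2 where lam2: "\<And>i. i \<in> {..<n} \<Longrightarrow> gram {..<n} (S \<union> B) ?h lam2 i = snd \<omega> i"
      using surj by blast
    have eF: "dot {..<d} (e j) (?X i) = dot {..<d} (F j) (\<lambda>k. ?Z (i, k))" for i j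
    proof -
      have "dot {..<d} (e j) (?X i) = (\<Sum>a<d. \<Sum>k<d. e j a * (A a k * ?Z (i, k)))"
        by (simp add: dot_def design_def sum_distrib_left)
      also have "\<dots> = (\<Sum>k<d. \<Sum>a<d. e j a * (A a k * ?Z (i, k)))" by (rule sum.swap)
      also have "\<dots> = dot {..<d} (F j) (\<lambda>k. ?Z (i, k))"
        unfolding F_def dot_def sum_distrib_right by (simp only: mult_ac)
      finally show ?thesis .
    qed
    \<comment> \<open>A direction of eigenvalue 0 has A^T e_j = 0, so the design vanishes along it
      for every outcome and not merely almost surely.\<close>
    have F0: "F j k = 0" if "j < d" "j \<notin> S \<union> B" "k < d" for j k
    proof -
      have "dot {..<d} (F j) (F j) = 0" using FF[OF that(1) that(1)] m0[OF that(1,2)] by simp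
      then show ?thesis using that(3) by (simp add: dot_self_eq_0)
    qed
    have h_eq: "dot {..<d} (e j) (?X i) = ?h j i" if "j < d" "i < n" for i j
    proof (cases "j \<in> S \<union> B")
      case True
      have "?h j i = sqrt (m j) * ((1 / sqrt (m j)) * dot {..<d} (F j) (\<lambda>k. ?Z (i, k)))"
        unfolding h_def coord_dot unfolding f_def dot_scale_left ..
      then show ?thesis using mpos[OF True] by (simp add: eF)
    next
      case False
      then have "dot {..<d} (F j) (\<lambda>k. ?Z (i, k)) = 0" using F0[OF that(1)] by (simp add: dot_def)
      moreover have "?h j i = 0" using m0[OF that(1) False] by (simp add: h_def)
      ultimately show ?thesis by (simp add: eF)
    qed
    have sym: "\<forall>i<d. \<forall>j<d. \<Sigma> i j = \<Sigma> j i" using psd by (simp add: psd_def)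
    have h0: "?h j i = 0" if "j < d" "j \<notin> S \<union> B" "i < n" for i j using m0[OF that(1,2)] by (simp add: h_def)
    have Y: "response d A \<sigma> wstar \<omega> i = mvmul d ?X wstar i + \<sigma> * snd \<omega> i" for i by (simp add: response_def)
    obtain w where w: "min_norm_interp n d ?X (response d A \<sigma> wstar \<omega>) w"
      and loss: "pop_loss d \<Sigma> \<sigma> wstar w = \<sigma>\<^sup>2 + (\<Sum>j\<in>S \<union> B. m j *
        (\<sigma> * dot {..<n} (?h j) lam2 - (w0 j - dot {..<n} (?h j) lam1))\<^sup>2)"
      using min_norm_interpolator_risk[where n = n and m = m and h = ?h and X = ?X and e = e and g = "snd \<omega>"
          and Y = "response d A \<sigma> wstar \<omega>" and \<sigma> = \<sigma> and lamw = lam1 and lamg = lam2,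
          OF e ev sym h_eq SB m0 h0 Y] lam1 lam2 unfolding w0_def by auto
    have "pop_loss d \<Sigma> \<sigma> wstar w \<le> (1 + \<theta>) * (\<sigma> + b)\<^sup>2"
      unfolding loss
    proof (rule split_design_risk[OF sd n T0 _ \<sigma> cw z _ z6 z7 VB0 lam1 lam2 _ \<theta>1 b0 b2])
      show "0 \<le> \<Lambda>" using \<Lambda> by simp
      show "?h j i = sqrt (m j) * coord d f ?Z j i" for j i by (simp add: h_def)
      show "36 * (real (card S) + 4 * \<Lambda>) / real n + 100 * real n * VB * \<Lambda> / T\<^sup>2 \<le> \<theta>" by (simp add: \<theta>_def)
    qed
    also have "\<dots> \<le> (1 + \<gamma>) * (1 + \<epsilon>) * (\<sigma> + b)\<^sup>2" using \<theta>2 by (intro mult_right_mono) auto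
    finally show ?thesis using w by blast
  qed
  then show ?thesis using E unfolding b_def T_def by blast
qed

theorem theorem3:
  shows "\<exists>C1 C c :: real. 0 < C1 \<and> C1 \<le> 66 \<and> 0 < C \<and> 0 < c \<and>
    (\<forall>(n::nat) (d::nat) \<Sigma> \<Sigma>1 \<Sigma>2 A wstar (\<sigma>::real) (\<delta>::real).
      0 < n \<longrightarrow> n \<le> d \<longrightarrow>
      psd d \<Sigma> \<longrightarrow>
      (\<forall>i<d. \<forall>j<d. (\<Sum>k<d. A i k * A j k) = \<Sigma> i j) \<longrightarrow>
      0 \<le> \<sigma> \<longrightarrow>
      0 < \<delta> \<longrightarrow> \<delta> \<le> 1/2 \<longrightarrow>
      cov_split d \<Sigma> \<Sigma>1 \<Sigma>2 \<longrightarrow>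
      (\<exists>i<d. \<exists>j<d. \<Sigma>2 i j \<noteq> 0) \<longrightarrow>
      (let \<gamma> = C1 * (sqrt (ln (1/\<delta>) / eff_rank_r d \<Sigma>2) + sqrt (ln (1/\<delta>) / real n)
                      + sqrt (real (mrank d \<Sigma>1) / real n));
           \<epsilon> = C * (sqrt (ln (1/\<delta>) / eff_rank_r d \<Sigma>2) + sqrt (ln (1/\<delta>) / real n)
                      + real n * ln (1/\<delta>) / eff_rank_R d \<Sigma>2)
       in c * (ln (1/\<delta>))\<^sup>2 \<le> eff_rank_R d \<Sigma>2 \<longrightarrow> \<gamma> \<le> 1 \<longrightarrow> \<epsilon> \<le> 1 \<longrightarrow>
          (\<exists>E \<in> sets (sample_space n d). measure (sample_space n d) E \<ge> 1 - \<delta> \<and>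
             (\<forall>\<omega>\<in>E. \<exists>w. min_norm_interp n d (design d A (fst \<omega>)) (response d A \<sigma> wstar \<omega>) w \<and>
                 pop_loss d \<Sigma> \<sigma> wstar w
                   \<le> (1 + \<gamma>) * (1 + \<epsilon>) * (\<sigma> + vnorm d wstar * sqrt (mtrace d \<Sigma>2 / real n))\<^sup>2))))"
  unfolding Let_def
  \<comment> \<open>66 is the largest admissible value of \<open>C1\<close> and thus gives the
    strongest bound on the rank; \<open>C\<close> is free and is taken large enough for all crude
    constants.\<close>
  by (rule exI[of _ 66], rule exI[of _ "10 ^ 12"], rule exI[of _ 1])
    (intro conjI allI impI benign_overfitting; simp)

end
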